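(* Let $\mathcal{F}\subset\mathcal{D}'$ be an $A$-submodule which is an injective cogenerator and satisfies the cutoff assumption (stated in the context), and let $P$ be a proper $A$-submodule of $A^k$. Then $\mathrm{Ker}_{\mathcal{F}}(P)$ can be written as the sum of its controllable part and an uncontrollable sub-system.
   Context: $A=\mathbb{C}[D_1,\ldots,D_n]$, $D_j=\frac{1}{\imath}\partial_j$, is the ring of constant coefficient partial differential operators on $\mathbb{R}^n$, acting by differentiation on the space $\mathcal{D}'$ of distributions on $\mathbb{R}^n$. For a submodule $P\subset A^k$, $\mathrm{Ker}_{\mathcal{F}}(P)=\{f\in\mathcal{F}^k : \sum_j p_j(D)f_j=0 \text{ for all } (p_1,\ldots,p_k)\in P\}$; such subspaces of $\mathcal{F}^k$ are called systems, and a sub-system of a system is a system contained in it. An injective $A$-module $\mathcal{F}$ is a cogenerator if $\mathrm{Hom}_A(M,\mathcal{F})\neq 0$ for every nonzero $A$-module $M$. A disjoint pair $U_1,U_2\subset\mathbb{R}^n$ with non-intersecting closures is admissible with respect to $\mathcal{F}$ if for any $f_1,f_2\in\mathcal{F}$ there is $f\in\mathcal{F}$ with $f=f_1$ on some neighbourhood of $U_1$ and $f=f_2$ on some neighbourhood of $U_2$. A system $B$ is controllable if for every admissible pair $U_1,U_2$ and any $f_1,f_2\in B$ there is $f\in B$ with $f=f_1$ on some neighbourhood of $U_1$ and $f=f_2$ on some neighbourhood of $U_2$. A system is uncontrollable if none of its nonzero sub-systems is controllable (the zero system is vacuously both controllable and uncontrollable). The controllable part of $\mathrm{Ker}_{\mathcal{F}}(P)$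 is its largest controllable sub-system, i.e. the controllable sub-system containing every other controllable sub-system; it equals $\mathrm{Ker}_{\mathcal{F}}(P_0)$ with $P_0=\{x\in A^k : ax\in P \text{ for some } 0\neq a\in A\}$. Cutoff assumption on $\mathcal{F}$: for every bounded $V\subset\mathbb{R}^n$ with nonempty interior there is a nonempty subset $U$ whose closure is contained in the interior of $V$ such that the pair $U,\ \mathbb{R}^n\setminus V$ is admissible with respect to $\mathcal{F}$. *)

theory Defs
  imports
    "HOL-Analysis.Analysis"
    "HOL-Library.Poly_Mapping"
    "HOL-Algebra.Algebraic_Closure_Type"
begin

section \<open>Distributions on \<open>\<real>\<^sup>n\<close>\<close>

definition partial :: "'n::finite \<Rightarrow> (real^'n \<Rightarrow> complex) \<Rightarrow> real^'n \<Rightarrow> complex" where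
  "partial j \<phi> = (\<lambda>x. frechet_derivative \<phi> (at x) (axis j 1))"

definition smooth :: "(real^'n::finite \<Rightarrow> complex) \<Rightarrow> bool" where
  "smooth \<phi> \<longleftrightarrow> (\<forall>js x. foldr partial js \<phi> differentiable (at x))"

definition supp :: "(real^'n::finite \<Rightarrow> complex) \<Rightarrow> (real^'n) set" where
  "supp \<phi> = closure (support_on UNIV \<phi>)"

definition test_functions :: "(real^'n::finite \<Rightarrow> complex) set" where
  "test_functions = {\<phi>. smooth \<phi> \<and> compact (supp \<phi>)}"

text \<open>The usual seminorm estimate on each compact set. Mixed partial derivatives of order at most
  \<open>N\<close> are indexed by lists of coordinates instead of multi-indices; each of them is then counted
  finitely often, which only affects the constant \<open>C\<close>.\<close>
definition test_continuous :: "((real^'n::finite \<Rightarrow> complex) \<Rightarrow> complex) \<Rightarrow> bool" where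
  "test_continuous T \<longleftrightarrow>
     (\<forall>K. compact K \<longrightarrow> (\<exists>C\<ge>0. \<exists>N. \<forall>\<phi>\<in>test_functions. supp \<phi> \<subseteq> K \<longrightarrow>
        cmod (T \<phi>) \<le> C * (\<Sum>js\<in>{js. length js \<le> N}. SUP x. cmod (foldr partial js \<phi> x))))"

text \<open>A distribution is a functional on test functions; it is extended by \<open>0\<close> to all other
  functions, so that equality of distributions is equality on test functions.\<close>
typedef (overloaded) ('n::finite) distribution =
  "{T :: (real^'n \<Rightarrow> complex) \<Rightarrow> complex.
      (\<forall>\<phi>\<in>test_functions. \<forall>\<psi>\<in>test_functions. T (\<lambda>x. \<phi> x + \<psi> x) = T \<phi> + T \<psi>) \<and>
      (\<forall>c. \<forall>\<phi>\<in>test_functions. T (\<lambda>x. c * \<phi> x) = c * T \<phi>) \<and>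
      test_continuous T \<and> (\<forall>\<phi>. \<phi> \<notin> test_functions \<longrightarrow> T \<phi> = 0)}"
  morphisms apply_dist Abs_distribution
  by (rule exI[of _ "\<lambda>_. 0"]) (auto simp: test_continuous_def intro!: exI[of _ "0::real"])

setup_lifting type_definition_distribution

lemma finite_lists: "finite {js :: 'n::finite list. length js \<le> N}"
  using finite_lists_length_le[of "UNIV :: 'n set" N] by simp

lemma supp_partial: "supp (partial j \<phi>) \<subseteq> supp \<phi>"
proof -
  have "partial j \<phi> x = 0" if "x \<notin> supp \<phi>" for x
  proof -
    have "(\<phi> has_derivative (\<lambda>_. 0)) (at x)"
    proof (rule has_derivative_transform_within_open[of "\<lambda>_. 0" _ _ _ "- supp \<phi>"])
      show "0 = \<phi> y" if "y \<in> - supp \<phi>" for y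
        using that closure_subset[of "support_on UNIV \<phi>"] by (auto simp: supp_def in_support_on)
    qed (use that in \<open>auto simp: supp_def\<close>)
    then show ?thesis
      by (simp add: partial_def flip: frechet_derivative_at)
  qed
  then have "support_on UNIV (partial j \<phi>) \<subseteq> supp \<phi>"
    unfolding support_on_def by blast
  then show ?thesis
    unfolding supp_def[of "partial j \<phi>"] by (rule closure_minimal) (simp add: supp_def)
qed

lemma supp_foldr_partial: "supp (foldr partial js \<phi>) \<subseteq> supp \<phi>"
  by (induction js) (use supp_partial in fastforce)+

lemma partial_test: "partial j \<phi> \<in> test_functions" if "\<phi> \<in> test_functions"
proof -
  have "foldr partial js (partial j \<phi>) differentiable at x" for js x
    using that[unfolded test_functions_def smooth_def, simplified] 
    by (metis (no_types, lifting) comp_apply foldr_Cons foldr_Nil foldr_append id_apply)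
  moreover have "compact (supp (partial j \<phi>))"
    using that supp_partial[of j \<phi>]
    by (metis (no_types, lifting) closed_closure compact_Int_closed inf.absorb_iff2 mem_Collect_eq
        supp_def test_functions_def)
  ultimately show ?thesis by (simp add: test_functions_def smooth_def)
qed

lemma differentiable_foldr_partial:
  "\<phi> \<in> test_functions \<Longrightarrow> foldr partial js \<phi> differentiable (at x)"
  by (simp add: test_functions_def smooth_def)

lemma partial_add:
  "\<phi> differentiable (at x) \<Longrightarrow> \<psi> differentiable (at x) \<Longrightarrow>
    partial j (\<lambda>x. \<phi> x + \<psi> x) x = partial j \<phi> x + partial j \<psi> x"
  unfolding partial_def
  by (metis (mono_tags, lifting) frechet_derivative_at frechet_derivative_works has_derivative_add)

lemma partial_cmult:
  "\<phi> differentiable (at x) \<Longrightarrow> partial j (\<lambda>x. c * \<phi> x) x = c * partial j \<phi> x"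
  unfolding partial_def
  by (metis (mono_tags, lifting) frechet_derivative_at frechet_derivative_works
      has_derivative_mult_right)

lemma foldr_partial_add:
  assumes "\<phi> \<in> test_functions" "\<psi> \<in> test_functions"
  shows "foldr partial js (\<lambda>x. \<phi> x + \<psi> x) = (\<lambda>x. foldr partial js \<phi> x + foldr partial js \<psi> x)"
proof (induction js)
  case (Cons j js)
  show ?case
    unfolding foldr.simps comp_apply Cons
    using assms by (simp add: fun_eq_iff partial_add differentiable_foldr_partial)
qed simp

lemma foldr_partial_cmult:
  assumes "\<phi> \<in> test_functions"
  shows "foldr partial js (\<lambda>x. c * \<phi> x) = (\<lambda>x. c * foldr partial js \<phi> x)"
proof (induction js)
  case (Cons j js)
  show ?case
    unfolding foldr.simps comp_apply Cons
    using assms by (simp add: fun_eq_iff partial_cmult differentiable_foldr_partial)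
qed simp

lemma test_add:
  assumes "\<phi> \<in> test_functions" "\<psi> \<in> test_functions"
  shows "(\<lambda>x. \<phi> x + \<psi> x) \<in> test_functions"
proof -
  have "supp (\<lambda>x. \<phi> x + \<psi> x) \<subseteq> supp \<phi> \<union> supp \<psi>"
    unfolding supp_def closure_Un[symmetric] by (rule closure_mono) (auto simp: in_support_on)
  moreover have "compact (supp \<phi> \<union> supp \<psi>)"
    using assms by (simp add: test_functions_def compact_Un)
  ultimately have "compact (supp (\<lambda>x. \<phi> x + \<psi> x))"
    by (metis closed_closure compact_Int_closed inf.absorb_iff2 supp_def)
  then show ?thesis
    using assms foldr_partial_add[OF assms] differentiable_foldr_partial
    by (auto simp: test_functions_def smooth_def)
qed

lemma test_cmult:
  assumes "\<phi> \<in> test_functions"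
  shows "(\<lambda>x. c * \<phi> x) \<in> test_functions"
proof -
  have "supp (\<lambda>x. c * \<phi> x) \<subseteq> supp \<phi>"
    unfolding supp_def by (rule closure_mono) (auto simp: in_support_on)
  then have "compact (supp (\<lambda>x. c * \<phi> x))"
    using assms by (metis (no_types, lifting) closed_closure compact_Int_closed inf.absorb_iff2
        mem_Collect_eq supp_def test_functions_def)
  then show ?thesis
    using assms foldr_partial_cmult[OF assms] differentiable_foldr_partial
    by (auto simp: test_functions_def smooth_def)
qed

lemma bdd_above_foldr_partial:
  assumes "\<phi> \<in> test_functions"
  shows "bdd_above (range (\<lambda>x. cmod (foldr partial js \<phi> x)))"
proof -
  let ?f = "foldr partial js \<phi>"
  have "continuous_on UNIV ?f"
    using differentiable_foldr_partial[OF assms]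
    by (simp add: differentiable_imp_continuous_on differentiable_on_def differentiable_at_withinI)
  then have "compact (?f ` supp \<phi>)"
    using assms by (auto intro!: compact_continuous_image intro: continuous_on_subset
        simp: test_functions_def)
  then obtain B where B: "\<And>x. x \<in> supp \<phi> \<Longrightarrow> cmod (?f x) \<le> B"
    by (meson bounded_iff compact_imp_bounded image_eqI)
  have "cmod (?f x) \<le> max B 0" for x
  proof (cases "x \<in> supp \<phi>")
    case False
    then have "x \<notin> support_on UNIV ?f"
      using supp_foldr_partial[of js \<phi>] closure_subset[of "support_on UNIV ?f"]
      by (auto simp: supp_def)
    then show ?thesis by (simp add: in_support_on)
  qed (use B in fastforce)
  then show ?thesis by (auto simp: bdd_above_def)
qed

lemma SUP_foldr_partial_nonneg:
  "\<phi> \<in> test_functions \<Longrightarrow> 0 \<le> (SUP x. cmod (foldr partial js \<phi> x))"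
  by (rule order_trans[OF norm_ge_zero cSUP_upper[OF UNIV_I bdd_above_foldr_partial]])

lemma test_continuous_cmult:
  assumes "test_continuous T"
  shows "test_continuous (\<lambda>\<phi>. c * T \<phi>)"
  unfolding test_continuous_def
proof (intro allI impI)
  fix K :: "(real^'a) set"
  assume "compact K"
  then obtain C N where C: "C \<ge> 0" "\<And>\<phi>. \<phi> \<in> test_functions \<Longrightarrow> supp \<phi> \<subseteq> K \<Longrightarrow>
      cmod (T \<phi>) \<le> C * (\<Sum>js\<in>{js. length js \<le> N}. SUP x. cmod (foldr partial js \<phi> x))"
    using assms unfolding test_continuous_def by meson
  show "\<exists>C\<ge>0. \<exists>N. \<forall>\<phi>\<in>test_functions. supp \<phi> \<subseteq> K \<longrightarrow>
      cmod (c * T \<phi>) \<le> C * (\<Sum>js\<in>{js. length js \<le> N}. SUP x. cmod (foldr partial js \<phi> x))"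
    by (rule exI[of _ "cmod c * C"])
      (use C in \<open>auto simp: norm_mult mult.assoc intro!: exI[of _ N] mult_left_mono\<close>)
qed

lemma test_continuous_add:
  fixes S T :: "(real^'n::finite \<Rightarrow> complex) \<Rightarrow> complex"
  assumes "test_continuous S" "test_continuous T"
  shows "test_continuous (\<lambda>\<phi>. S \<phi> + T \<phi>)"
  unfolding test_continuous_def
proof (intro allI impI)
  fix K :: "(real^'n) set"
  assume K: "compact K"
  let ?n = "\<lambda>N \<phi>. \<Sum>js\<in>{js. length js \<le> N}. SUP x. cmod (foldr partial js \<phi> x)"
  obtain C N where C: "C \<ge> 0" "\<And>\<phi>. \<phi> \<in> test_functions \<Longrightarrow> supp \<phi> \<subseteq> K \<Longrightarrow> cmod (S \<phi>) \<le> C * ?n N \<phi>"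
    using assms(1) K unfolding test_continuous_def by meson
  obtain D M where D: "D \<ge> 0" "\<And>\<phi>. \<phi> \<in> test_functions \<Longrightarrow> supp \<phi> \<subseteq> K \<Longrightarrow> cmod (T \<phi>) \<le> D * ?n M \<phi>"
    using assms(2) K unfolding test_continuous_def by meson
  have mono: "?n N \<phi> \<le> ?n (max N M) \<phi>" "?n M \<phi> \<le> ?n (max N M) \<phi>" if "\<phi> \<in> test_functions" for \<phi>
    using that by (auto intro!: sum_mono2 finite_lists SUP_foldr_partial_nonneg)
  have "cmod (S \<phi> + T \<phi>) \<le> (C + D) * ?n (max N M) \<phi>"
    if "\<phi> \<in> test_functions" "supp \<phi> \<subseteq> K" for \<phi>
  proof -
    have "cmod (S \<phi> + T \<phi>) \<le> C * ?n N \<phi> + D * ?n M \<phi>"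
      using C(2)[OF that] D(2)[OF that] norm_triangle_ineq[of "S \<phi>" "T \<phi>"] by linarith
    also have "\<dots> \<le> C * ?n (max N M) \<phi> + D * ?n (max N M) \<phi>"
      using mono[OF that(1)] C(1) D(1) by (intro add_mono mult_left_mono)
    finally show ?thesis by (simp add: algebra_simps)
  qed
  then show "\<exists>C\<ge>0. \<exists>N. \<forall>\<phi>\<in>test_functions. supp \<phi> \<subseteq> K \<longrightarrow> cmod (S \<phi> + T \<phi>) \<le> C * ?n N \<phi>"
    using C(1) D(1) by (intro exI[of _ "C + D"] conjI exI[of _ "max N M"]) auto
qed

lemma test_continuous_partial:
  fixes T :: "(real^'n::finite \<Rightarrow> complex) \<Rightarrow> complex"
  assumes "test_continuous T"
  shows "test_continuous (\<lambda>\<phi>. if \<phi> \<in> test_functions then - T (partial j \<phi>) else 0)"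
  unfolding test_continuous_def
proof (intro allI impI)
  fix K :: "(real^'n) set"
  assume K: "compact K"
  let ?n = "\<lambda>N \<phi>. \<Sum>js\<in>{js. length js \<le> N}. SUP x. cmod (foldr partial js \<phi> x)"
  obtain C N where C: "C \<ge> 0" "\<And>\<phi>. \<phi> \<in> test_functions \<Longrightarrow> supp \<phi> \<subseteq> K \<Longrightarrow> cmod (T \<phi>) \<le> C * ?n N \<phi>"
    using assms(1) K unfolding test_continuous_def by meson
  have "cmod (- T (partial j \<phi>)) \<le> C * ?n (Suc N) \<phi>"
    if "\<phi> \<in> test_functions" "supp \<phi> \<subseteq> K" for \<phi>
  proof -
    have "cmod (- T (partial j \<phi>)) \<le> C * ?n N (partial j \<phi>)"
      unfolding norm_minus_cancel
      using that by (intro C(2) partial_test order_trans[OF supp_partial])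
    also have "?n N (partial j \<phi>) =
        (\<Sum>js\<in>(\<lambda>js. js @ [j]) ` {js. length js \<le> N}. SUP x. cmod (foldr partial js \<phi> x))"
      by (subst sum.reindex) (auto simp: inj_on_def)
    also have "\<dots> \<le> ?n (Suc N) \<phi>"
      using that by (intro sum_mono2 finite_lists SUP_foldr_partial_nonneg) auto
    finally show ?thesis using C(1) by (simp add: mult_left_mono)
  qed
  then show "\<exists>C\<ge>0. \<exists>N. \<forall>\<phi>\<in>test_functions. supp \<phi> \<subseteq> K \<longrightarrow>
      cmod (if \<phi> \<in> test_functions then - T (partial j \<phi>) else 0) \<le> C * ?n N \<phi>"
    using C(1) by (intro exI[of _ C] conjI exI[of _ "Suc N"]) auto
qed

instantiation distribution :: (finite) ab_group_add
begin

lift_definition zero_distribution :: "'a distribution" is "\<lambda>_. 0"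
  by (auto simp: test_continuous_def intro!: exI[of _ "0::real"])

lift_definition plus_distribution :: "'a distribution \<Rightarrow> 'a distribution \<Rightarrow> 'a distribution" is
  "\<lambda>S T \<phi>. S \<phi> + T \<phi>"
  by (auto simp: test_continuous_add algebra_simps)

lift_definition uminus_distribution :: "'a distribution \<Rightarrow> 'a distribution" is "\<lambda>T \<phi>. - T \<phi>"
  using test_continuous_cmult[where c = "-1"] by auto

definition minus_distribution :: "'a distribution \<Rightarrow> 'a distribution \<Rightarrow> 'a distribution" where
  "minus_distribution S T = S + (- T)"

instance
  by standard (unfold minus_distribution_def, (transfer, auto simp: algebra_simps)+)

end

lift_definition scale_dist :: "complex \<Rightarrow> 'n::finite distribution \<Rightarrow> 'n distribution" is
  "\<lambda>c T \<phi>. c * T \<phi>"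
  by (auto simp: test_continuous_cmult algebra_simps)

lift_definition partial_dist :: "'n::finite \<Rightarrow> 'n distribution \<Rightarrow> 'n distribution" is
  "\<lambda>j T \<phi>. if \<phi> \<in> test_functions then - T (partial j \<phi>) else 0"
proof (intro CollectI conjI ballI allI, goal_cases)
  case (1 j T \<phi> \<psi>)
  then show ?case
    using foldr_partial_add[of \<phi> \<psi> "[j]"] by (simp add: test_add partial_test)
next
  case (2 j T c \<phi>)
  then show ?case
    using foldr_partial_cmult[of \<phi> "[j]" c] by (simp add: test_cmult partial_test)
qed (auto simp: test_continuous_partial)

definition eq_on_open :: "(real^'n::finite) set \<Rightarrow> 'n distribution \<Rightarrow> 'n distribution \<Rightarrow> bool" where
  "eq_on_open W S T \<longleftrightarrow> (\<forall>\<phi>\<in>test_functions. supp \<phi> \<subseteq> W \<longrightarrow> apply_dist S \<phi> = apply_dist T \<phi>)"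


section \<open>The ring \<open>A = \<complex>[D\<^sub>1, \<dots>, D\<^sub>n]\<close> and its modules\<close>

text \<open>Polynomials in indeterminates indexed by \<open>'n\<close>: a multi-index is a finitely supported map
  from \<open>'n\<close> to \<open>nat\<close>, a polynomial a finitely supported map from multi-indices to coefficients.
  Multiplication of \<^typ>\<open>('a, 'b) poly_mapping\<close> is convolution.\<close>
type_synonym 'n diffop = "('n \<Rightarrow>\<^sub>0 nat) \<Rightarrow>\<^sub>0 complex"

definition D_op :: "'n::finite \<Rightarrow> 'n distribution \<Rightarrow> 'n distribution" where
  "D_op j T = scale_dist (1 / \<i>) (partial_dist j T)"

text \<open>The operators \<open>D_op j\<close> commute, so the order in which \<^const>\<open>Finite_Set.fold\<close> composes their
  powers is immaterial.\<close>
definition D_monomial :: "('n \<Rightarrow>\<^sub>0 nat) \<Rightarrow> 'n::finite distribution \<Rightarrow> 'n distribution" where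
  "D_monomial \<alpha> T = Finite_Set.fold (\<lambda>j. D_op j ^^ Poly_Mapping.lookup \<alpha> j) T UNIV"

definition act :: "'n diffop \<Rightarrow> 'n::finite distribution \<Rightarrow> 'n distribution" where
  "act p T = (\<Sum>\<alpha>\<in>Poly_Mapping.keys p. scale_dist (Poly_Mapping.lookup p \<alpha>) (D_monomial \<alpha> T))"

abbreviation diffop_ring :: "'n::finite diffop ring" where
  "diffop_ring \<equiv> ring_of_type_algebra"

text \<open>The module on a set of elements of a type-class group, as a record. The multiplicative
  fields of the record play no role in modules.\<close>
definition module_on :: "'b set \<Rightarrow> ('a \<Rightarrow> 'b \<Rightarrow> 'b) \<Rightarrow> ('a, 'b::ab_group_add) module" where
  "module_on M smul =
     \<lparr>carrier = M, monoid.mult = undefined, one = undefined, zero = 0, add = (+), smult = smul\<rparr>"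

abbreviation free_A_module :: "('n::finite diffop, 'n diffop^'k) module" where
  "free_A_module \<equiv> module_on UNIV (*s)"

abbreviation dist_A_module :: "'n distribution set \<Rightarrow> ('n::finite diffop, 'n distribution) module" where
  "dist_A_module F \<equiv> module_on F act"

definition mod_hom ::
  "('a, 'r) ring_scheme \<Rightarrow> ('a, 'b, 'm) module_scheme \<Rightarrow> ('a, 'c, 'n) module_scheme \<Rightarrow> ('b \<Rightarrow> 'c) set"
  where
  "mod_hom R M N = {h \<in> hom (add_monoid M) (add_monoid N).
     \<forall>a\<in>carrier R. \<forall>x\<in>carrier M. h (a \<odot>\<^bsub>M\<^esub> x) = a \<odot>\<^bsub>N\<^esub> h x}"

text \<open>HOL cannot quantify over all types, so the test modules have their carriers in a type
  \<open>'u\<close>, passed as an argument. If \<open>'u\<close> has at least as many elements as \<open>R\<close>,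
  these notions do not depend on \<open>'u\<close> and agree with the unrestricted ones: injectivity by Baer's
  criterion (it suffices to extend homomorphisms from ideals to \<open>R\<close>), and the cogenerator
  property because for injective modules it suffices to test nonzero cyclic modules.\<close>
definition injective_module ::
  "'u itself \<Rightarrow> ('a, 'r) ring_scheme \<Rightarrow> ('a, 'b, 'm) module_scheme \<Rightarrow> bool" where
  "injective_module _ R E \<longleftrightarrow> module R E \<and>
     (\<forall>(M :: ('a, 'u) module) (N :: ('a, 'u) module) i h.
        module R M \<and> module R N \<and> i \<in> mod_hom R M N \<and> inj_on i (carrier M) \<and> h \<in> mod_hom R M E \<longrightarrow>
        (\<exists>g\<in>mod_hom R N E. \<forall>x\<in>carrier M. g (i x) = h x))"

definition injective_cogenerator ::
  "'u itself \<Rightarrow> ('a, 'r) ring_scheme \<Rightarrow> ('a, 'b, 'm) module_scheme \<Rightarrow> bool" where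
  "injective_cogenerator U R E \<longleftrightarrow> injective_module U R E \<and>
     (\<forall>M :: ('a, 'u) module. module R M \<and> carrier M \<noteq> {\<zero>\<^bsub>M\<^esub>} \<longrightarrow>
        (\<exists>h\<in>mod_hom R M E. \<exists>x\<in>carrier M. h x \<noteq> \<zero>\<^bsub>E\<^esub>))"

text \<open>Every countably generated \<open>A\<close>-module has an isomorphic copy with elements in this type,
  as a quotient (a set of cosets) of the free module of countable rank.\<close>
type_synonym 'n universe = "(nat \<Rightarrow> 'n diffop) set"


section \<open>Systems and controllability\<close>

definition Ker :: "'n distribution set \<Rightarrow> ('n diffop^'k) set \<Rightarrow> (('n::finite distribution)^'k) set" where
  "Ker F P = {f. (\<forall>j. f $ j \<in> F) \<and> (\<forall>p\<in>P. (\<Sum>j\<in>UNIV. act (p $ j) (f $ j)) = 0)}"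

definition is_system :: "'n distribution set \<Rightarrow> (('n::finite distribution)^'k) set \<Rightarrow> bool" where
  "is_system F B \<longleftrightarrow> (\<exists>P. submodule P diffop_ring free_A_module \<and> B = Ker F P)"

definition subsystem ::
  "'n distribution set \<Rightarrow> (('n::finite distribution)^'k) set \<Rightarrow> (('n distribution)^'k) set \<Rightarrow> bool" where
  "subsystem F B' B \<longleftrightarrow> is_system F B' \<and> B' \<subseteq> B"

definition eq_near :: "(real^'n::finite) set \<Rightarrow> 'n distribution \<Rightarrow> 'n distribution \<Rightarrow> bool" where
  "eq_near U f g \<longleftrightarrow> (\<exists>W. open W \<and> U \<subseteq> W \<and> eq_on_open W f g)"

definition admissible :: "'n distribution set \<Rightarrow> (real^'n::finite) set \<Rightarrow> (real^'n) set \<Rightarrow> bool" where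
  "admissible F U1 U2 \<longleftrightarrow> closure U1 \<inter> closure U2 = {} \<and>
     (\<forall>f1\<in>F. \<forall>f2\<in>F. \<exists>f\<in>F. eq_near U1 f f1 \<and> eq_near U2 f f2)"

definition controllable :: "'n distribution set \<Rightarrow> (('n::finite distribution)^'k) set \<Rightarrow> bool" where
  "controllable F B \<longleftrightarrow> (\<forall>U1 U2. admissible F U1 U2 \<longrightarrow>
     (\<forall>f1\<in>B. \<forall>f2\<in>B. \<exists>f\<in>B. \<forall>j. eq_near U1 (f $ j) (f1 $ j) \<and> eq_near U2 (f $ j) (f2 $ j)))"

definition uncontrollable :: "'n distribution set \<Rightarrow> (('n::finite distribution)^'k) set \<Rightarrow> bool" where
  "uncontrollable F B \<longleftrightarrow> (\<forall>B'. subsystem F B' B \<and> B' \<noteq> {0} \<longrightarrow> \<not> controllable F B')"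

definition is_controllable_part ::
  "'n distribution set \<Rightarrow> (('n::finite distribution)^'k) set \<Rightarrow> (('n distribution)^'k) set \<Rightarrow> bool" where
  "is_controllable_part F B C \<longleftrightarrow> subsystem F C B \<and> controllable F C \<and>
     (\<forall>C'. subsystem F C' B \<and> controllable F C' \<longrightarrow> C' \<subseteq> C)"

definition cutoff :: "'n::finite distribution set \<Rightarrow> bool" where
  "cutoff F \<longleftrightarrow> (\<forall>V :: (real^'n) set. bounded V \<and> interior V \<noteq> {} \<longrightarrow>
     (\<exists>U. U \<noteq> {} \<and> closure U \<subseteq> interior V \<and> admissible F U (- V)))"

end

theory Submission
  imports Defs
begin

text \<open>
  Let \<open>P\<^sub>0\<close>, the saturation of \<open>P\<close>, consist of all \<open>x\<close> with \<open>a x \<in> P\<close> for some \<open>a \<noteq> 0\<close>; thus \<open>P\<^sub>0 / P\<close>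
  is the torsion submodule of \<open>A\<^sup>k / P\<close>. By Zorn's lemma there is a submodule \<open>M \<supseteq> P\<close> that is
  maximal subject to \<open>M \<inter> P\<^sub>0 = P\<close>. Then \<open>A\<^sup>k / M\<close> is torsion: if no nonzero multiple of \<open>x\<close> lay
  in \<open>M\<close>, the larger module \<open>M + A x\<close> would still meet \<open>P\<^sub>0\<close> in \<open>P\<close> only, because \<open>A\<close> is a domain
  (\<open>complement_of_saturation\<close>). Injectivity of \<open>F\<close> turns the intersection \<open>P = P\<^sub>0 \<inter> M\<close> into the
  sum \<open>Ker P = Ker P\<^sub>0 + Ker M\<close> (\<open>Ker_decompose\<close>): an element \<open>f\<close> of \<open>Ker P\<close> is a homomorphism
  \<open>A\<^sup>k \<rightarrow> F\<close> vanishing on \<open>P\<close>, so there is a homomorphism on \<open>P\<^sub>0 + M\<close> that is \<open>0\<close> on \<open>P\<^sub>0\<close> and \<open>f\<close>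
  on \<open>M\<close>, and any extension of it to \<open>A\<^sup>k\<close> is the first summand.

  The system \<open>Ker P\<^sub>0\<close> is controllable: as \<open>A\<^sup>k / P\<^sub>0\<close> is torsion-free, \<open>P\<^sub>0\<close> is the kernel of a
  square matrix over \<open>A\<close> (\<open>saturated_is_kernel\<close>), and injectivity makes \<open>Ker P\<^sub>0\<close> the image of
  \<open>F\<^sup>k\<close> under the transposed matrix. Two solutions are then patched by patching their potentials,
  which is possible by the definition of an admissible pair (\<open>saturated_Ker_controllable\<close>).

  That \<open>Ker P\<^sub>0\<close> contains every controllable sub-system and that \<open>Ker M\<close> has no nonzero one both
  follow from \<open>controllable_annihilates_torsion\<close>: if \<open>a x \<in> P\<close> with \<open>a \<noteq> 0\<close>, then \<open>x\<close> annihilates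
  every controllable sub-system \<open>Ker Q\<close> of \<open>Ker P\<close>. Take the admissible pair \<open>U\<close>, complement of
  the unit ball, that the cutoff assumption provides. For \<open>f \<in> Ker Q\<close> controllability yields
  \<open>g \<in> Ker Q\<close> that equals \<open>f\<close> near \<open>U\<close> and vanishes off the ball. The compactly supported
  distribution \<open>x \<cdot> g\<close> is annihilated by \<open>a\<close>, hence zero (\<open>compact_support_zero\<close>), and therefore
  \<open>x \<cdot> f\<close> vanishes near \<open>U\<close>, where \<open>U\<close> is the same for all \<open>f\<close>. If \<open>x\<close> were not in \<open>Q\<close>, the ideal
  \<open>(Q : x)\<close> would be proper, hence contained in some maximal ideal \<open>(D\<^sub>1 - c\<^sub>1, \<dots>, D\<^sub>n - c\<^sub>n)\<close> by the
  Nullstellensatz; the cogenerator property yields \<open>0 \<noteq> T \<in> F\<close> annihilated by it, injectivity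
  yields \<open>f \<in> Ker Q\<close> with \<open>x \<cdot> f = T\<close>, and such a \<open>T\<close> vanishes on no nonempty open set
  (\<open>eigen_dist_zero\<close>), a contradiction. Hence \<open>x \<in> Q\<close>.

  The two analytic facts hold for the following reasons. For \<open>compact_support_zero\<close>, an inner
  product identity for the regularizations \<open>T * \<phi>\<close> shows that the annihilator ideal of a compactly
  supported \<open>T\<close> is closed under formal differentiation of polynomials (\<open>pderiv_annihilates\<close>); if
  it is nonzero, it contains a nonzero constant. For \<open>eigen_dist_zero\<close>, \<open>T\<close> is multiplied by an
  exponential so that all its derivatives vanish; it then takes the same value on a test function
  and on its normalized dilations about any point, whose supports shrink into the set where \<open>T\<close>
  is zero.
\<close>

(* The symbol $ denotes a component of a vector, never a coefficient of a power series. *)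
no_notation fps_nth (infixl "$" 75)

section \<open>Smooth functions\<close>

lemma smooth_differentiable: "smooth \<phi> \<Longrightarrow> \<phi> differentiable (at x)"
  unfolding smooth_def by (metis foldr_Nil id_apply)

lemma smooth_partial:
  assumes "smooth \<phi>" shows "smooth (partial j \<phi>)"
  unfolding smooth_def
proof (intro allI)
  fix js x
  have "foldr partial (js @ [j]) \<phi> differentiable at x"
    using assms unfolding smooth_def by blast
  then show "foldr partial js (partial j \<phi>) differentiable at x" by simp
qed

lemma smooth_foldr_partial: "smooth \<phi> \<Longrightarrow> smooth (foldr partial js \<phi>)"
  by (induction js) (auto intro: smooth_partial)

text \<open>Smoothness is the largest property of differentiable functions that is closed under partial
  derivatives; this replaces the bookkeeping with iterated derivatives in all closure proofs below.\<close>
lemma smooth_coinduct: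
  assumes "Q \<phi>"
    and "\<And>\<phi> x. Q \<phi> \<Longrightarrow> \<phi> differentiable (at x)"
    and "\<And>\<phi> j. Q \<phi> \<Longrightarrow> Q (partial j \<phi>)"
  shows "smooth \<phi>"
proof -
  have "Q (foldr partial js \<phi>)" for js
    by (induction js) (use assms in auto)
  then show ?thesis unfolding smooth_def using assms(2) by blast
qed

lemma test_smooth: "\<phi> \<in> test_functions \<Longrightarrow> smooth \<phi>"
  by (simp add: test_functions_def)

lemma test_compact: "\<phi> \<in> test_functions \<Longrightarrow> compact (supp \<phi>)"
  by (simp add: test_functions_def)

lemma not_in_supp: "x \<notin> supp \<phi> \<Longrightarrow> \<phi> x = 0"
  using closure_subset[of "support_on UNIV \<phi>"] by (auto simp: supp_def in_support_on)

lemma not_in_supp_foldr: "x \<notin> supp \<phi> \<Longrightarrow> foldr partial js \<phi> x = 0"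
  using supp_foldr_partial[of js \<phi>] not_in_supp[of x "foldr partial js \<phi>"] by blast

lemma supp_minimal: "closed K \<Longrightarrow> (\<And>x. x \<notin> K \<Longrightarrow> \<phi> x = 0) \<Longrightarrow> supp \<phi> \<subseteq> K"
  unfolding supp_def by (rule closure_minimal) (force simp: in_support_on)+

lemma testI:
  assumes "smooth \<phi>" "compact K" "\<And>x. x \<notin> K \<Longrightarrow> \<phi> x = 0"
  shows "\<phi> \<in> test_functions"
proof -
  have "supp \<phi> \<subseteq> K" using assms by (intro supp_minimal compact_imp_closed)
  then have "compact (supp \<phi>)"
    using assms(2) by (metis closed_closure compact_Int_closed inf.absorb_iff2 supp_def)
  with assms(1) show ?thesis by (simp add: test_functions_def)
qed

lemma smooth_continuous: "smooth \<phi> \<Longrightarrow> continuous_on A \<phi>"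
  by (meson continuous_at_imp_continuous_on differentiable_imp_continuous_within smooth_differentiable)

lemma has_derivative_partials:
  assumes "\<phi> differentiable (at x)"
  shows "(\<phi> has_derivative (\<lambda>h. \<Sum>j\<in>UNIV. (h $ j) *\<^sub>R partial j \<phi> x)) (at x)"
proof -
  let ?D = "frechet_derivative \<phi> (at x)"
  have D: "(\<phi> has_derivative ?D) (at x)" using assms by (simp add: frechet_derivative_works)
  then have lin: "linear ?D" by (rule has_derivative_linear)
  have "?D h = (\<Sum>j\<in>UNIV. (h $ j) *\<^sub>R partial j \<phi> x)" for h
  proof -
    have "h = (\<Sum>j\<in>UNIV. (h $ j) *\<^sub>R axis j 1)"
      by (simp add: basis_expansion flip: scalar_mult_eq_scaleR)
    then have "?D h = ?D (\<Sum>j\<in>UNIV. (h $ j) *\<^sub>R axis j 1)" by simp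
    also have "\<dots> = (\<Sum>j\<in>UNIV. (h $ j) *\<^sub>R ?D (axis j 1))"
      using lin by (simp add: linear_sum linear_scale)
    finally show ?thesis by (simp add: partial_def)
  qed
  with D show ?thesis by (metis (no_types, lifting) ext)
qed

lemma vector_derivative_along:
  assumes "\<phi> differentiable (at (g t))" "(g has_vector_derivative v) (at t within S)"
  shows "((\<lambda>t. \<phi> (g t)) has_vector_derivative (\<Sum>j\<in>UNIV. (v $ j) *\<^sub>R partial j \<phi> (g t))) (at t within S)"
proof -
  have "((\<phi> \<circ> g) has_derivative ((\<lambda>h. \<Sum>j\<in>UNIV. (h $ j) *\<^sub>R partial j \<phi> (g t)) \<circ> (\<lambda>x. x *\<^sub>R v)))
      (at t within S)"
    using assms has_derivative_partials[OF assms(1)]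
    by (intro diff_chain_within) (auto simp: has_vector_derivative_def intro: has_derivative_at_withinI)
  then show ?thesis
    by (simp add: has_vector_derivative_def o_def scaleR_sum_right)
qed

lemma vector_derivative_axis:
  assumes "\<phi> differentiable (at (x + t *\<^sub>R axis j 1))"
  shows "((\<lambda>t. \<phi> (x + t *\<^sub>R axis j 1)) has_vector_derivative partial j \<phi> (x + t *\<^sub>R axis j 1)) (at t within S)"
proof -
  have "((\<lambda>t. x + t *\<^sub>R axis j (1::real)) has_vector_derivative axis j 1) (at t within S)"
    by (auto intro!: derivative_eq_intros)
  from vector_derivative_along[OF assms this] show ?thesis
    by (simp add: axis_def if_distrib[of "\<lambda>r. r *\<^sub>R _"] cong: if_cong)
qed

lemma partial_eqI:
  assumes "(\<phi> has_derivative D) (at x)"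
  shows "partial j \<phi> x = D (axis j 1)"
  using frechet_derivative_at[OF assms] by (simp add: partial_def)

lemma partial_mult:
  assumes "f differentiable (at x)" "g differentiable (at x)"
  shows "partial j (\<lambda>x. f x * g x) x = partial j f x * g x + f x * partial j g x"
proof -
  have "((\<lambda>x. f x * g x) has_derivative (\<lambda>h. f x * frechet_derivative g (at x) h + frechet_derivative f (at x) h * g x)) (at x)"
    using assms by (intro has_derivative_mult) (auto simp: frechet_derivative_works)
  from partial_eqI[OF this, of j] show ?thesis by (simp add: partial_def)
qed

text \<open>Products of smooth functions are not themselves closed under differentiation, but their finite
  sums are. This is the invariant for the coinductive proof that products are smooth.\<close>
inductive prod_sum :: "(real^'n::finite \<Rightarrow> complex) \<Rightarrow> bool" where
  prod: "smooth f \<Longrightarrow> smooth g \<Longrightarrow> prod_sum (\<lambda>x. f x * g x)"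
| add: "prod_sum f \<Longrightarrow> prod_sum g \<Longrightarrow> prod_sum (\<lambda>x. f x + g x)"

lemma prod_sum_differentiable: "prod_sum f \<Longrightarrow> f differentiable (at x)"
  by (induction rule: prod_sum.induct)
    (simp_all add: differentiable_mult differentiable_add smooth_differentiable)

lemma prod_sum_partial: "prod_sum f \<Longrightarrow> prod_sum (partial j f)"
proof (induction rule: prod_sum.induct)
  case (prod f g)
  have "partial j (\<lambda>x. f x * g x) = (\<lambda>x. partial j f x * g x + f x * partial j g x)"
    using prod by (auto simp: fun_eq_iff intro!: partial_mult smooth_differentiable)
  then show ?case using prod by (auto intro!: prod_sum.intros smooth_partial)
next
  case (add f g)
  have "partial j (\<lambda>x. f x + g x) = (\<lambda>x. partial j f x + partial j g x)"
    using add by (auto simp: fun_eq_iff intro!: partial_add prod_sum_differentiable)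
  then show ?case using add by (auto intro!: prod_sum.intros)
qed

lemma smooth_mult: "smooth f \<Longrightarrow> smooth g \<Longrightarrow> smooth (\<lambda>x. f x * g x)"
  by (rule smooth_coinduct[of prod_sum, OF prod_sum.prod prod_sum_differentiable prod_sum_partial])

lemma partial_const [simp]: "partial j (\<lambda>x. c) = (\<lambda>x. 0)"
  by (auto simp: partial_def frechet_derivative_const)

lemma smooth_const: "smooth (\<lambda>x. c)"
  by (rule smooth_coinduct[of "\<lambda>f. \<exists>c. f = (\<lambda>x. c)"]) auto

lemma smooth_add: "smooth f \<Longrightarrow> smooth g \<Longrightarrow> smooth (\<lambda>x. f x + g x)"
  by (rule smooth_coinduct[of prod_sum, OF prod_sum.add prod_sum_differentiable prod_sum_partial])
    (use prod_sum.prod[of f "\<lambda>x. 1"] prod_sum.prod[of g "\<lambda>x. 1"] smooth_const[of 1] in simp_all)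

lemma has_derivative_coord:
  "((\<lambda>x::real^'n::finite. complex_of_real (x $ i - a)) has_derivative (\<lambda>h. complex_of_real (h $ i))) (at x)"
proof -
  have "((\<lambda>x::real^'n. x $ i - a) has_derivative (\<lambda>h. h $ i)) (at x)"
    using has_derivative_diff[OF bounded_linear_imp_has_derivative[OF bounded_linear_vec_nth[of i]] has_derivative_const[of a], of "at x"]
    by simp
  then show ?thesis by (rule has_derivative_of_real)
qed

lemma partial_coord:
  "partial j (\<lambda>x::real^'n::finite. complex_of_real (x $ i - a)) = (\<lambda>x. if i = j then 1 else 0)"
proof
  fix x :: "real^'n"
  from partial_eqI[OF has_derivative_coord, of j i a x]
  show "partial j (\<lambda>x. complex_of_real (x $ i - a)) x = (if i = j then 1 else 0)"
    by (simp add: axis_def)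
qed

lemma smooth_coord: "smooth (\<lambda>x::real^'n::finite. complex_of_real (x $ i - a))"
proof (rule smooth_coinduct[of "\<lambda>f. (\<exists>c. f = (\<lambda>x. c)) \<or> f = (\<lambda>x. complex_of_real (x $ i - a))"])
  fix f :: "real^'n \<Rightarrow> complex" and x j
  assume f: "(\<exists>c. f = (\<lambda>x. c)) \<or> f = (\<lambda>x. complex_of_real (x $ i - a))"
  then show "f differentiable at x"
    using has_derivative_coord[of i a] has_derivative_const by (fastforce simp: differentiable_def simp del: of_real_diff)
  show "(\<exists>c. partial j f = (\<lambda>x. c)) \<or> partial j f = (\<lambda>x. complex_of_real (x $ i - a))"
    using f by (auto simp: partial_coord simp del: of_real_diff)
qed simp

lemma partial_affine:
  assumes "smooth \<phi>"
  shows "partial j (\<lambda>y. \<phi> (a + s *\<^sub>R y)) = (\<lambda>y. of_real s * partial j \<phi> (a + s *\<^sub>R y))"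
proof
  fix y
  have "((\<lambda>y. a + s *\<^sub>R y) has_derivative (\<lambda>h. s *\<^sub>R h)) (at y)"
    by (auto intro!: derivative_eq_intros)
  from diff_chain_at[OF this has_derivative_partials[OF smooth_differentiable[OF assms]]]
  have "((\<lambda>y. \<phi> (a + s *\<^sub>R y)) has_derivative
      (\<lambda>h. \<Sum>j\<in>UNIV. ((s *\<^sub>R h) $ j) *\<^sub>R partial j \<phi> (a + s *\<^sub>R y))) (at y)"
    by (simp add: o_def)
  from partial_eqI[OF this, of j]
  show "partial j (\<lambda>y. \<phi> (a + s *\<^sub>R y)) y = of_real s * partial j \<phi> (a + s *\<^sub>R y)"
    by (simp add: axis_def if_distrib[of "\<lambda>r. r *\<^sub>R _"] if_distrib[of "\<lambda>r. s * r"] cong: if_cong)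
      (simp add: scaleR_conv_of_real)
qed

lemma partial_scale:
  assumes "smooth \<phi>" shows "partial j (\<lambda>x. c * \<phi> x) = (\<lambda>x. c * partial j \<phi> x)"
  using assms by (auto simp: fun_eq_iff intro!: partial_cmult smooth_differentiable)

lemma foldr_partial_affine:
  assumes "smooth \<phi>"
  shows "foldr partial js (\<lambda>y. \<phi> (a + s *\<^sub>R y))
    = (\<lambda>y. of_real s ^ length js * foldr partial js \<phi> (a + s *\<^sub>R y))"
proof -
  have diff: "(\<lambda>y. \<psi> (a + s *\<^sub>R y)) differentiable (at y)" if "smooth \<psi>" for \<psi> y
    using differentiable_chain_at[of "\<lambda>y. a + s *\<^sub>R y" y \<psi>] smooth_differentiable[OF that]
    by (simp add: o_def)
  show ?thesis
  proof (induction js)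
    case (Cons j js)
    have "partial j (\<lambda>y. of_real s ^ length js * foldr partial js \<phi> (a + s *\<^sub>R y)) =
      (\<lambda>y. of_real s ^ length js * partial j (\<lambda>y. foldr partial js \<phi> (a + s *\<^sub>R y)) y)"
      by (rule ext, rule partial_cmult, rule diff, rule smooth_foldr_partial[OF assms])
    then show ?case
      by (simp add: Cons partial_affine[OF smooth_foldr_partial[OF assms]] mult_ac)
  qed simp
qed

lemma smooth_affine:
  assumes "smooth \<phi>" shows "smooth (\<lambda>y. \<phi> (a + s *\<^sub>R y))"
proof -
  have "(\<lambda>y. \<psi> (a + s *\<^sub>R y)) differentiable (at y)" if "smooth \<psi>" for \<psi> y
    using differentiable_chain_at[of "\<lambda>y. a + s *\<^sub>R y" y \<psi>] smooth_differentiable[OF that]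
    by (simp add: o_def)
  then show ?thesis
    unfolding smooth_def[of "\<lambda>y. \<phi> (a + s *\<^sub>R y)"] foldr_partial_affine[OF assms]
    by (intro allI differentiable_mult differentiable_const) (simp add: smooth_foldr_partial[OF assms])
qed

subsection \<open>Symmetry of mixed partial derivatives\<close>

text \<open>The second difference of \<open>\<phi>\<close> along two axes, divided by \<open>h\<^sup>2\<close>, approximates an iterated partial
  derivative. It does not change when the axes are exchanged, which yields the symmetry of mixed
  derivatives. Differentiability of \<open>\<partial>\<^sub>i \<phi>\<close> at the point \<open>x\<close> controls the difference of
  two values of \<open>\<partial>\<^sub>i \<phi>\<close>, and the mean value inequality integrates this along the \<open>i\<close>-axis.\<close>
lemma second_difference:
  fixes \<phi> :: "real^'n::finite \<Rightarrow> complex"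
  assumes sm: "smooth \<phi>" and e: "e > 0"
  shows "\<exists>d>0. \<forall>h. 0 < h \<and> h < d \<longrightarrow>
    cmod (\<phi> (x + h *\<^sub>R axis i 1 + h *\<^sub>R axis j 1) - \<phi> (x + h *\<^sub>R axis i 1) - \<phi> (x + h *\<^sub>R axis j 1) + \<phi> x
      - h\<^sup>2 *\<^sub>R partial j (partial i \<phi>) x) \<le> e * h\<^sup>2"
proof -
  let ?f = "partial i \<phi>"
  let ?D = "\<lambda>h::real^'n. \<Sum>k\<in>UNIV. (h $ k) *\<^sub>R partial k ?f x"
  have smf: "smooth ?f" using sm by (rule smooth_partial)
  have D: "(?f has_derivative ?D) (at x)" by (rule has_derivative_partials[OF smooth_differentiable[OF smf]])
  have linD: "linear ?D" using D has_derivative_linear by blast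
  obtain d where d: "d > 0" "\<And>y. norm (y - x) < d \<Longrightarrow>
      cmod (?f y - ?f x - ?D (y - x)) \<le> (e/3) * norm (y - x)"
    using D[unfolded has_derivative_at_alt] e by (meson divide_pos_pos zero_less_numeral)
  show ?thesis
  proof (intro exI[of _ "d/2"] conjI allI impI)
    fix h :: real assume h: "0 < h \<and> h < d/2"
    let ?i = "axis i 1 :: real^'n" and ?j = "axis j 1 :: real^'n"
    define g where "g t = \<phi> (x + h *\<^sub>R ?j + t *\<^sub>R ?i) - \<phi> (x + t *\<^sub>R ?i)" for t
    define g' where "g' t = ?f (x + h *\<^sub>R ?j + t *\<^sub>R ?i) - ?f (x + t *\<^sub>R ?i)" for t
    have g: "(g has_vector_derivative g' t) (at t within {0..h})" for t
      unfolding g_def g'_def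
      by (intro derivative_intros vector_derivative_axis smooth_differentiable[OF sm])
    have Dj: "?D ?j = partial j ?f x"
      by (simp add: axis_def if_distrib[of "\<lambda>r. r *\<^sub>R _"] cong: if_cong)
    have bound: "cmod (g' t - h *\<^sub>R partial j ?f x) \<le> e * h" if t: "t \<in> {0..h}" for t
    proof -
      have n1: "norm (h *\<^sub>R ?j + t *\<^sub>R ?i) \<le> h + t"
        using t norm_triangle_ineq[of "h *\<^sub>R ?j" "t *\<^sub>R ?i"] h by (simp add: norm_axis_1)
      have n2: "norm (t *\<^sub>R ?i) = t" using t by (simp add: norm_axis_1)
      have "norm ((x + h *\<^sub>R ?j + t *\<^sub>R ?i) - x) < d" using n1 t h by (simp add: add.assoc)
      from d(2)[OF this]
      have 1: "cmod (?f (x + h *\<^sub>R ?j + t *\<^sub>R ?i) - ?f x - ?D (h *\<^sub>R ?j + t *\<^sub>R ?i)) \<le> (e/3) * (h + t)"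
        using n1 e by (simp add: add.assoc) (smt (verit, best) divide_right_mono mult_left_mono)
      have "norm ((x + t *\<^sub>R ?i) - x) < d" using n2 t h by simp
      from d(2)[OF this]
      have 2: "cmod (?f (x + t *\<^sub>R ?i) - ?f x - ?D (t *\<^sub>R ?i)) \<le> (e/3) * t" using n2 by simp
      have "?D (h *\<^sub>R ?j + t *\<^sub>R ?i) = h *\<^sub>R partial j ?f x + ?D (t *\<^sub>R ?i)"
        using linear_add[OF linD, of "h *\<^sub>R ?j" "t *\<^sub>R ?i"] linear_scale[OF linD, of h ?j] Dj by simp
      then have "g' t - h *\<^sub>R partial j ?f x =
         (?f (x + h *\<^sub>R ?j + t *\<^sub>R ?i) - ?f x - ?D (h *\<^sub>R ?j + t *\<^sub>R ?i))
         - (?f (x + t *\<^sub>R ?i) - ?f x - ?D (t *\<^sub>R ?i))" by (simp add: g'_def)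
      then have "cmod (g' t - h *\<^sub>R partial j ?f x) \<le> (e/3) * (h + t) + (e/3) * t"
        using 1 2 norm_triangle_ineq4 by (smt (verit, best))
      also have "\<dots> \<le> (e/3) * (h + h) + (e/3) * h"
        using t e by (intro add_mono mult_left_mono) auto
      finally show ?thesis by (simp add: algebra_simps)
    qed
    define G where "G t = g t - t *\<^sub>R (h *\<^sub>R partial j ?f x)" for t
    have G: "(G has_vector_derivative (g' t - h *\<^sub>R partial j ?f x)) (at t within {0..h})" for t
      unfolding G_def by (auto intro!: derivative_eq_intros g)
    have "cmod (G h - G 0 - (h - 0) *\<^sub>R (0::complex)) \<le> norm (h - 0) * (e * h)"
    proof -
      have "norm (G h - G 0) \<le> (e * h) * norm (h - 0)"
        by (rule differentiable_bound[of "{0..h}" G "\<lambda>t s. s *\<^sub>R (g' t - h *\<^sub>R partial j ?f x)"])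
          (use G bound h e in \<open>auto simp: has_vector_derivative_def intro!: onorm_le mult_left_mono
            simp: mult.commute[of "e * h"]\<close>)
      then show ?thesis by (simp add: mult.commute)
    qed
    then show "cmod (\<phi> (x + h *\<^sub>R ?i + h *\<^sub>R ?j) - \<phi> (x + h *\<^sub>R ?i) - \<phi> (x + h *\<^sub>R ?j) + \<phi> x
      - h\<^sup>2 *\<^sub>R partial j ?f x) \<le> e * h\<^sup>2"
      using h by (simp add: G_def g_def power2_eq_square algebra_simps)
  qed (use d in auto)
qed

lemma partial_commute:
  fixes \<phi> :: "real^'n::finite \<Rightarrow> complex"
  assumes "smooth \<phi>"
  shows "partial i (partial j \<phi>) = partial j (partial i \<phi>)"
proof (rule ext, rule ccontr)
  fix x
  let ?a = "partial i (partial j \<phi>) x" and ?b = "partial j (partial i \<phi>) x"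
  assume ne: "?a \<noteq> ?b"
  define e where "e = cmod (?a - ?b) / 3"
  have e: "e > 0" using ne by (simp add: e_def)
  obtain d where d: "d > 0" "\<And>h. 0 < h \<Longrightarrow> h < d \<Longrightarrow>
    cmod (\<phi> (x + h *\<^sub>R axis i 1 + h *\<^sub>R axis j 1) - \<phi> (x + h *\<^sub>R axis i 1) - \<phi> (x + h *\<^sub>R axis j 1) + \<phi> x
      - h\<^sup>2 *\<^sub>R ?b) \<le> e * h\<^sup>2" using second_difference[OF assms e, of x i j] by blast
  obtain d' where d': "d' > 0" "\<And>h. 0 < h \<Longrightarrow> h < d' \<Longrightarrow>
    cmod (\<phi> (x + h *\<^sub>R axis j 1 + h *\<^sub>R axis i 1) - \<phi> (x + h *\<^sub>R axis j 1) - \<phi> (x + h *\<^sub>R axis i 1) + \<phi> x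
      - h\<^sup>2 *\<^sub>R ?a) \<le> e * h\<^sup>2" using second_difference[OF assms e, of x j i] by blast
  define h where "h = min d d' / 2"
  have h: "0 < h" "h < d" "h < d'" using d(1) d'(1) by (auto simp: h_def)
  let ?\<Delta> = "\<phi> (x + h *\<^sub>R axis i 1 + h *\<^sub>R axis j 1) - \<phi> (x + h *\<^sub>R axis i 1) - \<phi> (x + h *\<^sub>R axis j 1) + \<phi> x"
  have 1: "cmod (?\<Delta> - h\<^sup>2 *\<^sub>R ?b) \<le> e * h\<^sup>2" using d(2) h by blast
  have 2: "cmod (?\<Delta> - h\<^sup>2 *\<^sub>R ?a) \<le> e * h\<^sup>2" using d'(2)[OF h(1,3)] by (simp add: algebra_simps)
  have "h\<^sup>2 *\<^sub>R (?a - ?b) = (?\<Delta> - h\<^sup>2 *\<^sub>R ?b) - (?\<Delta> - h\<^sup>2 *\<^sub>R ?a)" by (simp add: algebra_simps)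
  then have "cmod (h\<^sup>2 *\<^sub>R (?a - ?b)) \<le> e * h\<^sup>2 + e * h\<^sup>2"
    using 1 2 norm_triangle_ineq4 by (smt (verit, best))
  then have "h\<^sup>2 * cmod (?a - ?b) \<le> 2 * (e * h\<^sup>2)" by simp
  then have "h\<^sup>2 * (3 * e) \<le> h\<^sup>2 * (2 * e)" by (simp add: e_def mult_ac)
  then show False using h(1) e by simp
qed

lemma foldr_partial_commute:
  "smooth \<phi> \<Longrightarrow> foldr partial js (partial j \<phi>) = partial j (foldr partial js \<phi>)"
  by (induction js) (auto simp: partial_commute smooth_foldr_partial)

section \<open>Families of test functions depending on a parameter\<close>

lemma dist_add: "\<phi> \<in> test_functions \<Longrightarrow> \<psi> \<in> test_functions \<Longrightarrow>
    apply_dist T (\<lambda>x. \<phi> x + \<psi> x) = apply_dist T \<phi> + apply_dist T \<psi>"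
  using apply_dist[of T] by auto

lemma dist_cmult: "\<phi> \<in> test_functions \<Longrightarrow> apply_dist T (\<lambda>x. c * \<phi> x) = c * apply_dist T \<phi>"
  using apply_dist[of T] by auto

lemma dist_nontest: "\<phi> \<notin> test_functions \<Longrightarrow> apply_dist T \<phi> = 0"
  using apply_dist[of T] by auto

lemma dist_zero:
  fixes T :: "'n::finite distribution"
  shows "apply_dist T (\<lambda>x. 0) = 0"
proof (cases "(\<lambda>x::real^'n. 0::complex) \<in> test_functions")
  case True
  show ?thesis using dist_cmult[OF True, of T 0] by (simp only: mult_zero_left)
qed (rule dist_nontest)

lemma dist_eqI: "(\<And>\<phi>. \<phi> \<in> test_functions \<Longrightarrow> apply_dist S \<phi> = apply_dist T \<phi>) \<Longrightarrow> S = T"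
  by (metis (no_types, lifting) apply_dist_inject dist_nontest ext)

lemma dist_test_continuous: "test_continuous (apply_dist T)"
  using apply_dist[of T] by auto

lemma test_diff:
  assumes "\<phi> \<in> test_functions" "\<psi> \<in> test_functions"
  shows "(\<lambda>x. \<phi> x - \<psi> x) \<in> test_functions"
  using test_add[OF assms(1) test_cmult[OF assms(2), of "-1"]] by simp

lemma dist_diff:
  assumes "\<phi> \<in> test_functions" "\<psi> \<in> test_functions"
  shows "apply_dist T (\<lambda>x. \<phi> x - \<psi> x) = apply_dist T \<phi> - apply_dist T \<psi>"
  using dist_add[OF assms(1) test_cmult[OF assms(2), of "-1"], of T] dist_cmult[OF assms(2), of T "-1"] by simp

lemma foldr_partial_diff:
  assumes "\<phi> \<in> test_functions" "\<psi> \<in> test_functions"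
  shows "foldr partial js (\<lambda>x. \<phi> x - \<psi> x) = (\<lambda>x. foldr partial js \<phi> x - foldr partial js \<psi> x)"
  using foldr_partial_add[OF assms(1) test_cmult[OF assms(2), of "-1"], of js]
    foldr_partial_cmult[OF assms(2), of js "-1"] by simp

text \<open>The continuity of \<open>T\<close> in the form used below: a bound that is uniform over the derivatives of
  order at most \<open>N\<close> passes to the value of \<open>T\<close>.\<close>
lemma dist_estimate:
  fixes T :: "'n::finite distribution"
  assumes "compact K"
  shows "\<exists>B\<ge>0. \<exists>N. \<forall>\<phi> e. \<phi> \<in> test_functions \<longrightarrow> supp \<phi> \<subseteq> K \<longrightarrow>
    (\<forall>js. length js \<le> N \<longrightarrow> (\<forall>x. cmod (foldr partial js \<phi> x) \<le> e)) \<longrightarrow> cmod (apply_dist T \<phi>) \<le> B * e"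
proof -
  obtain C N where C: "C \<ge> 0" "\<And>\<phi>. \<phi> \<in> test_functions \<Longrightarrow> supp \<phi> \<subseteq> K \<Longrightarrow>
      cmod (apply_dist T \<phi>) \<le> C * (\<Sum>js\<in>{js. length js \<le> N}. SUP x. cmod (foldr partial js \<phi> x))"
    using assms dist_test_continuous[of T] unfolding test_continuous_def by meson
  have "cmod (apply_dist T \<phi>) \<le> (C * card {js :: 'n list. length js \<le> N}) * e"
    if "\<phi> \<in> test_functions" "supp \<phi> \<subseteq> K" "\<And>js x. length js \<le> N \<Longrightarrow> cmod (foldr partial js \<phi> x) \<le> e" for \<phi> e
  proof -
    have "(\<Sum>js\<in>{js. length js \<le> N}. SUP x. cmod (foldr partial js \<phi> x)) \<le> (\<Sum>js\<in>{js::'n list. length js \<le> N}. e)"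
      using that(3) by (intro sum_mono cSUP_least) auto
    also have "\<dots> = card {js :: 'n list. length js \<le> N} * e" by simp
    finally show ?thesis using C(2)[OF that(1,2)] C(1)
      by (smt (verit, best) mult.assoc mult_left_mono)
  qed
  then show ?thesis using C(1) by (intro exI[of _ "C * card {js :: 'n list. length js \<le> N}"] conjI exI[of _ N]) auto
qed

text \<open>Joint continuity over a compact parameter set gives a modulus of continuity in the parameter
  that is uniform in \<open>x\<close>, simultaneously for the finitely many derivatives that a distribution sees.\<close>
lemma equicontinuous_family:
  fixes f :: "'j \<Rightarrow> 'p::metric_space \<Rightarrow> real^'n::finite \<Rightarrow> complex"
  assumes "finite J" "compact P" "compact K"
    and "\<And>j. j \<in> J \<Longrightarrow> continuous_on (P \<times> K) (\<lambda>(p, x). f j p x)"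
    and "\<And>j p x. p \<in> P \<Longrightarrow> x \<notin> K \<Longrightarrow> f j p x = 0" and "e > 0"
  shows "\<exists>d>0. \<forall>j\<in>J. \<forall>p\<in>P. \<forall>q\<in>P. \<forall>x. dist p q < d \<longrightarrow> cmod (f j p x - f j q x) \<le> e"
  using assms(1,4)
proof (induction J rule: finite_induct)
  case empty
  show ?case by (intro exI[of _ 1]) auto
next
  case (insert j J)
  obtain d1 where d1: "d1 > 0" "\<forall>j\<in>J. \<forall>p\<in>P. \<forall>q\<in>P. \<forall>x. dist p q < d1 \<longrightarrow> cmod (f j p x - f j q x) \<le> e"
    using insert.IH insert.prems by (meson insertI2)
  have "uniformly_continuous_on (P \<times> K) (\<lambda>(p, x). f j p x)"
    using insert assms by (intro compact_uniformly_continuous compact_Times) auto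
  then obtain d2 where d2: "d2 > 0" "\<And>z w. z \<in> P \<times> K \<Longrightarrow> w \<in> P \<times> K \<Longrightarrow> dist w z < d2 \<Longrightarrow>
      dist ((\<lambda>(p, x). f j p x) w) ((\<lambda>(p, x). f j p x) z) < e"
    using \<open>e > 0\<close> unfolding uniformly_continuous_on_def by meson
  have "cmod (f j p x - f j q x) \<le> e" if "p \<in> P" "q \<in> P" "dist p q < d2" for p q x
  proof (cases "x \<in> K")
    case True
    then show ?thesis using d2(2)[of "(q, x)" "(p, x)"] that by (simp add: dist_Pair_Pair dist_norm)
  next
    case False
    then show ?thesis using assms(5,6) that by simp
  qed
  with d1 d2(1) show ?case
    by (intro exI[of _ "min d1 d2"]) auto
qed

lemma dist_param_continuous:
  fixes \<Phi> :: "'p::metric_space \<Rightarrow> real^'n::finite \<Rightarrow> complex"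
  assumes P: "compact P" and K: "compact K"
    and \<Phi>: "\<And>p. p \<in> P \<Longrightarrow> \<Phi> p \<in> test_functions" "\<And>p. p \<in> P \<Longrightarrow> supp (\<Phi> p) \<subseteq> K"
    and cont: "\<And>js. continuous_on (P \<times> K) (\<lambda>(p, x). foldr partial js (\<Phi> p) x)"
  shows "continuous_on P (\<lambda>p. apply_dist T (\<Phi> p))"
proof -
  obtain B N where B: "B \<ge> 0" "\<And>\<phi> e. \<phi> \<in> test_functions \<Longrightarrow> supp \<phi> \<subseteq> K \<Longrightarrow>
    (\<And>js x. length js \<le> N \<Longrightarrow> cmod (foldr partial js \<phi> x) \<le> e) \<Longrightarrow> cmod (apply_dist T \<phi>) \<le> B * e"
    using dist_estimate[OF K, of T] by metis
  have zero: "foldr partial js (\<Phi> p) x = 0" if "p \<in> P" "x \<notin> K" for js p x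
    using \<Phi>(2)[OF that(1)] that(2) by (intro not_in_supp_foldr) auto
  show ?thesis
    unfolding continuous_on_iff
  proof (intro ballI allI impI)
    fix p e assume p: "p \<in> P" and e: "(0::real) < e"
    define e' where "e' = e / (B + 1)"
    have e': "e' > 0" "B * e' < e" using e B(1) by (auto simp: e'_def field_simps)
    obtain d where d: "d > 0" "\<forall>js\<in>{js. length js \<le> N}. \<forall>p\<in>P. \<forall>q\<in>P. \<forall>x. dist p q < d \<longrightarrow>
       cmod (foldr partial js (\<Phi> p) x - foldr partial js (\<Phi> q) x) \<le> e'"
      using equicontinuous_family[where f = "\<lambda>js p x. foldr partial js (\<Phi> p) x",
          OF finite_lists[of N] P K cont zero e'(1)] by blast
    have "dist (apply_dist T (\<Phi> q)) (apply_dist T (\<Phi> p)) < e" if q: "q \<in> P" "dist q p < d" for q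
    proof -
      have "cmod (apply_dist T (\<lambda>x. \<Phi> q x - \<Phi> p x)) \<le> B * e'"
      proof (rule B(2)[OF test_diff])
        show "supp (\<lambda>x. \<Phi> q x - \<Phi> p x) \<subseteq> K"
          using zero[of p _ "[]"] zero[of q _ "[]"] p q by (intro supp_minimal compact_imp_closed K) auto
      qed (use p q d(2) \<Phi> in \<open>auto simp: foldr_partial_diff\<close>)
      then show ?thesis using e'(2) p q \<Phi> by (simp add: dist_diff dist_norm)
    qed
    with d(1) show "\<exists>d>0. \<forall>x'\<in>P. dist x' p < d \<longrightarrow> dist (apply_dist T (\<Phi> x')) (apply_dist T (\<Phi> p)) < e"
      by blast
  qed
qed

text \<open>Differentiation under the distribution. The remainder \<open>\<Phi> s - \<Phi> t - (s - t) \<Phi>' t\<close> is a test function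
  all of whose derivatives are \<open>o (s - t)\<close> uniformly in \<open>x\<close>, by the mean value inequality for each
  derivative. Translations of a test function give the derivatives of \<open>T * \<phi>\<close>, dilations the
  invariance in \<open>dilation_derivative\<close>.\<close>
lemma dist_param_derivative:
  fixes \<Phi> \<Phi>' :: "real \<Rightarrow> real^'n::finite \<Rightarrow> complex"
  assumes K: "compact K"
    and \<Phi>: "\<And>t. t \<in> {a..b} \<Longrightarrow> \<Phi> t \<in> test_functions" "\<And>t. t \<in> {a..b} \<Longrightarrow> supp (\<Phi> t) \<subseteq> K"
    and \<Phi>': "\<And>t. t \<in> {a..b} \<Longrightarrow> \<Phi>' t \<in> test_functions" "\<And>t. t \<in> {a..b} \<Longrightarrow> supp (\<Phi>' t) \<subseteq> K"
    and deriv: "\<And>js x t. t \<in> {a..b} \<Longrightarrow>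
      ((\<lambda>t. foldr partial js (\<Phi> t) x) has_vector_derivative foldr partial js (\<Phi>' t) x) (at t within {a..b})"
    and cont: "\<And>js. continuous_on ({a..b} \<times> K) (\<lambda>(t, x). foldr partial js (\<Phi>' t) x)"
    and t: "t \<in> {a..b}"
  shows "((\<lambda>t. apply_dist T (\<Phi> t)) has_vector_derivative apply_dist T (\<Phi>' t)) (at t within {a..b})"
proof -
  obtain B N where B: "B \<ge> 0" "\<And>\<phi> e. \<phi> \<in> test_functions \<Longrightarrow> supp \<phi> \<subseteq> K \<Longrightarrow>
    (\<And>js x. length js \<le> N \<Longrightarrow> cmod (foldr partial js \<phi> x) \<le> e) \<Longrightarrow> cmod (apply_dist T \<phi>) \<le> B * e"
    using dist_estimate[OF K, of T] by metis
  have zero: "foldr partial js (\<Phi>' t) x = 0" if "t \<in> {a..b}" "x \<notin> K" for js t x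
    using \<Phi>'(2)[OF that(1)] that(2) by (intro not_in_supp_foldr) auto
  have zero': "\<Phi> t x = 0" if "t \<in> {a..b}" "x \<notin> K" for t x
    using \<Phi>(2)[OF that(1)] that(2) by (intro not_in_supp) auto
  show ?thesis
    unfolding has_vector_derivative_def has_derivative_within_alt
  proof (intro conjI allI impI)
    fix e :: real assume e: "e > 0"
    define e' where "e' = e / (B + 1)"
    have e': "e' > 0" "B * e' \<le> e" using e B(1) by (auto simp: e'_def field_simps)
    obtain d where d: "d > 0" "\<forall>js\<in>{js. length js \<le> N}. \<forall>p\<in>{a..b}. \<forall>q\<in>{a..b}. \<forall>x. dist p q < d \<longrightarrow>
       cmod (foldr partial js (\<Phi>' p) x - foldr partial js (\<Phi>' q) x) \<le> e'"
      using equicontinuous_family[where f = "\<lambda>js p x. foldr partial js (\<Phi>' p) x",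
          OF finite_lists[of N] compact_Icc K cont zero e'(1)] by blast
    have "cmod (apply_dist T (\<Phi> s) - apply_dist T (\<Phi> t) - (s - t) *\<^sub>R apply_dist T (\<Phi>' t)) \<le> e * norm (s - t)"
      if s: "s \<in> {a..b}" "norm (s - t) < d" for s
    proof -
      define R where "R x = (\<Phi> s x - \<Phi> t x) - of_real (s - t) * \<Phi>' t x" for x
      have "R \<in> test_functions" unfolding R_def using s t \<Phi> \<Phi>' by (intro test_diff test_cmult) auto
      moreover have "supp R \<subseteq> K"
        using zero[of t _ "[]"] zero' s t unfolding R_def
        by (intro supp_minimal compact_imp_closed K) auto
      moreover have "cmod (foldr partial js R x) \<le> e' * norm (s - t)" if "length js \<le> N" for js x
      proof -
        have "foldr partial js R x
          = foldr partial js (\<Phi> s) x - foldr partial js (\<Phi> t) x - (s - t) *\<^sub>R foldr partial js (\<Phi>' t) x"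
          unfolding R_def using s t \<Phi> \<Phi>'
          by (simp add: foldr_partial_diff foldr_partial_cmult test_diff test_cmult scaleR_conv_of_real)
        moreover have "norm \<dots> \<le> norm (s - t) * e'"
        proof (rule vector_differentiable_bound_linearization[where S = "closed_segment t s"])
          have sub: "closed_segment t s \<subseteq> {a..b}"
            using s t by (simp add: closed_segment_subset)
          show "((\<lambda>t. foldr partial js (\<Phi> t) x) has_vector_derivative foldr partial js (\<Phi>' r) x)
              (at r within closed_segment t s)" if "r \<in> closed_segment t s" for r
            using deriv[of r] sub that has_vector_derivative_within_subset by blast
          show "norm (foldr partial js (\<Phi>' r) x - foldr partial js (\<Phi>' t) x) \<le> e'"
            if r: "r \<in> closed_segment t s" for r
          proof -
            have "dist r t < d" using segment_bound1[OF r] s by (simp add: dist_norm)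
            then show ?thesis using d(2) \<open>length js \<le> N\<close> sub r t by blast
          qed
        qed auto
        ultimately show ?thesis by (simp add: mult.commute)
      qed
      ultimately have "cmod (apply_dist T R) \<le> B * (e' * norm (s - t))" by (rule B(2))
      also have "\<dots> \<le> e * norm (s - t)" using e'(2) by (metis mult.assoc mult_right_mono norm_ge_zero)
      also have "apply_dist T R = apply_dist T (\<Phi> s) - apply_dist T (\<Phi> t) - (s - t) *\<^sub>R apply_dist T (\<Phi>' t)"
        unfolding R_def using s t \<Phi> \<Phi>' by (simp add: dist_diff dist_cmult test_diff test_cmult scaleR_conv_of_real)
      finally show ?thesis .
    qed
    with d(1) show "\<exists>d>0. \<forall>y\<in>{a..b}. norm (y - t) < d \<longrightarrow>
        cmod (apply_dist T (\<Phi> y) - apply_dist T (\<Phi> t) - (y - t) *\<^sub>R apply_dist T (\<Phi>' t)) \<le> e * norm (y - t)"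
      by blast
  qed (rule bounded_linear_scaleR_left)
qed

section \<open>Regularization\<close>

text \<open>The reflection is written as a scalar multiple so that the argument of \<open>\<phi>\<close> is an affine map of the
  form \<open>a + s y\<close>, to which \<open>foldr_partial_affine\<close> applies.\<close>
definition conv :: "'n::finite distribution \<Rightarrow> (real^'n \<Rightarrow> complex) \<Rightarrow> real^'n \<Rightarrow> complex" where
  "conv T \<phi> x = apply_dist T (\<lambda>y. \<phi> (x + (- 1) *\<^sub>R y))"

lemma test_affine:
  assumes "\<phi> \<in> test_functions" "s \<noteq> 0"
  shows "(\<lambda>y. \<phi> (a + s *\<^sub>R y)) \<in> test_functions"
proof (rule testI)
  show "smooth (\<lambda>y. \<phi> (a + s *\<^sub>R y))" using assms by (intro smooth_affine test_smooth)
  show "compact ((\<lambda>y. (1/s) *\<^sub>R (y - a)) ` supp \<phi>)"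
    using assms by (intro compact_continuous_image continuous_intros test_compact)
  fix y assume y: "y \<notin> (\<lambda>y. (1/s) *\<^sub>R (y - a)) ` supp \<phi>"
  have "y = (1/s) *\<^sub>R ((a + s *\<^sub>R y) - a)" using assms(2) by simp
  then have "a + s *\<^sub>R y \<notin> supp \<phi>" using y by blast
  then show "\<phi> (a + s *\<^sub>R y) = 0" by (rule not_in_supp)
qed

lemma supp_affine:
  assumes "s \<noteq> 0"
  shows "supp (\<lambda>y. \<phi> (a + s *\<^sub>R y)) \<subseteq> {y. a + s *\<^sub>R y \<in> supp \<phi>}"
proof (rule supp_minimal)
  have "closed ((\<lambda>y. a + s *\<^sub>R y) -` supp \<phi>)"
    by (rule closed_vimage) (auto simp: supp_def intro!: continuous_intros)
  then show "closed {y. a + s *\<^sub>R y \<in> supp \<phi>}" by (simp add: vimage_def)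
qed (auto intro: not_in_supp)

lemma conv_partial_dist:
  assumes "\<phi> \<in> test_functions"
  shows "conv (partial_dist j T) \<phi> x = conv T (partial j \<phi>) x"
proof -
  have "partial j (\<lambda>y. \<phi> (x + (- 1) *\<^sub>R y)) = (\<lambda>y. (- 1) * partial j \<phi> (x + (- 1) *\<^sub>R y))"
    using partial_affine[OF test_smooth[OF assms], of j x "-1"] by simp
  moreover have "(\<lambda>y. partial j \<phi> (x + (- 1) *\<^sub>R y)) \<in> test_functions"
    using test_affine[OF partial_test[OF assms], of "-1"] by simp
  ultimately show ?thesis
    using test_affine[OF assms, of "-1" x] dist_cmult[of _ T "-1"]
    by (simp add: conv_def partial_dist.rep_eq)
qed

text \<open>For \<open>x\<close> in a compact set, the supports of the functions \<open>y \<mapsto> \<phi> (x - y)\<close> stay in one compact set, as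
  required for the seminorm estimate.\<close>
lemma conv_family_supp:
  fixes \<phi> :: "real^'n::finite \<Rightarrow> complex"
  assumes "\<phi> \<in> test_functions" "compact P"
  shows "\<exists>K. compact K \<and> (\<forall>x\<in>P. supp (\<lambda>y. \<phi> (x + (- 1) *\<^sub>R y)) \<subseteq> K)"
proof (intro exI[of _ "(\<lambda>(x, z). x - z) ` (P \<times> supp \<phi>)"] conjI ballI)
  show "compact ((\<lambda>(x, z). x - z) ` (P \<times> supp \<phi>))"
    using assms by (intro compact_continuous_image compact_Times test_compact)
      (auto simp: case_prod_unfold intro!: continuous_intros)
  fix x assume x: "x \<in> P"
  show "supp (\<lambda>y. \<phi> (x + (- 1) *\<^sub>R y)) \<subseteq> (\<lambda>(x, z). x - z) ` (P \<times> supp \<phi>)"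
  proof
    fix y assume "y \<in> supp (\<lambda>y. \<phi> (x + (- 1) *\<^sub>R y))"
    then have "x - y \<in> supp \<phi>" using supp_affine[of "-1" \<phi> x] by auto
    then show "y \<in> (\<lambda>(x, z). x - z) ` (P \<times> supp \<phi>)" using x by (intro image_eqI[of _ _ "(x, x - y)"]) auto
  qed
qed

lemma continuous_conv:
  fixes \<phi> :: "real^'n::finite \<Rightarrow> complex"
  assumes \<phi>: "\<phi> \<in> test_functions"
  shows "continuous_on UNIV (conv T \<phi>)"
proof -
  have "continuous_on (cball x 1) (conv T \<phi>)" for x
  proof -
    from conv_family_supp[OF \<phi> compact_cball[of x 1]]
    obtain K where K: "compact K" "\<forall>z\<in>cball x 1. supp (\<lambda>y. \<phi> (z + (- 1) *\<^sub>R y)) \<subseteq> K"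
      by (elim exE conjE)
    show ?thesis
      unfolding conv_def
    proof (rule dist_param_continuous[OF compact_cball K(1)])
      show "continuous_on (cball x 1 \<times> K) (\<lambda>(p, xa). foldr partial js (\<lambda>y. \<phi> (p + (- 1) *\<^sub>R y)) xa)" for js
        unfolding foldr_partial_affine[OF test_smooth[OF \<phi>]] case_prod_unfold
        by (intro continuous_intros
            continuous_on_compose2[OF smooth_continuous[OF smooth_foldr_partial[OF test_smooth[OF \<phi>]], of UNIV]]) auto
    qed (use test_affine[OF \<phi>, of "-1"] K(2) in simp_all)
  qed
  then have "continuous (at x) (conv T \<phi>)" for x
    by (metis centre_in_ball continuous_on_interior interior_cball zero_less_one)
  then show ?thesis by (simp add: continuous_at_imp_continuous_on)
qed

lemma conv_derivative:
  fixes \<phi> :: "real^'n::finite \<Rightarrow> complex"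
  assumes \<phi>: "\<phi> \<in> test_functions"
  shows "((\<lambda>t. conv T \<phi> (x + t *\<^sub>R axis j 1)) has_vector_derivative conv (partial_dist j T) \<phi> (x + t *\<^sub>R axis j 1)) (at t)"
proof -
  let ?g = "\<lambda>t. x + t *\<^sub>R (axis j 1 :: real^'n)"
  have "compact (?g ` {t-1..t+1})" by (intro compact_continuous_image continuous_intros) auto
  from conv_family_supp[OF \<phi> this] conv_family_supp[OF partial_test[OF \<phi>, of j] this]
  obtain K1 K2 where K1: "compact K1" "\<forall>x\<in>?g ` {t-1..t+1}. supp (\<lambda>y. \<phi> (x + (- 1) *\<^sub>R y)) \<subseteq> K1"
    and K2: "compact K2" "\<forall>x\<in>?g ` {t-1..t+1}. supp (\<lambda>y. partial j \<phi> (x + (- 1) *\<^sub>R y)) \<subseteq> K2"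
    by (elim exE conjE)
  have K: "supp (\<lambda>y. \<phi> (?g s + (- 1) *\<^sub>R y)) \<subseteq> K1 \<union> K2"
    "supp (\<lambda>y. partial j \<phi> (?g s + (- 1) *\<^sub>R y)) \<subseteq> K1 \<union> K2" if "s \<in> {t-1..t+1}" for s
    using bspec[OF K1(2) imageI[OF that]] bspec[OF K2(2) imageI[OF that]] by (simp_all add: le_supI1 le_supI2)
  have sm: "smooth \<phi>" "smooth (partial j \<phi>)" using \<phi> by (auto intro: smooth_partial test_smooth)
  have "((\<lambda>s. apply_dist T (\<lambda>y. \<phi> (?g s + (- 1) *\<^sub>R y))) has_vector_derivative
      apply_dist T (\<lambda>y. partial j \<phi> (?g t + (- 1) *\<^sub>R y))) (at t within {t-1..t+1})"
  proof (rule dist_param_derivative[where K = "K1 \<union> K2"])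
    fix js :: "'n list" and z and s :: real assume "s \<in> {t-1..t+1}"
    let ?\<psi> = "foldr partial js \<phi>"
    have "((\<lambda>s. ?\<psi> ((x + (- 1) *\<^sub>R z) + s *\<^sub>R axis j 1)) has_vector_derivative
        partial j ?\<psi> ((x + (- 1) *\<^sub>R z) + s *\<^sub>R axis j 1)) (at s within {t-1..t+1})"
      by (rule vector_derivative_axis[OF smooth_differentiable[OF smooth_foldr_partial[OF sm(1)]]])
    then have "((\<lambda>s. of_real (- 1) ^ length js * ?\<psi> (?g s + (- 1) *\<^sub>R z)) has_vector_derivative
        of_real (- 1) ^ length js * partial j ?\<psi> (?g s + (- 1) *\<^sub>R z)) (at s within {t-1..t+1})"
      by (intro has_vector_derivative_mult_right) (simp add: algebra_simps)
    then show "((\<lambda>s. foldr partial js (\<lambda>y. \<phi> (?g s + (- 1) *\<^sub>R y)) z) has_vector_derivative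
          foldr partial js (\<lambda>y. partial j \<phi> (?g s + (- 1) *\<^sub>R y)) z) (at s within {t-1..t+1})"
      unfolding foldr_partial_affine[OF sm(1)] foldr_partial_affine[OF sm(2)]
        foldr_partial_commute[OF sm(1)] .
  next
    show "continuous_on ({t-1..t+1} \<times> (K1 \<union> K2)) (\<lambda>(s, z). foldr partial js (\<lambda>y. partial j \<phi> (?g s + (- 1) *\<^sub>R y)) z)" for js
      unfolding foldr_partial_affine[OF sm(2)] case_prod_unfold
      by (intro continuous_intros
          continuous_on_compose2[OF smooth_continuous[OF smooth_foldr_partial[OF sm(2)], of UNIV]]) auto
  next
    show "compact (K1 \<union> K2)" using K1(1) K2(1) by (rule compact_Un)
    show "t \<in> {t-1..t+1}" by simp
  qed (use K test_affine[OF \<phi>, of "-1"] test_affine[OF partial_test[OF \<phi>], of "-1"] in simp_all)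
  then have "((\<lambda>s. conv T \<phi> (?g s)) has_vector_derivative conv T (partial j \<phi>) (?g t)) (at t within {t-1..t+1})"
    by (simp add: conv_def)
  then show ?thesis
    by (subst conv_partial_dist[OF \<phi>])
      (simp add: has_vector_derivative_def at_within_interior[of t "{t-1..t+1}"])
qed


section \<open>Joint eigenvectors of the derivations\<close>

definition exp_fun :: "complex^'n::finite \<Rightarrow> real^'n \<Rightarrow> complex" where
  "exp_fun c x = exp (\<Sum>j\<in>UNIV. c $ j * complex_of_real (x $ j))"

lemma exp_fun_has_derivative:
  fixes c :: "complex^'n::finite"
  shows "(exp_fun c has_derivative (\<lambda>h. (\<Sum>j\<in>UNIV. c $ j * complex_of_real (h $ j)) * exp_fun c x)) (at x)"
proof -
  have "((\<lambda>x::real^'n. complex_of_real (x $ j)) has_derivative (\<lambda>h. complex_of_real (h $ j))) (at x)" for j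
    using has_derivative_coord[of j 0 x] by simp
  then have "((\<lambda>x::real^'n. \<Sum>j\<in>UNIV. c $ j * complex_of_real (x $ j)) has_derivative
      (\<lambda>h. \<Sum>j\<in>UNIV. c $ j * complex_of_real (h $ j))) (at x)"
    by (intro has_derivative_sum has_derivative_mult_right)
  from has_derivative_compose[OF this, of exp "(*) (exp (\<Sum>j\<in>UNIV. c $ j * complex_of_real (x $ j)))"]
  show ?thesis
    using DERIV_exp[of "\<Sum>j\<in>UNIV. c $ j * complex_of_real (x $ j)", unfolded has_field_derivative_def]
    by (simp add: exp_fun_def[abs_def] mult.commute)
qed

lemma partial_exp_fun: "partial j (exp_fun c) = (\<lambda>x. c $ j * exp_fun c x)"
proof
  fix x
  have "(\<Sum>i\<in>UNIV. c $ i * complex_of_real (axis j 1 $ i)) = c $ j"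
    by (simp add: axis_def if_distrib[of complex_of_real] if_distrib[of "\<lambda>r. _ * r"] cong: if_cong)
  then show "partial j (exp_fun c) x = c $ j * exp_fun c x"
    using partial_eqI[OF exp_fun_has_derivative, of j c x] by simp
qed

lemma smooth_exp_fun: "smooth (exp_fun c)"
proof (rule smooth_coinduct[of "\<lambda>f. \<exists>a. f = (\<lambda>x. a * exp_fun c x)"])
  show "\<exists>a. exp_fun c = (\<lambda>x. a * exp_fun c x)" by (intro exI[of _ 1]) simp
  have diff: "exp_fun c differentiable at x" for x
    using exp_fun_has_derivative[of c x] by (auto simp: differentiable_def)
  fix f x j assume "\<exists>a. f = (\<lambda>x. a * exp_fun c x)"
  then obtain a where a: "f = (\<lambda>x. a * exp_fun c x)" by blast
  show "f differentiable at x"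
    unfolding a using diff by (intro differentiable_mult differentiable_const)
  have "partial j f = (\<lambda>x. (a * c $ j) * exp_fun c x)"
    unfolding a using partial_cmult[OF diff, of j a] by (auto simp: partial_exp_fun)
  then show "\<exists>a. partial j f = (\<lambda>x. a * exp_fun c x)" by blast
qed

lemma test_mult:
  assumes "smooth f" "\<phi> \<in> test_functions"
  shows "(\<lambda>x. f x * \<phi> x) \<in> test_functions"
  by (rule testI[OF smooth_mult[OF assms(1) test_smooth[OF assms(2)]] test_compact[OF assms(2)]])
    (simp add: not_in_supp)

lemma partial_exp_mult:
  assumes "\<phi> \<in> test_functions"
  shows "partial j (\<lambda>x. exp_fun c x * \<phi> x) = (\<lambda>x. exp_fun c x * (partial j \<phi> x + c $ j * \<phi> x))"
proof
  fix x
  show "partial j (\<lambda>x. exp_fun c x * \<phi> x) x = exp_fun c x * (partial j \<phi> x + c $ j * \<phi> x)"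
    using partial_mult[OF smooth_differentiable[OF smooth_exp_fun] smooth_differentiable[OF test_smooth[OF assms]], of j c x]
    by (simp add: partial_exp_fun algebra_simps)
qed

text \<open>Multiplication by an exponential commutes with \<open>\<partial>\<^sub>j\<close> up to adding a constant to \<open>\<partial>\<^sub>j\<close>, so it is
  continuous for the seminorms of test functions; the induction peels off the innermost derivative.
  This is what makes the product of a distribution with an exponential a distribution.\<close>
lemma exp_mult_estimate:
  fixes c :: "complex^'n::finite" and K :: "(real^'n) set"
  assumes K: "compact K"
  shows "\<exists>B\<ge>0. \<forall>\<phi> e. \<phi> \<in> test_functions \<longrightarrow> supp \<phi> \<subseteq> K \<longrightarrow>
    (\<forall>ks. length ks \<le> length js \<longrightarrow> (\<forall>x. cmod (foldr partial ks \<phi> x) \<le> e)) \<longrightarrow>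
    (\<forall>x. cmod (foldr partial js (\<lambda>x. exp_fun c x * \<phi> x) x) \<le> B * e)"
proof (induction js rule: rev_induct)
  case Nil
  have "bounded (exp_fun c ` K)"
    by (intro compact_imp_bounded compact_continuous_image K smooth_continuous smooth_exp_fun)
  then obtain B where B: "\<And>x. x \<in> K \<Longrightarrow> cmod (exp_fun c x) \<le> B" by (auto simp: bounded_iff)
  show ?case
  proof (intro exI[of _ "max B 0"] conjI allI impI)
    fix \<phi> e and x :: "real^'n"
    assume \<phi>: "\<phi> \<in> test_functions" "supp \<phi> \<subseteq> K"
      "\<forall>ks. length ks \<le> length ([]::'n list) \<longrightarrow> (\<forall>x. cmod (foldr partial ks \<phi> x) \<le> e)"
    have e: "cmod (\<phi> x) \<le> e" using \<phi>(3) by auto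
    show "cmod (foldr partial [] (\<lambda>x. exp_fun c x * \<phi> x) x) \<le> max B 0 * e"
    proof (cases "x \<in> K")
      case True
      then show ?thesis using B[OF True] e by (auto simp: norm_mult intro!: mult_mono)
    next
      case False
      then have "\<phi> x = 0" using \<phi>(2) not_in_supp by blast
      then show ?thesis using e by simp
    qed
  qed simp
next
  case (snoc j js)
  then obtain B where B: "B \<ge> 0" "\<And>\<phi> e x. \<phi> \<in> test_functions \<Longrightarrow> supp \<phi> \<subseteq> K \<Longrightarrow>
    (\<And>ks x. length ks \<le> length js \<Longrightarrow> cmod (foldr partial ks \<phi> x) \<le> e) \<Longrightarrow>
    cmod (foldr partial js (\<lambda>x. exp_fun c x * \<phi> x) x) \<le> B * e" by metis
  show ?case
  proof (intro exI[of _ "B * (1 + cmod (c $ j))"] conjI allI impI)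
    fix \<phi> e and x :: "real^'n"
    assume \<phi>: "\<phi> \<in> test_functions" "supp \<phi> \<subseteq> K"
      "\<forall>ks. length ks \<le> length (js @ [j]) \<longrightarrow> (\<forall>x. cmod (foldr partial ks \<phi> x) \<le> e)"
    let ?\<psi> = "\<lambda>x. partial j \<phi> x + c $ j * \<phi> x"
    have t: "partial j \<phi> \<in> test_functions" "(\<lambda>x. c $ j * \<phi> x) \<in> test_functions"
      using \<phi> by (auto intro: partial_test test_cmult)
    have "cmod (foldr partial js (\<lambda>x. exp_fun c x * ?\<psi> x) x) \<le> B * (e + cmod (c $ j) * e)"
    proof (rule B(2))
      show "?\<psi> \<in> test_functions" using t by (rule test_add)
      show "supp ?\<psi> \<subseteq> K"
      proof (rule supp_minimal)
        fix y assume "y \<notin> K"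
        then have "y \<notin> supp \<phi>" using \<phi>(2) by blast
        then show "?\<psi> y = 0" using not_in_supp[of y \<phi>] not_in_supp_foldr[of y \<phi> "[j]"] by simp
      qed (use K compact_imp_closed in blast)
      fix ks :: "'n list" and y assume ks: "length ks \<le> length js"
      have "cmod (foldr partial ks (partial j \<phi>) y) \<le> e"
        using \<phi>(3)[rule_format, of "ks @ [j]" y] ks by simp
      moreover have "cmod (foldr partial ks \<phi> y) \<le> e" using \<phi>(3) ks by simp
      ultimately show "cmod (foldr partial ks ?\<psi> y) \<le> e + cmod (c $ j) * e"
        unfolding foldr_partial_add[OF t] foldr_partial_cmult[OF \<phi>(1)]
        by (intro order_trans[OF norm_triangle_ineq] add_mono) (auto simp: norm_mult intro!: mult_left_mono)
    qed
    moreover have "B * (1 + cmod (c $ j)) * e = B * (e + cmod (c $ j) * e)" by (simp add: algebra_simps)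
    ultimately show "cmod (foldr partial (js @ [j]) (\<lambda>x. exp_fun c x * \<phi> x) x) \<le> B * (1 + cmod (c $ j)) * e"
      by (simp only: foldr_append foldr_Cons foldr_Nil o_apply id_apply partial_exp_mult[OF \<phi>(1)])
  qed (use B(1) in simp)
qed

lift_definition exp_mult_dist :: "complex^'n \<Rightarrow> 'n::finite distribution \<Rightarrow> 'n distribution" is
  "\<lambda>c T \<phi>. if \<phi> \<in> test_functions then T (\<lambda>x. exp_fun c x * \<phi> x) else 0"
proof (intro CollectI conjI ballI allI impI, goal_cases)
  case (1 c T \<phi> \<psi>)
  then show ?case
    using test_mult[OF smooth_exp_fun[of c]] by (simp add: test_add distrib_left)
next
  case (2 c T a \<phi>)
  have "(\<lambda>x. exp_fun c x * (a * \<phi> x)) = (\<lambda>x. a * (exp_fun c x * \<phi> x))" by (simp add: mult_ac)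
  with 2 show ?case
    using test_mult[OF smooth_exp_fun[of c], of \<phi>] by (simp add: test_cmult)
next
  case (3 c T)
  have T: "test_continuous T" using 3 by blast
  show ?case
    unfolding test_continuous_def
  proof (intro allI impI)
    fix K :: "(real^'n) set" assume K: "compact K"
    let ?S = "\<lambda>N \<phi>. \<Sum>js\<in>{js. length js \<le> N}. SUP x. cmod (foldr partial js \<phi> x)"
    obtain C N where C: "C \<ge> 0" "\<And>\<phi>. \<phi> \<in> test_functions \<Longrightarrow> supp \<phi> \<subseteq> K \<Longrightarrow>
      cmod (T \<phi>) \<le> C * ?S N \<phi>"
      using T K unfolding test_continuous_def by meson
    have "\<forall>js. \<exists>B\<ge>0. \<forall>\<phi> e. \<phi> \<in> test_functions \<longrightarrow> supp \<phi> \<subseteq> K \<longrightarrow>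
      (\<forall>ks. length ks \<le> length js \<longrightarrow> (\<forall>x. cmod (foldr partial ks \<phi> x) \<le> e)) \<longrightarrow>
      (\<forall>x. cmod (foldr partial js (\<lambda>x. exp_fun c x * \<phi> x) x) \<le> B * e)"
      using exp_mult_estimate[OF K] by blast
    from choice[OF this] obtain B where B: "\<forall>js. B js \<ge> 0 \<and> (\<forall>\<phi> e. \<phi> \<in> test_functions \<longrightarrow> supp \<phi> \<subseteq> K \<longrightarrow>
      (\<forall>ks. length ks \<le> length js \<longrightarrow> (\<forall>x. cmod (foldr partial ks \<phi> x) \<le> e)) \<longrightarrow>
      (\<forall>x. cmod (foldr partial js (\<lambda>x. exp_fun c x * \<phi> x) x) \<le> B js * e))" by (elim exE)
    note B1 = B[THEN spec, THEN conjunct1] and B2 = B[THEN spec, THEN conjunct2, rule_format]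
    define M where "M = (\<Sum>js\<in>{js. length js \<le> N}. B js)"
    have "cmod (T (\<lambda>x. exp_fun c x * \<phi> x)) \<le> (C * M) * ?S N \<phi>"
      if \<phi>: "\<phi> \<in> test_functions" "supp \<phi> \<subseteq> K" for \<phi>
    proof -
      have bd: "cmod (foldr partial ks \<phi> x) \<le> ?S N \<phi>" if ks: "length ks \<le> N" for ks x
      proof -
        have "cmod (foldr partial ks \<phi> x) \<le> (SUP x. cmod (foldr partial ks \<phi> x))"
          by (rule cSUP_upper[OF UNIV_I bdd_above_foldr_partial[OF \<phi>(1)]])
        also have "\<dots> \<le> ?S N \<phi>"
          using ks \<phi>(1) by (intro member_le_sum finite_lists SUP_foldr_partial_nonneg) auto
        finally show ?thesis .
      qed
      have "supp (\<lambda>x. exp_fun c x * \<phi> x) \<subseteq> K"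
        using \<phi>(2) not_in_supp[of _ \<phi>] by (intro supp_minimal compact_imp_closed K) fastforce
      then have "cmod (T (\<lambda>x. exp_fun c x * \<phi> x)) \<le> C * ?S N (\<lambda>x. exp_fun c x * \<phi> x)"
        by (intro C(2) test_mult smooth_exp_fun \<phi>)
      also have "\<dots> \<le> C * (\<Sum>js\<in>{js. length js \<le> N}. B js * ?S N \<phi>)"
        using bd by (intro mult_left_mono C(1) sum_mono cSUP_least B2 \<phi>) auto
      also have "\<dots> = (C * M) * ?S N \<phi>" by (simp add: M_def sum_distrib_right)
      finally show ?thesis .
    qed
    moreover have "C * M \<ge> 0" unfolding M_def using B1 C(1) by (intro mult_nonneg_nonneg sum_nonneg)
    ultimately show "\<exists>C\<ge>0. \<exists>N. \<forall>\<phi>\<in>test_functions. supp \<phi> \<subseteq> K \<longrightarrow>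
        cmod (if \<phi> \<in> test_functions then T (\<lambda>x. exp_fun c x * \<phi> x) else 0) \<le> C * ?S N \<phi>"
      by (intro exI[of _ "C * M"] conjI exI[of _ N]) auto
  qed
qed auto

definition dilate :: "real^'n::finite \<Rightarrow> real \<Rightarrow> real^'n \<Rightarrow> real^'n" where
  "dilate z s x = (z - s *\<^sub>R z) + s *\<^sub>R x"

lemma smooth_dilate: "smooth \<psi> \<Longrightarrow> smooth (\<lambda>x. \<psi> (dilate z s x))"
  unfolding dilate_def by (rule smooth_affine)

lemma partial_dilate:
  "smooth \<psi> \<Longrightarrow> partial k (\<lambda>x. \<psi> (dilate z s x)) = (\<lambda>x. of_real s * partial k \<psi> (dilate z s x))"
  unfolding dilate_def by (rule partial_affine)

lemma smooth_sum:
  assumes "finite J" "\<And>j. j \<in> J \<Longrightarrow> smooth (f j)" shows "smooth (\<lambda>x. \<Sum>j\<in>J. f j x)"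
  using assms by (induction J rule: finite_induct) (simp_all add: smooth_add smooth_const)

lemma partial_add_smooth:
  assumes "smooth f" "smooth g" shows "partial k (\<lambda>x. f x + g x) = (\<lambda>x. partial k f x + partial k g x)"
  by (rule ext, rule partial_add[OF smooth_differentiable[OF assms(1)] smooth_differentiable[OF assms(2)]])

lemma partial_sum_smooth:
  assumes "finite J" "\<And>j. j \<in> J \<Longrightarrow> smooth (f j)"
  shows "partial k (\<lambda>x. \<Sum>j\<in>J. f j x) = (\<lambda>x. \<Sum>j\<in>J. partial k (f j) x)"
  using assms
proof (induction J rule: finite_induct)
  case (insert i J)
  have "smooth (f i)" using insert.prems by simp
  moreover have "smooth (\<lambda>x. \<Sum>j\<in>J. f j x)" using insert by (intro smooth_sum) simp_all
  ultimately have "partial k (\<lambda>x. f i x + (\<Sum>j\<in>J. f j x)) = (\<lambda>x. partial k (f i) x + partial k (\<lambda>x. \<Sum>j\<in>J. f j x) x)"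
    by (rule partial_add_smooth)
  then show ?case using insert by simp
qed simp

lemma partial_coord_dilate:
  assumes \<psi>: "smooth \<psi>"
  shows "partial k (\<lambda>x. complex_of_real (x $ j - z $ j) * \<psi> (dilate z s x)) =
    (\<lambda>x. (if j = k then \<psi> (dilate z s x) else 0) + of_real s * (complex_of_real (x $ j - z $ j) * partial k \<psi> (dilate z s x)))"
proof
  fix x
  have "partial k (\<lambda>x. complex_of_real (x $ j - z $ j) * \<psi> (dilate z s x)) x
    = partial k (\<lambda>x. complex_of_real (x $ j - z $ j)) x * \<psi> (dilate z s x)
     + complex_of_real (x $ j - z $ j) * partial k (\<lambda>x. \<psi> (dilate z s x)) x"
    by (rule partial_mult[OF smooth_differentiable[OF smooth_coord] smooth_differentiable[OF smooth_dilate[OF \<psi>]]])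
  then show "partial k (\<lambda>x. complex_of_real (x $ j - z $ j) * \<psi> (dilate z s x)) x = (if j = k then \<psi> (dilate z s x) else 0) + of_real s * (complex_of_real (x $ j - z $ j) * partial k \<psi> (dilate z s x))"
    unfolding partial_coord partial_dilate[OF \<psi>] by (simp only: mult_ac) simp
qed

text \<open>The derivative in \<open>s\<close> of \<open>s\<^sup>m \<psi> (dilate z s x)\<close>. The family is closed under partial derivatives in \<open>x\<close>:
  each raises \<open>m\<close> by one and differentiates \<open>\<psi>\<close> (\<open>partial_dilation_rate\<close>), so that derivatives in \<open>s\<close> and
  in \<open>x\<close> can be exchanged to any order.\<close>
definition dilation_rate :: "real^'n::finite \<Rightarrow> nat \<Rightarrow> (real^'n \<Rightarrow> complex) \<Rightarrow> real \<Rightarrow> real^'n \<Rightarrow> complex" where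
  "dilation_rate z m \<psi> s x = of_real (real m * s ^ (m - 1)) * \<psi> (dilate z s x)
      + (\<Sum>j\<in>UNIV. of_real (s ^ m) * (complex_of_real (x $ j - z $ j) * partial j \<psi> (dilate z s x)))"

lemma smooth_coord_dilate:
  assumes "smooth \<psi>" shows "smooth (\<lambda>x. c * (complex_of_real (x $ j - z $ j) * \<psi> (dilate z s x)))"
  by (rule smooth_mult[OF smooth_const smooth_mult[OF smooth_coord smooth_dilate[OF assms]]])

lemma smooth_dilation_rate:
  assumes "smooth \<psi>" shows "smooth (dilation_rate z m \<psi> s)"
  unfolding dilation_rate_def
  by (rule smooth_add[OF smooth_mult[OF smooth_const smooth_dilate[OF assms]]
        smooth_sum[OF finite smooth_coord_dilate[OF smooth_partial[OF assms]]]])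

lemma partial_dilation_rate:
  fixes z :: "real^'n::finite"
  assumes \<psi>: "smooth \<psi>" and m: "m > 0"
  shows "partial k (dilation_rate z m \<psi> s) = dilation_rate z (Suc m) (partial k \<psi>) s"
proof
  fix x
  let ?p = "partial k \<psi>"
  let ?term = "\<lambda>j x. complex_of_real (s ^ m) * (complex_of_real (x $ j - z $ j) * partial j \<psi> (dilate z s x))"
  have ss: "s ^ m = s ^ (m - 1) * s" using m by (metis One_nat_def Suc_pred power_Suc2)
  have 1: "partial k (\<lambda>x. of_real (real m * s ^ (m - 1)) * \<psi> (dilate z s x)) x = of_real (real m * s ^ m) * ?p (dilate z s x)"
    unfolding partial_scale[OF smooth_dilate[OF \<psi>]] partial_dilate[OF \<psi>] ss by (simp add: mult_ac)
  have 2: "partial k (?term j) x = of_real (s ^ m) * (if j = k then ?p (dilate z s x) else 0)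
      + of_real (s ^ Suc m) * (complex_of_real (x $ j - z $ j) * partial j ?p (dilate z s x))" for j
    unfolding partial_scale[OF smooth_mult[OF smooth_coord smooth_dilate[OF smooth_partial[OF \<psi>]]]]
      partial_coord_dilate[OF smooth_partial[OF \<psi>]] partial_commute[OF \<psi>, of k j]
    by (auto simp add: distrib_left mult_ac simp del: of_real_diff)
  have "partial k (dilation_rate z m \<psi> s) x = partial k (\<lambda>x. of_real (real m * s ^ (m - 1)) * \<psi> (dilate z s x)) x +
     (\<Sum>j\<in>UNIV. partial k (?term j) x)"
    unfolding dilation_rate_def
      partial_add_smooth[OF smooth_mult[OF smooth_const smooth_dilate[OF \<psi>]]
        smooth_sum[OF finite smooth_coord_dilate[OF smooth_partial[OF \<psi>]]]]
      partial_sum_smooth[OF finite smooth_coord_dilate[OF smooth_partial[OF \<psi>]]] ..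
  also have "(\<Sum>j\<in>UNIV. partial k (?term j) x) = of_real (s ^ m) * ?p (dilate z s x)
      + (\<Sum>j\<in>UNIV. of_real (s ^ Suc m) * (complex_of_real (x $ j - z $ j) * partial j ?p (dilate z s x)))"
    unfolding 2 sum.distrib by (simp add: if_distrib[of "\<lambda>r. _ * r"] del: of_real_diff cong: if_cong)
  finally have E: "partial k (dilation_rate z m \<psi> s) x = of_real (real m * s ^ m) * ?p (dilate z s x) + \<dots>"
    unfolding 1 .
  show "partial k (dilation_rate z m \<psi> s) x = dilation_rate z (Suc m) (partial k \<psi>) s x"
    by (subst E) (simp add: dilation_rate_def distrib_right del: of_real_diff)
qed

text \<open>The exponent \<open>n\<close> makes the \<open>s\<close>-derivative of the normalized dilation \<open>s\<^sup>n \<phi> (dilate z s x)\<close> the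
  divergence of \<open>s\<^sup>n\<^sup>-\<^sup>1 (x - z) \<phi> (dilate z s x)\<close>, and \<open>T\<close> annihilates divergences of test fields since all
  its derivatives vanish.\<close>
lemma dilation_derivative:
  fixes T :: "'n::finite distribution"
  assumes T: "\<And>j. partial_dist j T = 0" and \<phi>: "\<phi> \<in> test_functions" and s: "s \<in> {1..b}"
  shows "((\<lambda>s. apply_dist T (\<lambda>x. of_real (s ^ CARD('n)) * \<phi> (dilate z s x))) has_vector_derivative 0)
    (at s within {1..b})"
proof -
  let ?G = "dilation_rate z"
  let ?F = "\<lambda>s x. complex_of_real (s ^ CARD('n)) * \<phi> (dilate z s x)"
  have sm: "smooth \<phi>" using \<phi> by (rule test_smooth)
  have foldrG: "foldr partial js (?G (CARD('n)) \<phi> s) = ?G (CARD('n) + length js) (foldr partial js \<phi>) s" for js s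
    by (induction js) (simp_all add: partial_dilation_rate smooth_foldr_partial[OF sm])
  have foldrF: "foldr partial js (?F s) = (\<lambda>x. of_real (s ^ (CARD('n) + length js)) * foldr partial js \<phi> (dilate z s x))"
    if "s \<noteq> 0" for js s
    unfolding dilate_def
      foldr_partial_cmult[OF test_affine[OF \<phi> that, of "z - s *\<^sub>R z"], of js "of_real (s ^ CARD('n))"]
      foldr_partial_affine[OF sm] by (simp only: power_add mult_ac of_real_mult of_real_power)
  \<comment> \<open>The union of the supports of the dilated functions, as the image of a compact set.\<close>
  define K where "K = (\<lambda>(s, y). z + (1/s) *\<^sub>R (y - z)) ` ({1..b} \<times> supp \<phi>)"
  have K: "compact K" unfolding K_def case_prod_unfold
    using test_compact[OF \<phi>] by (intro compact_continuous_image compact_Times continuous_intros) auto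
  have zero: "dilate z s x \<notin> supp \<phi>" if "x \<notin> K" "s \<in> {1..b}" for s x
  proof
    assume "dilate z s x \<in> supp \<phi>"
    moreover have "x = z + (1/s) *\<^sub>R (dilate z s x - z)" using that(2) by (simp add: dilate_def scaleR_add_right scaleR_diff_right)
    ultimately have "x \<in> K" unfolding K_def using that(2) by (intro image_eqI[of _ _ "(s, dilate z s x)"]) auto
    then show False using that(1) by blast
  qed
  have zF: "\<phi> (dilate z s x) = 0" "partial j \<phi> (dilate z s x) = 0" if "x \<notin> K" "s \<in> {1..b}" for s x j
    using not_in_supp[OF zero[OF that]] not_in_supp_foldr[OF zero[OF that], of "[j]"] by simp_all
  have testF: "?F s \<in> test_functions" if "s \<in> {1..b}" for s
    by (rule testI[OF smooth_mult[OF smooth_const smooth_dilate[OF sm]] K]) (use zF that in simp)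
  have testG: "?G (CARD('n)) \<phi> s \<in> test_functions" if "s \<in> {1..b}" for s
    by (rule testI[OF smooth_dilation_rate[OF sm] K]) (use zF that in \<open>simp add: dilation_rate_def\<close>)
  have "((\<lambda>s. apply_dist T (?F s)) has_vector_derivative apply_dist T (?G (CARD('n)) \<phi> s)) (at s within {1..b})"
  proof (rule dist_param_derivative[OF K testF _ testG])
    show "supp (?F s) \<subseteq> K" if "s \<in> {1..b}" for s
      by (rule supp_minimal[OF compact_imp_closed[OF K]]) (use zF that in simp)
    show "supp (?G (CARD('n)) \<phi> s) \<subseteq> K" if "s \<in> {1..b}" for s
      by (rule supp_minimal[OF compact_imp_closed[OF K]]) (use zF that in \<open>simp add: dilation_rate_def\<close>)
    fix js :: "'n list"
    let ?m = "CARD('n) + length js" and ?\<psi> = "foldr partial js \<phi>"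
    have sm\<psi>: "smooth ?\<psi>" using sm by (rule smooth_foldr_partial)
    show "continuous_on ({1..b} \<times> K) (\<lambda>(s, x). foldr partial js (?G (CARD('n)) \<phi> s) x)"
      unfolding foldrG dilation_rate_def dilate_def case_prod_unfold
      by (intro continuous_intros continuous_on_compose2[OF smooth_continuous[OF sm\<psi>, of UNIV]]
          continuous_on_compose2[OF smooth_continuous[OF smooth_partial[OF sm\<psi>], of UNIV]]) auto
    fix x and s :: real assume s: "s \<in> {1..b}"
    have "((\<lambda>s. dilate z s x) has_vector_derivative x - z) (at s within {1..b})"
      unfolding dilate_def by (auto intro!: derivative_eq_intros)
    from vector_derivative_along[OF smooth_differentiable[OF sm\<psi>] this]
    have 1: "((\<lambda>s. ?\<psi> (dilate z s x)) has_vector_derivative (\<Sum>j\<in>UNIV. (x - z) $ j *\<^sub>R partial j ?\<psi> (dilate z s x))) (at s within {1..b})" .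
    have "((\<lambda>s. s ^ ?m) has_real_derivative real ?m * s ^ (?m - 1)) (at s within {1..b})"
      by (auto intro!: derivative_eq_intros)
    then have 2: "((\<lambda>s. complex_of_real (s ^ ?m)) has_vector_derivative complex_of_real (real ?m * s ^ (?m - 1))) (at s within {1..b})"
      by (intro has_vector_derivative_of_real) (simp add: has_real_derivative_iff_has_vector_derivative)
    have "((\<lambda>s. of_real (s ^ ?m) * ?\<psi> (dilate z s x)) has_vector_derivative ?G ?m ?\<psi> s x) (at s within {1..b})"
      using has_vector_derivative_mult[OF 2 1]
      by (simp add: dilation_rate_def sum_distrib_left scaleR_conv_of_real add.commute)
    then show "((\<lambda>s. foldr partial js (?F s) x) has_vector_derivative foldr partial js (?G (CARD('n)) \<phi> s) x) (at s within {1..b})"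
      unfolding foldrG by (rule has_vector_derivative_transform[OF s, rotated]) (subst foldrF, auto)
  qed (use s in auto)
  moreover have "apply_dist T (?G (CARD('n)) \<phi> s) = 0"
  proof -
    define H where "H j x = of_real (s ^ (CARD('n) - 1)) * (complex_of_real (x $ j - z $ j) * \<phi> (dilate z s x))" for j x
    have testH: "H j \<in> test_functions" for j
      unfolding H_def by (rule testI[OF smooth_coord_dilate[OF sm] K]) (use zF s in simp)
    have ss: "s ^ CARD('n) = s ^ (CARD('n) - 1) * s"
      by (metis One_nat_def Suc_pred power_Suc2 zero_less_card_finite)
    have pH: "partial j (H j) x = of_real (s ^ (CARD('n) - 1)) * \<phi> (dilate z s x) +
        of_real (s ^ CARD('n)) * (complex_of_real (x $ j - z $ j) * partial j \<phi> (dilate z s x))" for j x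
      unfolding H_def partial_scale[OF smooth_mult[OF smooth_coord smooth_dilate[OF sm]]]
        partial_coord_dilate[OF sm] ss by (simp add: distrib_left del: of_real_diff)
    have G: "?G (CARD('n)) \<phi> s = (\<lambda>x. \<Sum>j\<in>UNIV. partial j (H j) x)"
      by (auto simp: dilation_rate_def pH sum.distrib simp del: of_real_diff)
    have sumT: "(\<lambda>x. \<Sum>j\<in>J. partial j (H j) x) \<in> test_functions \<and>
        apply_dist T (\<lambda>x. \<Sum>j\<in>J. partial j (H j) x) = (\<Sum>j\<in>J. apply_dist T (partial j (H j)))" if "finite J" for J
      using that
    proof (induction J rule: finite_induct)
      case empty
      have "(\<lambda>x. 0) \<in> test_functions" by (rule testI[OF smooth_const compact_empty]) simp
      then show ?case by (simp add: dist_zero)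
    next
      case (insert j J)
      then show ?case using partial_test[OF testH[of j]] by (simp add: test_add dist_add)
    qed
    have "apply_dist T (partial j (H j)) = 0" for j
    proof -
      have "apply_dist (partial_dist j T) (H j) = 0" using T by (simp add: zero_distribution.rep_eq)
      then show ?thesis using testH[of j] by (simp add: partial_dist.rep_eq)
    qed
    with sumT[of UNIV] show ?thesis unfolding G by simp
  qed
  ultimately show ?thesis by simp
qed

text \<open>Dilating about a point of \<open>W\<close> by a large factor moves the support of any test function into \<open>W\<close>
  without changing the value of \<open>T\<close>.\<close>
lemma constant_dist_zero:
  fixes T :: "'n::finite distribution"
  assumes T: "\<And>j. partial_dist j T = 0" and W: "open W" "W \<noteq> {}" and z: "eq_on_open W T 0"
  shows "T = 0"
proof (rule dist_eqI)
  fix \<phi> :: "real^'n \<Rightarrow> complex" assume \<phi>: "\<phi> \<in> test_functions"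
  obtain x0 r where x0: "r > 0" "ball x0 r \<subseteq> W" using W by (meson all_not_in_conv openE)
  obtain R where R: "\<And>y. y \<in> supp \<phi> \<Longrightarrow> dist x0 y \<le> R"
    using compact_imp_bounded[OF test_compact[OF \<phi>]] bounded_any_center[of "supp \<phi>" x0] by auto
  \<comment> \<open>Dilation by \<open>b\<close> shrinks a support within distance \<open>R\<close> of \<open>x0\<close> to within distance \<open>\<bar>R\<bar> / b < r\<close>.\<close>
  define b where "b = max 1 ((\<bar>R\<bar> + 1) / r)"
  have b: "b \<ge> 1" "\<bar>R\<bar> < b * r" using x0(1) by (auto simp: b_def field_simps max_def)
  let ?\<Phi> = "\<lambda>s x. complex_of_real (s ^ CARD('n)) * \<phi> (dilate x0 s x)"
  obtain c where c: "\<And>s. s \<in> {1..b} \<Longrightarrow> apply_dist T (?\<Phi> s) = c"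
    using has_vector_derivative_zero_constant[of "{1..b}" "\<lambda>s. apply_dist T (?\<Phi> s)", OF convex_closed_interval
        dilation_derivative[OF T \<phi>]] by blast
  have "apply_dist T (?\<Phi> 1) = apply_dist T (?\<Phi> b)" using c[of 1] c[of b] b(1) by simp
  moreover have "?\<Phi> 1 = \<phi>" by (simp add: dilate_def)
  moreover have "apply_dist T (?\<Phi> b) = 0"
  proof -
    have "supp (?\<Phi> b) \<subseteq> cball x0 (\<bar>R\<bar> / b)"
    proof (rule supp_minimal)
      fix x assume x: "x \<notin> cball x0 (\<bar>R\<bar> / b)"
      have "x0 - dilate x0 b x = b *\<^sub>R (x0 - x)" by (simp add: dilate_def scaleR_diff_right)
      then have "dist x0 (dilate x0 b x) = b * dist x0 x" using b(1) by (simp add: dist_norm)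
      also have "\<dots> > R" using x b(1) by (simp add: field_simps)
      finally show "?\<Phi> b x = 0" using R[of "dilate x0 b x"] not_in_supp[of "dilate x0 b x" \<phi>] by fastforce
    qed simp
    also have "cball x0 (\<bar>R\<bar> / b) \<subseteq> ball x0 r"
    proof -
      have "\<bar>R\<bar> / b < r" using b by (simp add: field_simps)
      then show ?thesis by (auto simp: subset_iff)
    qed
    also have "ball x0 r \<subseteq> W" by (rule x0)
    finally have "supp (?\<Phi> b) \<subseteq> W" .
    moreover have "?\<Phi> b \<in> test_functions"
      using b unfolding dilate_def by (intro test_cmult test_affine[OF \<phi>]) auto
    ultimately show ?thesis using z by (simp add: eq_on_open_def zero_distribution.rep_eq)
  qed
  ultimately show "apply_dist T \<phi> = apply_dist 0 \<phi>" by (simp add: zero_distribution.rep_eq)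
qed

lemma eigen_dist_zero:
  fixes T :: "'n::finite distribution"
  assumes T: "\<And>j. partial_dist j T = scale_dist (c $ j) T" and W: "open W" "W \<noteq> {}" and z: "eq_on_open W T 0"
  shows "T = 0"
proof -
  \<comment> \<open>The exponential that cancels the eigenvalues: all derivatives of \<open>?S\<close> vanish.\<close>
  let ?S = "exp_mult_dist (- c) T"
  have "?S = 0"
  proof (rule constant_dist_zero[OF _ W])
    show "partial_dist j ?S = 0" for j
    proof (rule dist_eqI)
      fix \<phi> :: "real^'n \<Rightarrow> complex" assume \<phi>: "\<phi> \<in> test_functions"
      let ?e = "\<lambda>x. exp_fun (- c) x * \<phi> x"
      have t: "?e \<in> test_functions" using \<phi> by (intro test_mult smooth_exp_fun)
      have p: "partial j ?e = (\<lambda>x. exp_fun (- c) x * partial j \<phi> x - c $ j * ?e x)"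
        unfolding partial_exp_mult[OF \<phi>] by (rule ext) (simp add: algebra_simps)
      have t': "(\<lambda>x. exp_fun (- c) x * partial j \<phi> x) \<in> test_functions"
        using \<phi> by (intro test_mult smooth_exp_fun partial_test)
      have "- apply_dist T (partial j ?e) = c $ j * apply_dist T ?e"
        using arg_cong[OF T[of j], of "\<lambda>T. apply_dist T ?e"] t by (simp add: partial_dist.rep_eq scale_dist.rep_eq)
      then have "apply_dist T (\<lambda>x. exp_fun (- c) x * partial j \<phi> x) = 0"
        unfolding p using dist_diff[OF t' test_cmult[OF t, of "c $ j"], of T] dist_cmult[OF t, of T "c $ j"] by simp
      then show "apply_dist (partial_dist j ?S) \<phi> = apply_dist 0 \<phi>"
        using \<phi> partial_test[OF \<phi>, of j] by (simp add: partial_dist.rep_eq exp_mult_dist.rep_eq zero_distribution.rep_eq)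
    qed
    show "eq_on_open W ?S 0"
      unfolding eq_on_open_def
    proof (intro ballI impI)
      fix \<phi> :: "real^'n \<Rightarrow> complex" assume \<phi>: "\<phi> \<in> test_functions" "supp \<phi> \<subseteq> W"
      have "supp (\<lambda>x. exp_fun (- c) x * \<phi> x) \<subseteq> supp \<phi>"
        by (rule supp_minimal) (auto simp: supp_def[of \<phi>] not_in_supp[unfolded supp_def])
      then show "apply_dist ?S \<phi> = apply_dist 0 \<phi>"
        using z \<phi> test_mult[OF smooth_exp_fun \<phi>(1), of "- c"]
        by (auto simp: eq_on_open_def exp_mult_dist.rep_eq zero_distribution.rep_eq)
    qed
  qed
  show ?thesis
  proof (rule dist_eqI)
    fix \<phi> :: "real^'n \<Rightarrow> complex" assume \<phi>: "\<phi> \<in> test_functions"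
    have "(\<lambda>x. exp_fun (- c) x * (exp_fun c x * \<phi> x)) = \<phi>"
      by (auto simp: exp_fun_def sum_negf simp flip: mult.assoc exp_add)
    moreover have t: "(\<lambda>x. exp_fun c x * \<phi> x) \<in> test_functions" using \<phi> by (intro test_mult smooth_exp_fun)
    ultimately have "apply_dist T \<phi> = apply_dist ?S (\<lambda>x. exp_fun c x * \<phi> x)"
      by (simp add: exp_mult_dist.rep_eq)
    then show "apply_dist T \<phi> = apply_dist 0 \<phi>" using \<open>?S = 0\<close> by (simp add: zero_distribution.rep_eq)
  qed
qed

section \<open>The polynomial ring\<close>

abbreviation const_poly :: "complex \<Rightarrow> 'n diffop" where
  "const_poly c \<equiv> Poly_Mapping.single 0 c"

abbreviation var_poly :: "'n \<Rightarrow> 'n diffop" where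
  "var_poly j \<equiv> Poly_Mapping.single (Poly_Mapping.single j (Suc 0)) 1"

lemma poly_mapping_sum_induct [case_names single add]:
  fixes p :: "'a \<Rightarrow>\<^sub>0 'b::comm_monoid_add"
  assumes "\<And>k c. P (Poly_Mapping.single k c)" and "\<And>p q. P p \<Longrightarrow> P q \<Longrightarrow> P (p + q)"
  shows "P p"
proof (induction p rule: Poly_Mapping.update_induct)
  case const
  show ?case using assms(1)[of undefined 0] by simp
next
  case (update f a b)
  have "Poly_Mapping.update a b f = Poly_Mapping.single a b + f"
    using update(1) by (auto intro!: poly_mapping_eqI simp: lookup_update lookup_add lookup_single in_keys_iff)
  then show ?case using assms update by simp
qed

definition total_degree :: "('n::finite \<Rightarrow>\<^sub>0 nat) \<Rightarrow> nat" where
  "total_degree \<alpha> = (\<Sum>j\<in>UNIV. Poly_Mapping.lookup \<alpha> j)"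

lemma total_degree_add: "total_degree (\<alpha> + \<beta>) = total_degree \<alpha> + total_degree \<beta>"
  by (simp add: total_degree_def lookup_add sum.distrib)

lemma total_degree_single [simp]: "total_degree (Poly_Mapping.single j n) = n"
  by (simp add: total_degree_def lookup_single when_def)

lemma total_degree_0_iff: "total_degree \<alpha> = 0 \<longleftrightarrow> \<alpha> = 0"
  by (auto simp: total_degree_def poly_mapping_eq_iff fun_eq_iff)

lemma remove_var: "Poly_Mapping.lookup \<alpha> j > 0 \<Longrightarrow> (\<alpha> - Poly_Mapping.single j (Suc 0)) + Poly_Mapping.single j (Suc 0) = \<alpha>"
  by (rule poly_mapping_eqI) (auto simp: lookup_add lookup_minus lookup_single when_def)

text \<open>Building polynomials from constants by multiplication with a single variable and addition suits
  identities in which the action of one \<open>D\<^sub>j\<close> at a time is understood.\<close>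
lemma diffop_induct [case_names const var add]:
  fixes p :: "'n::finite diffop"
  assumes "\<And>c. P (const_poly c)" "\<And>j p. P p \<Longrightarrow> P (var_poly j * p)" "\<And>p q. P p \<Longrightarrow> P q \<Longrightarrow> P (p + q)"
  shows "P p"
proof (induction p rule: poly_mapping_sum_induct)
  case (single \<alpha> c)
  show ?case
  proof (induction "total_degree \<alpha>" arbitrary: \<alpha>)
    case 0
    then have "\<alpha> = 0" using total_degree_0_iff by metis
    then show ?case using assms(1) by simp
  next
    case (Suc n)
    then have "total_degree \<alpha> \<noteq> 0" by simp
    then obtain j where "Poly_Mapping.lookup \<alpha> j > 0"
      unfolding total_degree_def by (metis gr0I sum.neutral)
    then have \<alpha>: "Poly_Mapping.single j (Suc 0) + (\<alpha> - Poly_Mapping.single j (Suc 0)) = \<alpha>"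
      using remove_var by (metis add.commute)
    have "total_degree \<alpha> = Suc 0 + total_degree (\<alpha> - Poly_Mapping.single j (Suc 0))"
      using total_degree_add[of "Poly_Mapping.single j (Suc 0)" "\<alpha> - Poly_Mapping.single j (Suc 0)"]
      unfolding \<alpha> total_degree_single .
    then have "P (Poly_Mapping.single (\<alpha> - Poly_Mapping.single j (Suc 0)) c)" using Suc by simp
    from assms(2)[OF this, of j] show ?case by (simp only: mult_single \<alpha> mult_1_left)
  qed
qed (use assms in auto)

subsection \<open>Formal partial derivatives\<close>

text \<open>The coefficient of \<open>X\<^sup>\<beta>\<close> in the derivative comes from \<open>X\<^sup>\<beta>\<^sup>+\<^sup>e\<close>, with \<open>e\<close> the \<open>j\<close>-th unit multi-index.\<close>
lift_definition pderiv_poly :: "'n \<Rightarrow> 'n::finite diffop \<Rightarrow> 'n diffop" is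
  "\<lambda>j p \<beta>. of_nat (Poly_Mapping.lookup \<beta> j + 1) * p (\<beta> + Poly_Mapping.single j (Suc 0))"
proof -
  fix j :: 'n and p :: "('n \<Rightarrow>\<^sub>0 nat) \<Rightarrow> complex"
  assume "finite {\<alpha>. p \<alpha> \<noteq> 0}"
  then have "finite ((\<lambda>\<beta>. \<beta> + Poly_Mapping.single j (Suc 0)) -` {\<alpha>. p \<alpha> \<noteq> 0})"
    by (rule finite_vimageI) (auto simp: inj_def)
  then show "finite {\<beta>. of_nat (Poly_Mapping.lookup \<beta> j + 1) * p (\<beta> + Poly_Mapping.single j (Suc 0)) \<noteq> 0}"
    by (rule finite_subset[rotated]) auto
qed

lemma pderiv_poly_add: "pderiv_poly j (p + q) = pderiv_poly j p + pderiv_poly j q"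
  by (rule poly_mapping_eqI) (simp add: pderiv_poly.rep_eq lookup_add algebra_simps)

lemma pderiv_poly_const: "pderiv_poly (j::'n::finite) (const_poly c) = 0"
proof (rule poly_mapping_eqI)
  fix \<beta> :: "'n \<Rightarrow>\<^sub>0 nat"
  have "\<beta> + Poly_Mapping.single j (Suc 0) \<noteq> 0"
    using total_degree_add[of \<beta> "Poly_Mapping.single j (Suc 0)"] total_degree_0_iff[of "\<beta> + Poly_Mapping.single j (Suc 0)"] by simp
  then show "Poly_Mapping.lookup (pderiv_poly j (const_poly c)) \<beta> = Poly_Mapping.lookup 0 \<beta>"
    by (simp add: pderiv_poly.rep_eq lookup_single when_def)
qed

lemma lookup_var_mult:
  "Poly_Mapping.lookup (var_poly k * p) \<beta> =
    (if Poly_Mapping.lookup \<beta> k = 0 then 0 else Poly_Mapping.lookup p (\<beta> - Poly_Mapping.single k (Suc 0)))"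
proof (induction p rule: poly_mapping_sum_induct)
  case (single \<alpha> c)
  have "Poly_Mapping.single k (Suc 0) + \<alpha> = \<beta> \<longleftrightarrow> Poly_Mapping.lookup \<beta> k \<noteq> 0 \<and> \<alpha> = \<beta> - Poly_Mapping.single k (Suc 0)"
    using remove_var[of \<beta> k] by (auto simp: lookup_add add.commute)
  then show ?case by (auto simp: mult_single lookup_single when_def)
qed (auto simp: distrib_left lookup_add)

lemma pderiv_poly_var_mult:
  fixes p :: "'n::finite diffop"
  shows "pderiv_poly j (var_poly k * p) = (if j = k then p else 0) + var_poly k * pderiv_poly j p"
proof (rule poly_mapping_eqI)
  fix \<beta> :: "'n \<Rightarrow>\<^sub>0 nat"
  let ?l = "Poly_Mapping.lookup"
  show "?l (pderiv_poly j (var_poly k * p)) \<beta> = ?l ((if j = k then p else 0) + var_poly k * pderiv_poly j p) \<beta>"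
  proof (cases "j = k")
    case True
    then show ?thesis
    proof (cases "?l \<beta> k = 0")
      case False
      then have "Suc (?l (\<beta> - Poly_Mapping.single k (Suc 0)) k) = ?l \<beta> k"
        by (simp add: lookup_minus)
      then have "complex_of_nat (?l \<beta> k) = of_nat (?l (\<beta> - Poly_Mapping.single k (Suc 0)) k) + 1"
        by (metis of_nat_Suc add.commute)
      then show ?thesis using True False remove_var[of \<beta> k]
        by (simp add: pderiv_poly.rep_eq lookup_add lookup_var_mult distrib_right)
    qed (simp add: pderiv_poly.rep_eq lookup_add lookup_var_mult)
  next
    case False
    then show ?thesis
    proof (cases "?l \<beta> k = 0")
      case False
      have "\<beta> + Poly_Mapping.single j (Suc 0) - Poly_Mapping.single k (Suc 0) = \<beta> - Poly_Mapping.single k (Suc 0) + Poly_Mapping.single j (Suc 0)"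
        using False \<open>j \<noteq> k\<close> by (intro poly_mapping_eqI) (auto simp: lookup_add lookup_minus lookup_single when_def)
      then show ?thesis using False \<open>j \<noteq> k\<close>
        by (simp add: pderiv_poly.rep_eq lookup_add lookup_var_mult lookup_single lookup_minus when_def)
    qed (simp add: pderiv_poly.rep_eq lookup_add lookup_var_mult lookup_single when_def)
  qed
qed

text \<open>A formal derivative lowers the degree, and over \<open>\<complex>\<close> a polynomial with all derivatives zero is
  constant. So repeated differentiation of a nonzero element ends in a nonzero constant.\<close>
lemma derivative_closed_contains_constant:
  fixes p :: "'n::finite diffop"
  assumes closed: "\<And>p j. p \<in> I \<Longrightarrow> pderiv_poly j p \<in> I" and "p \<in> I" "p \<noteq> 0"
  shows "\<exists>c. c \<noteq> 0 \<and> const_poly c \<in> I"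
proof -
  have "\<exists>c. c \<noteq> 0 \<and> const_poly c \<in> I"
    if "\<And>\<alpha>. \<alpha> \<in> Poly_Mapping.keys p \<Longrightarrow> total_degree \<alpha> \<le> N" "p \<in> I" "p \<noteq> 0" for N p
    using that
  proof (induction N arbitrary: p)
    case 0
    have "p = const_poly (Poly_Mapping.lookup p 0)"
      using 0(1) total_degree_0_iff
      by (intro poly_mapping_eqI) (auto simp: lookup_single when_def in_keys_iff)
    moreover have "Poly_Mapping.lookup p 0 \<noteq> 0" using calculation 0(3) by auto
    ultimately show ?case using 0(2) by metis
  next
    case (Suc N)
    show ?case
    proof (cases "\<forall>j. pderiv_poly j p = 0")
      case True
      have zero: "Poly_Mapping.lookup p \<alpha> = 0" if "\<alpha> \<noteq> 0" for \<alpha>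
      proof -
        obtain j where j: "Poly_Mapping.lookup \<alpha> j > 0"
          using \<open>\<alpha> \<noteq> 0\<close> by (metis gr0I lookup_zero poly_mapping_eqI)
        have "Poly_Mapping.lookup (pderiv_poly j p) (\<alpha> - Poly_Mapping.single j (Suc 0)) = 0" using True by simp
        then show ?thesis using remove_var[OF j] by (simp add: pderiv_poly.rep_eq flip: of_nat_Suc)
      qed
      have "p = const_poly (Poly_Mapping.lookup p 0)"
        using zero by (intro poly_mapping_eqI) (auto simp: lookup_single when_def)
      moreover have "Poly_Mapping.lookup p 0 \<noteq> 0" using calculation Suc(4) by auto
      ultimately show ?thesis using Suc(3) by metis
    next
      case False
      then obtain j where j: "pderiv_poly j p \<noteq> 0" by blast
      show ?thesis
      proof (rule Suc.IH[OF _ closed[OF Suc.prems(2)] j])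
        fix \<beta> assume "\<beta> \<in> Poly_Mapping.keys (pderiv_poly j p)"
        then have "\<beta> + Poly_Mapping.single j (Suc 0) \<in> Poly_Mapping.keys p"
          by (auto simp: in_keys_iff pderiv_poly.rep_eq)
        from Suc.prems(1)[OF this] show "total_degree \<beta> \<le> N" by (simp add: total_degree_add)
      qed
    qed
  qed
  from this[of p "Max (total_degree ` Poly_Mapping.keys p)"] show ?thesis using assms by simp
qed

subsection \<open>Absence of zero divisors\<close>

text \<open>Numbering the variables embeds the ring into polynomials in the linearly ordered variables
  \<open>X\<^sub>0, X\<^sub>1, \<dots>\<close>, for which multi-indices carry a compatible linear order and leading terms multiply.\<close>
lemma diffop_no_zero_divisors:
  fixes p q :: "'n::finite diffop"
  assumes "p * q = 0" shows "p = 0 \<or> q = 0"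
proof -
  obtain e :: "'n \<Rightarrow> nat" where e: "inj e"
    using finite_imp_inj_to_nat_seg[of "UNIV :: 'n set"] by auto
  define w where "w \<alpha> = (\<Sum>j\<in>UNIV. Poly_Mapping.single (e j) (Poly_Mapping.lookup \<alpha> j))" for \<alpha> :: "'n \<Rightarrow>\<^sub>0 nat"
  have w_add: "w (\<alpha> + \<beta>) = w \<alpha> + w \<beta>" for \<alpha> \<beta>
    by (simp add: w_def lookup_add single_add sum.distrib)
  have w_lookup: "Poly_Mapping.lookup (w \<alpha>) (e j) = Poly_Mapping.lookup \<alpha> j" for \<alpha> j
  proof -
    have "Poly_Mapping.lookup (w \<alpha>) (e j) = (\<Sum>i\<in>UNIV. if i = j then Poly_Mapping.lookup \<alpha> i else 0)"
      unfolding w_def lookup_sum by (rule sum.cong) (auto simp: lookup_single when_def inj_eq[OF e])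
    then show ?thesis by simp
  qed
  have w_inj: "w \<alpha> = w \<beta> \<longleftrightarrow> \<alpha> = \<beta>" for \<alpha> \<beta>
    by (metis poly_mapping_eqI w_lookup)
  define \<Phi> :: "'n diffop \<Rightarrow> (nat \<Rightarrow>\<^sub>0 nat) \<Rightarrow>\<^sub>0 complex" where
    "\<Phi> p = (\<Sum>\<alpha>\<in>Poly_Mapping.keys p. Poly_Mapping.single (w \<alpha>) (Poly_Mapping.lookup p \<alpha>))" for p
  have \<Phi>_add: "\<Phi> (p + q) = \<Phi> p + \<Phi> q" for p q
    unfolding \<Phi>_def by (rule setsum_keys_plus_distrib) (auto simp: single_add)
  have \<Phi>_single: "\<Phi> (Poly_Mapping.single \<alpha> c) = Poly_Mapping.single (w \<alpha>) c" for \<alpha> c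
    by (simp add: \<Phi>_def)
  have \<Phi>_mult: "\<Phi> (p * q) = \<Phi> p * \<Phi> q" for p q
  proof (induction p rule: poly_mapping_sum_induct)
    case (single \<alpha> c)
    show ?case
      by (induction q rule: poly_mapping_sum_induct)
        (simp_all add: mult_single \<Phi>_single w_add distrib_left \<Phi>_add)
  qed (simp add: distrib_right \<Phi>_add)
  have \<Phi>_0: "p = 0" if "\<Phi> p = 0" for p
  proof (rule poly_mapping_eqI)
    fix \<alpha>
    have "Poly_Mapping.lookup (\<Phi> p) (w \<alpha>) = (\<Sum>\<beta>\<in>Poly_Mapping.keys p. if \<beta> = \<alpha> then Poly_Mapping.lookup p \<beta> else 0)"
      unfolding \<Phi>_def lookup_sum by (rule sum.cong) (auto simp: lookup_single when_def w_inj)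
    also have "\<dots> = Poly_Mapping.lookup p \<alpha>" by (auto simp: in_keys_iff)
    finally show "Poly_Mapping.lookup p \<alpha> = Poly_Mapping.lookup 0 \<alpha>" using that by simp
  qed
  have "\<Phi> p * \<Phi> q = 0" using assms \<Phi>_mult[of p q] by (simp add: \<Phi>_def)
  then show ?thesis using \<Phi>_0 by (metis mult_eq_0_iff)
qed

lemma diffop_prod_nonzero:
  assumes "finite J" "\<And>j. j \<in> J \<Longrightarrow> f j \<noteq> (0::'n::finite diffop)"
  shows "(\<Prod>j\<in>J. f j) \<noteq> 0"
  using assms by (induction J rule: finite_induct) (use diffop_no_zero_divisors in auto)

section \<open>Submodules\<close>

text \<open>Submodules of a type-class module whose scalar multiplication is the parameter; used for ideals
  of \<open>A\<close> (with \<open>(*)\<close>) and for submodules of \<open>A\<^sup>k\<close> (with \<open>(*s)\<close>).\<close>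
definition lin_closed :: "('a \<Rightarrow> 'b \<Rightarrow> 'b) \<Rightarrow> 'b::ab_group_add set \<Rightarrow> bool" where
  "lin_closed smul M \<longleftrightarrow> 0 \<in> M \<and> (\<forall>x\<in>M. \<forall>y\<in>M. x + y \<in> M) \<and> (\<forall>a. \<forall>x\<in>M. smul a x \<in> M)"

lemma lin_closedD:
  assumes "lin_closed smul M"
  shows "0 \<in> M" "x \<in> M \<Longrightarrow> y \<in> M \<Longrightarrow> x + y \<in> M" "x \<in> M \<Longrightarrow> smul a x \<in> M"
  using assms by (auto simp: lin_closed_def)

lemma lin_closed_chain_Union:
  assumes "\<C> \<noteq> {}" "\<And>M. M \<in> \<C> \<Longrightarrow> lin_closed smul M" "\<And>M N. M \<in> \<C> \<Longrightarrow> N \<in> \<C> \<Longrightarrow> M \<subseteq> N \<or> N \<subseteq> M"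
  shows "lin_closed smul (\<Union>\<C>)"
  unfolding lin_closed_def
proof (intro conjI ballI allI)
  show "0 \<in> \<Union>\<C>" using assms(1,2) lin_closedD(1) by blast
  fix x assume x: "x \<in> \<Union>\<C>"
  from x obtain M where M: "x \<in> M" "M \<in> \<C>" by (rule UnionE)
  show "smul a x \<in> \<Union>\<C>" for a
    using lin_closedD(3)[OF assms(2)[OF M(2)] M(1)] M(2) by (rule UnionI[rotated])
  fix y assume y: "y \<in> \<Union>\<C>"
  from y obtain N where N: "y \<in> N" "N \<in> \<C>" by (rule UnionE)
  from assms(3)[OF M(2) N(2)] show "x + y \<in> \<Union>\<C>"
  proof
    assume "M \<subseteq> N"
    then have "x + y \<in> N" using M N lin_closedD(2)[OF assms(2)[OF N(2)]] by blast
    then show ?thesis using N(2) by (rule UnionI[rotated])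
  next
    assume "N \<subseteq> M"
    then have "x + y \<in> M" using M N lin_closedD(2)[OF assms(2)[OF M(2)]] by blast
    then show ?thesis using M(2) by (rule UnionI[rotated])
  qed
qed

text \<open>Zorn's lemma for submodules \<open>M \<supseteq> P\<close> with \<open>M \<inter> S \<subseteq> Q\<close>. It serves twice: \<open>S = {1}\<close>, \<open>Q = {}\<close> gives
  maximal ideals, and the saturation of \<open>P\<close> as \<open>S\<close>, with \<open>Q = P\<close>, gives the torsion complement.\<close>
lemma maximal_submodule_meeting:
  fixes P S :: "'b::ab_group_add set"
  assumes P: "lin_closed smul P" "P \<inter> S \<subseteq> Q"
  shows "\<exists>M. lin_closed smul M \<and> P \<subseteq> M \<and> M \<inter> S \<subseteq> Q \<and>
    (\<forall>N. lin_closed smul N \<longrightarrow> M \<subseteq> N \<longrightarrow> N \<inter> S \<subseteq> Q \<longrightarrow> N = M)"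
proof -
  define A where "A = {M. lin_closed smul M \<and> P \<subseteq> M \<and> M \<inter> S \<subseteq> Q}"
  have "\<exists>M\<in>A. \<forall>N\<in>A. M \<subseteq> N \<longrightarrow> N = M"
  proof (rule subset_Zorn_nonempty)
    show "A \<noteq> {}" using P by (auto simp: A_def)
    fix \<C> assume C: "\<C> \<noteq> {}" "subset.chain A \<C>"
    then have sub: "\<And>M. M \<in> \<C> \<Longrightarrow> lin_closed smul M \<and> P \<subseteq> M \<and> M \<inter> S \<subseteq> Q" by (auto simp: subset.chain_def A_def)
    have "lin_closed smul (\<Union>\<C>)"
    proof (rule lin_closed_chain_Union[OF C(1)])
      show "lin_closed smul M" if "M \<in> \<C>" for M using sub[OF that] by blast
      show "M \<subseteq> N \<or> N \<subseteq> M" if "M \<in> \<C>" "N \<in> \<C>" for M N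
        using C(2) that by (simp add: subset_chain_def)
    qed
    moreover have "P \<subseteq> \<Union>\<C>" using C(1) sub by blast
    moreover have "\<Union>\<C> \<inter> S \<subseteq> Q" using sub by blast
    ultimately show "\<Union>\<C> \<in> A" by (simp add: A_def)
  qed
  then obtain M where "M \<in> A" "\<forall>N\<in>A. M \<subseteq> N \<longrightarrow> N = M" by blast
  then show ?thesis unfolding A_def by (intro exI[of _ M]) auto
qed

lemma lin_closed_adjoin:
  fixes smul :: "'a::comm_ring_1 \<Rightarrow> 'b::ab_group_add \<Rightarrow> 'b"
  assumes "Modules.module smul" and M: "lin_closed smul M"
  shows "lin_closed smul {m + smul r x | m r. m \<in> M}"
  unfolding lin_closed_def
proof (intro conjI ballI allI)
  interpret Modules.module smul by (rule assms(1))
  have "0 = 0 + smul 0 x" by simp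
  then show "0 \<in> {m + smul r x | m r. m \<in> M}" using lin_closedD(1)[OF M] by blast
  fix y assume "y \<in> {m + smul r x | m r. m \<in> M}"
  then obtain m r where y: "y = m + smul r x" "m \<in> M" by blast
  have "smul a y = smul a m + smul (a * r) x" for a using y(1) by (simp add: scale_right_distrib)
  then show "smul a y \<in> {m + smul r x | m r. m \<in> M}" for a
    using lin_closedD(3)[OF M y(2), of a] by blast
  fix z assume "z \<in> {m + smul r x | m r. m \<in> M}"
  then obtain n s where z: "z = n + smul s x" "n \<in> M" by blast
  have "y + z = (m + n) + smul (r + s) x" using y(1) z(1) by (simp add: scale_left_distrib add_ac)
  then show "y + z \<in> {m + smul r x | m r. m \<in> M}"
    using lin_closedD(2)[OF M y(2) z(2)] by blast
qed

lemma module_times: "Modules.module ((*) :: 'a::comm_ring_1 \<Rightarrow> 'a \<Rightarrow> 'a)"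
  by unfold_locales (simp_all add: distrib_left distrib_right mult.assoc)

lemma maximal_ideal_exists:
  fixes I :: "'a::comm_ring_1 set"
  assumes I: "lin_closed (*) I" "1 \<notin> I"
  shows "\<exists>M. lin_closed (*) M \<and> I \<subseteq> M \<and> 1 \<notin> M \<and> (\<forall>x. x \<notin> M \<longrightarrow> (\<exists>r. r * x - 1 \<in> M))"
proof -
  have "I \<inter> {1} \<subseteq> {}" using I by blast
  from maximal_submodule_meeting[OF I(1) this]
  obtain M where M: "lin_closed (*) M" "I \<subseteq> M" "1 \<notin> M"
    and max: "\<And>N. lin_closed (*) N \<Longrightarrow> M \<subseteq> N \<Longrightarrow> 1 \<notin> N \<Longrightarrow> N = M" by auto
  have "\<exists>r. r * x - 1 \<in> M" if x: "x \<notin> M" for x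
  proof -
    let ?N = "{m + r * x | m r. m \<in> M}"
    have "m = m + 0 * x" "x = 0 + 1 * x" for m by simp_all
    then have "M \<subseteq> ?N" "x \<in> ?N" using lin_closedD(1)[OF M(1)] by blast+
    then have "1 \<in> ?N" using max[OF lin_closed_adjoin[OF module_times M(1)]] x by blast
    then obtain m r where mr: "1 = m + r * x" "m \<in> M" by blast
    have "r * x - 1 = (- 1) * m" using mr(1) by (simp add: algebra_simps)
    then show ?thesis using lin_closedD(3)[OF M(1) mr(2), of "- 1"] by metis
  qed
  with M show ?thesis by blast
qed

section \<open>Maximal ideals of the polynomial ring\<close>

lemma const_poly_add: "const_poly (a + b) = const_poly a + const_poly b"
  by (simp add: single_add)

lemma const_poly_mult: "const_poly (a * b) = const_poly a * const_poly b"
  by (simp add: mult_single)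

text \<open>A nonzero \<open>q\<close> splits into linear factors over \<open>\<complex>\<close>; modulo a maximal ideal containing \<open>q(x)\<close> one of
  the factors \<open>x - c\<close> must vanish.\<close>
lemma univariate_splits:
  fixes M :: "'n::finite diffop set" and q :: "complex poly"
  assumes M: "lin_closed (*) M" "1 \<notin> M" and max: "\<And>x. x \<notin> M \<Longrightarrow> \<exists>r. r * x - 1 \<in> M"
    and q: "q \<noteq> 0" "poly (map_poly const_poly q) x \<in> M"
  shows "\<exists>c. x - const_poly c \<in> M"
  using q
proof (induction "Polynomial.degree q" arbitrary: q)
  case 0
  then obtain a where a: "q = [:a:]" "a \<noteq> 0" by (metis degree_eq_zeroE pCons_0_0)
  then have "const_poly a \<in> M" using 0 by (simp add: map_poly_pCons)
  from lin_closedD(3)[OF M(1) this, of "const_poly (1/a)"] have "1 \<in> M"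
    using a(2) by (simp add: mult_single)
  then show ?case using M(2) by blast
next
  case (Suc d)
  have "\<not> constant (poly q)" using Suc(2) by (metis constant_degree nat.distinct(1))
  then obtain z where "poly q z = 0" using fundamental_theorem_of_algebra by blast
  then obtain q' where q': "q = [:- z, 1:] * q'" by (metis dvdE poly_eq_0_iff_dvd)
  have hom: "map_poly const_poly ([:- z, 1:] * q') = [:const_poly (- z), 1:] * map_poly const_poly q'"
  proof -
    have "map_poly const_poly ([:- z, 1:] * q') = map_poly const_poly (Polynomial.smult (- z) q' + pCons 0 q')" by simp
    also have "\<dots> = Polynomial.smult (const_poly (- z)) (map_poly const_poly q') + pCons 0 (map_poly const_poly q')"
      by (rule poly_eqI) (auto simp: coeff_map_poly coeff_pCons const_poly_add const_poly_mult mult_single single_add[symmetric] split: nat.splits)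
    finally show ?thesis by simp
  qed
  have eq: "poly (map_poly const_poly q) x = (x - const_poly z) * poly (map_poly const_poly q') x"
    unfolding q' hom by (simp add: single_uminus algebra_simps)
  have q0: "q' \<noteq> 0" using Suc.prems(1) q' by auto
  have deg: "d = Polynomial.degree q'" using Suc(2) q0 unfolding q' by (subst (asm) degree_mult_eq) auto
  show ?case
  proof (cases "x - const_poly z \<in> M")
    case False
    then obtain r where r: "r * (x - const_poly z) - 1 \<in> M" using max by blast
    let ?y = "poly (map_poly const_poly q') x"
    have "(x - const_poly z) * ?y \<in> M" using Suc.prems(2) unfolding eq .
    then have "r * ((x - const_poly z) * ?y) + (- ?y) * (r * (x - const_poly z) - 1) \<in> M"
      by (rule lin_closedD(2)[OF M(1) lin_closedD(3)[OF M(1)] lin_closedD(3)[OF M(1) r]])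
    moreover have "r * ((x - const_poly z) * ?y) + (- ?y) * (r * (x - const_poly z) - 1) = ?y"
      by (simp add: algebra_simps)
    ultimately have "?y \<in> M" by simp
    then show ?thesis by (rule Suc.hyps(1)[OF deg q0])
  next
    case True
    then show ?thesis ..
  qed
qed

interpretation diffop_vs: vector_space "\<lambda>c (p :: 'n::finite diffop). const_poly c * p"
  by unfold_locales (simp_all add: distrib_left distrib_right const_poly_add const_poly_mult mult.assoc)

lemma span_monomials:
  fixes p :: "'n::finite diffop"
  assumes "Poly_Mapping.keys p \<subseteq> B"
  shows "p \<in> diffop_vs.span ((\<lambda>\<alpha>. Poly_Mapping.single \<alpha> 1) ` B)"
proof -
  have "p = (\<Sum>\<alpha>\<in>Poly_Mapping.keys p. const_poly (Poly_Mapping.lookup p \<alpha>) * Poly_Mapping.single \<alpha> 1)"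
  proof (rule poly_mapping_eqI)
    fix \<beta>
    have "Poly_Mapping.lookup (\<Sum>\<alpha>\<in>Poly_Mapping.keys p. const_poly (Poly_Mapping.lookup p \<alpha>) * Poly_Mapping.single \<alpha> 1) \<beta>
       = (\<Sum>\<alpha>\<in>Poly_Mapping.keys p. if \<alpha> = \<beta> then Poly_Mapping.lookup p \<alpha> else 0)"
      unfolding lookup_sum by (rule sum.cong) (auto simp: mult_single lookup_single when_def)
    then show "Poly_Mapping.lookup p \<beta> = Poly_Mapping.lookup (\<Sum>\<alpha>\<in>Poly_Mapping.keys p. const_poly (Poly_Mapping.lookup p \<alpha>) * Poly_Mapping.single \<alpha> 1) \<beta>"
      by (auto simp: in_keys_iff)
  qed
  moreover have "\<dots> \<in> diffop_vs.span ((\<lambda>\<alpha>. Poly_Mapping.single \<alpha> 1) ` B)"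
    using assms by (intro diffop_vs.span_sum diffop_vs.span_scale diffop_vs.span_base) auto
  ultimately show ?thesis by metis
qed

lemma finite_total_degree: "finite {\<alpha> :: 'n::finite \<Rightarrow>\<^sub>0 nat. total_degree \<alpha> \<le> d}"
proof -
  have "Poly_Mapping.lookup ` {\<alpha> :: 'n \<Rightarrow>\<^sub>0 nat. total_degree \<alpha> \<le> d} \<subseteq> {f. \<forall>j. f j \<in> {..d}}"
    by (auto simp: total_degree_def intro: order_trans[OF member_le_sum[of _ UNIV]])
  moreover have "finite {f :: 'n \<Rightarrow> nat. \<forall>j. f j \<in> {..d}}"
    using finite_PiE[of "UNIV :: 'n set" "\<lambda>_. {..d}"] by (simp add: PiE_def Pi_def extensional_def)
  ultimately show ?thesis
    by (meson finite_imageD finite_subset inj_onI lookup_inject)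
qed

text \<open>The Nullstellensatz for the uncountable field \<open>\<complex>\<close>. If no \<open>x - c\<close> were in \<open>M\<close>, each would have an
  inverse \<open>r c\<close> modulo \<open>M\<close>. Uncountably many \<open>r c\<close> lie in a space of countable dimension, so infinitely
  many have bounded degree and some of these satisfy a linear relation. Clearing denominators turns
  the relation into a nonzero univariate polynomial with value at \<open>x\<close> in \<open>M\<close>.\<close>
lemma maximal_ideal_contains_linear:
  fixes M :: "'n::finite diffop set"
  assumes M: "lin_closed (*) M" "1 \<notin> M" and max: "\<And>x. x \<notin> M \<Longrightarrow> \<exists>r. r * x - 1 \<in> M"
  shows "\<exists>c. x - const_poly c \<in> M"
proof (rule ccontr)
  assume "\<nexists>c. x - const_poly c \<in> M"
  then have "\<forall>c. \<exists>r. r * (x - const_poly c) - 1 \<in> M" using max by blast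
  from choice[OF this] obtain r where r: "\<And>c. r c * (x - const_poly c) - 1 \<in> M" by blast
  \<comment> \<open>Including \<open>0\<close> avoids the maximum of a possibly empty set.\<close>
  define deg where "deg c = Max (insert 0 (total_degree ` Poly_Mapping.keys (r c)))" for c
  have "uncountable (UNIV :: complex set)" by (rule uncountable_UNIV_complex)
  moreover have "(UNIV :: complex set) = (\<Union>d. {c. deg c = d})" by auto
  ultimately obtain d where d: "infinite {c. deg c = d}"
    by (metis countable_UN countable_finite uncountable_def countableI_type)
  define T where "T = (\<lambda>\<alpha>. Poly_Mapping.single \<alpha> (1::complex)) ` {\<alpha> :: 'n \<Rightarrow>\<^sub>0 nat. total_degree \<alpha> \<le> d}"
  have T: "finite T" unfolding T_def by (intro finite_imageI finite_total_degree)
  have span: "r c \<in> diffop_vs.span T" if "deg c = d" for c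
    unfolding T_def
  proof (rule span_monomials, rule subsetI)
    fix \<alpha> assume "\<alpha> \<in> Poly_Mapping.keys (r c)"
    then have "total_degree \<alpha> \<le> deg c" unfolding deg_def by (intro Max_ge) auto
    then show "\<alpha> \<in> {\<alpha>. total_degree \<alpha> \<le> d}" using that by simp
  qed
  obtain S where S: "S \<subseteq> {c. deg c = d}" "finite S" "card S = Suc (card T)"
    using infinite_arbitrarily_large[OF d] by blast
  obtain u where u: "\<exists>c\<in>S. u c \<noteq> 0" "(\<Sum>c\<in>S. const_poly (u c) * r c) = 0"
  proof (cases "inj_on r S")
    case True
    have "diffop_vs.dependent (r ` S)"
    proof (rule ccontr)
      assume "\<not> diffop_vs.dependent (r ` S)"
      then have "card (r ` S) \<le> card T"
        using diffop_vs.independent_span_bound[OF T] span S(1) by blast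
      then show False using card_image[OF True] S(3) by simp
    qed
    then obtain v where v: "\<exists>p\<in>r ` S. v p \<noteq> 0" "(\<Sum>p\<in>r ` S. const_poly (v p) * p) = 0"
      using diffop_vs.dependent_finite[of "r ` S"] S(2) by blast
    show ?thesis
      by (rule that[of "v \<circ> r"]) (use v True in \<open>auto simp: sum.reindex\<close>)
  next
    case False
    then obtain a b where ab: "a \<in> S" "b \<in> S" "a \<noteq> b" "r a = r b" by (auto simp: inj_on_def)
    define u where "u c = (if c = a then 1 else if c = b then -1 else 0 :: complex)" for c
    have "(\<Sum>c\<in>S. const_poly (u c) * r c) = (\<Sum>c\<in>{a, b}. const_poly (u c) * r c)"
      using ab S(2) by (intro sum.mono_neutral_right) (auto simp: u_def)
    also have "\<dots> = 0" using ab by (simp add: u_def single_uminus)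
    finally show ?thesis using ab(1) by (intro that[of u]) (auto simp: u_def)
  qed
  \<comment> \<open>The relation \<open>\<Sum>c. u c / (x - c) = 0\<close> modulo \<open>M\<close>, multiplied by all \<open>x - c\<close>.\<close>
  define q where "q = (\<Sum>c\<in>S. Polynomial.smult (u c) (\<Prod>e\<in>S - {c}. [:- e, 1:]))"
  have "q \<noteq> 0"
  proof
    assume "q = 0"
    obtain c where c: "c \<in> S" "u c \<noteq> 0" using u(1) by blast
    \<comment> \<open>At a point \<open>c\<close> of \<open>S\<close> only the summand that lacks the factor for \<open>c\<close> survives.\<close>
    have "poly q c = (\<Sum>e\<in>S. if e = c then u c * (\<Prod>e\<in>S - {c}. c - e) else 0)"
      unfolding q_def poly_sum
    proof (rule sum.cong)
      fix e assume e: "e \<in> S"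
      show "poly (Polynomial.smult (u e) (\<Prod>e\<in>S - {e}. [:- e, 1:])) c = (if e = c then u c * (\<Prod>e\<in>S - {c}. c - e) else 0)"
        using S(2) c(1) e by (auto simp: poly_prod)
    qed simp
    also have "\<dots> = u c * (\<Prod>e\<in>S - {c}. c - e)" using S(2) c(1) by simp
    also have "\<dots> \<noteq> 0" using c(2) S(2) by auto
    finally show False using \<open>q = 0\<close> by simp
  qed
  moreover have "poly (map_poly const_poly q) x \<in> M"
  proof -
    define hom where "hom q = poly (map_poly const_poly q) x" for q
    have hom_add: "hom (p + q) = hom p + hom q" for p q
    proof -
      have "(map_poly const_poly (p + q) :: 'n diffop poly) = map_poly const_poly p + map_poly const_poly q"
        by (rule poly_eqI) (simp add: coeff_map_poly const_poly_add)
      then show ?thesis unfolding hom_def by (simp only: poly_add)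
    qed
    have hom_smult: "hom (Polynomial.smult a p) = const_poly a * hom p" for a p
    proof -
      have "(map_poly const_poly (Polynomial.smult a p) :: 'n diffop poly) = Polynomial.smult (const_poly a) (map_poly const_poly p)"
        by (rule poly_eqI) (simp add: coeff_map_poly const_poly_mult)
      then show ?thesis unfolding hom_def by (simp only: Polynomial.poly_smult)
    qed
    have hom_linear: "hom ([:- c, 1:] * p) = (x - const_poly c) * hom p" for c p
    proof -
      have "[:- c, 1:] * p = Polynomial.smult (- c) p + pCons 0 p" by simp
      then have "hom ([:- c, 1:] * p) = const_poly (- c) * hom p + hom (pCons 0 p)"
        by (simp only: hom_add hom_smult)
      also have "hom (pCons 0 p) = x * hom p" by (simp add: hom_def map_poly_pCons)
      finally show ?thesis by (simp add: single_uminus algebra_simps)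
    qed
    have hom_sum: "hom (\<Sum>c\<in>S'. f c) = (\<Sum>c\<in>S'. hom (f c))" if "finite S'" for f and S' :: "complex set"
      using that by (induction S' rule: finite_induct) (simp_all add: hom_add, simp add: hom_def)
    have hom_prod: "hom (\<Prod>c\<in>S'. [:- c, 1:]) = (\<Prod>c\<in>S'. x - const_poly c)" if "finite S'" for S'
      using that
    proof (induction S' rule: finite_induct)
      case empty
      show ?case by (simp add: hom_def)
    qed (simp add: hom_linear del: mult_pCons_left)
    define D where "D = (\<Prod>c\<in>S. x - const_poly c)"
    have "hom q = (\<Sum>c\<in>S. const_poly (u c) * (\<Prod>e\<in>S - {c}. x - const_poly e))"
      unfolding q_def using S(2) by (simp add: hom_sum hom_smult hom_prod)
    also have "\<dots> = (\<Sum>c\<in>S. D * (const_poly (u c) * r c)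
         + (- const_poly (u c) * (\<Prod>e\<in>S - {c}. x - const_poly e)) * (r c * (x - const_poly c) - 1))"
    proof (rule sum.cong)
      have alg: "u * Q = (y * Q) * (u * r) + (- u * Q) * (r * y - 1)" for u Q r y :: "'n diffop"
        by (simp add: algebra_simps)
      fix c assume "c \<in> S"
      then have D: "D = (x - const_poly c) * (\<Prod>e\<in>S - {c}. x - const_poly e)"
        unfolding D_def using S(2) by (rule prod.remove[rotated])
      show "const_poly (u c) * (\<Prod>e\<in>S - {c}. x - const_poly e) = D * (const_poly (u c) * r c)
         + (- const_poly (u c) * (\<Prod>e\<in>S - {c}. x - const_poly e)) * (r c * (x - const_poly c) - 1)"
        unfolding D by (rule alg)
    qed simp
    also have "\<dots> = D * (\<Sum>c\<in>S. const_poly (u c) * r c)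
         + (\<Sum>c\<in>S. (- const_poly (u c) * (\<Prod>e\<in>S - {c}. x - const_poly e)) * (r c * (x - const_poly c) - 1))"
      by (simp only: sum.distrib sum_distrib_left)
    also have "\<dots> = (\<Sum>c\<in>S. (- const_poly (u c) * (\<Prod>e\<in>S - {c}. x - const_poly e)) * (r c * (x - const_poly c) - 1))"
      unfolding u(2) by simp
    also have "\<dots> \<in> M"
    proof -
      have "(\<Sum>c\<in>S'. f c * (r c * (x - const_poly c) - 1)) \<in> M" if "finite S'" for f S'
        using that
      proof (induction S' rule: finite_induct)
        case (insert c S')
        then show ?case
          using lin_closedD(2)[OF M(1) lin_closedD(3)[OF M(1) r] insert.IH] by simp
      qed (use lin_closedD(1)[OF M(1)] in simp)
      from this[OF S(2)] show ?thesis .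
    qed
    finally show ?thesis by (simp add: hom_def)
  qed
  ultimately show False
    using univariate_splits[OF M max] \<open>\<nexists>c. x - const_poly c \<in> M\<close> by blast
qed

section \<open>An inner product on compactly supported functions\<close>

definition cont_supp :: "real \<Rightarrow> (real^'n::finite \<Rightarrow> complex) \<Rightarrow> bool" where
  "cont_supp R f \<longleftrightarrow> continuous_on UNIV f \<and> (\<forall>x. norm x > R \<longrightarrow> f x = 0)"

lemma cont_supp_add: "cont_supp R f \<Longrightarrow> cont_supp R g \<Longrightarrow> cont_supp R (\<lambda>x. f x + g x)"
  by (auto simp: cont_supp_def intro!: continuous_intros)

lemma cont_supp_mult: "cont_supp R f \<Longrightarrow> continuous_on UNIV g \<Longrightarrow> cont_supp R (\<lambda>x. g x * f x)"
  by (auto simp: cont_supp_def intro!: continuous_intros)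

lemma cont_supp_mult_cnj: "cont_supp R f \<Longrightarrow> cont_supp R g \<Longrightarrow> cont_supp R (\<lambda>x. f x * cnj (g x))"
  by (auto simp: cont_supp_def intro!: continuous_intros)

lemma cont_supp_integrable:
  assumes "cont_supp R f" shows "integrable lborel f"
proof -
  have "integrable lborel (\<lambda>x. indicator (cball 0 R) x *\<^sub>R f x)"
    using assms by (intro borel_integrable_compact) (auto simp: cont_supp_def intro: continuous_on_subset)
  also have "(\<lambda>x. indicator (cball 0 R) x *\<^sub>R f x) = f"
    using assms by (auto simp: cont_supp_def indicator_def fun_eq_iff not_le)
  finally show ?thesis .
qed

definition ip :: "(real^'n::finite \<Rightarrow> complex) \<Rightarrow> (real^'n \<Rightarrow> complex) \<Rightarrow> complex" where
  "ip f g = (\<integral>x. f x * cnj (g x) \<partial>lborel)"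

lemma ip_add_left: "cont_supp R f \<Longrightarrow> cont_supp R g \<Longrightarrow> cont_supp R h \<Longrightarrow>
    ip (\<lambda>x. f x + g x) h = ip f h + ip g h"
  unfolding ip_def distrib_right
  by (intro Bochner_Integration.integral_add cont_supp_integrable[OF cont_supp_mult_cnj])

lemma ip_add_right: "cont_supp R f \<Longrightarrow> cont_supp R g \<Longrightarrow> cont_supp R h \<Longrightarrow>
    ip h (\<lambda>x. f x + g x) = ip h f + ip h g"
  unfolding ip_def distrib_left complex_cnj_add
  by (intro Bochner_Integration.integral_add cont_supp_integrable[OF cont_supp_mult_cnj])

lemma ip_scale_left: "ip (\<lambda>x. c * f x) g = c * ip f g"
  by (simp add: ip_def mult.assoc)

lemma ip_scale_right: "ip f (\<lambda>x. c * g x) = cnj c * ip f g"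
proof -
  have "(\<lambda>x. f x * cnj (c * g x)) = (\<lambda>x. cnj c * (f x * cnj (g x)))" by (simp add: mult_ac)
  then show ?thesis by (simp add: ip_def)
qed

lemma ip_zero_left: "ip (\<lambda>x. 0) g = 0"
  by (simp add: ip_def)

lemma ip_zero_right: "ip g (\<lambda>x. 0) = 0"
  by (simp add: ip_def)

text \<open>Continuity upgrades vanishing almost everywhere to vanishing everywhere.\<close>
lemma ip_definite:
  assumes f: "cont_supp R f" and "ip f f = 0"
  shows "f x = 0"
proof -
  have eq: "(\<lambda>x. f x * cnj (f x)) = (\<lambda>x. complex_of_real ((cmod (f x))\<^sup>2))"
    by (simp only: complex_norm_square)
  have int: "integrable lborel (\<lambda>x. (cmod (f x))\<^sup>2)"
    using cont_supp_integrable[OF cont_supp_mult_cnj[OF f f]] unfolding eq complex_of_real_integrable_eq .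
  have "complex_of_real (\<integral>x. (cmod (f x))\<^sup>2 \<partial>lborel) = 0"
    using assms(2) unfolding ip_def eq integral_complex_of_real .
  then have "AE x in lborel. (cmod (f x))\<^sup>2 = 0"
    using integral_nonneg_eq_0_iff_AE[OF int] by simp
  then have "AE x in lebesgue. x \<in> {x. f x = 0}"
    by (intro AE_completion) simp
  moreover have "closed {x. f x = 0}"
    using f by (intro closed_Collect_eq) (auto simp: cont_supp_def)
  ultimately show ?thesis using mem_closed_if_AE_lebesgue by blast
qed

text \<open>The difference quotients of \<open>w\<close> have integral zero by translation invariance, and they converge to
  \<open>w'\<close> boundedly inside a fixed ball.\<close>
lemma integral_derivative_zero:
  fixes w :: "real^'n::finite \<Rightarrow> complex"
  assumes w: "cont_supp R w" "cont_supp R w'"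
    and deriv: "\<And>x t. ((\<lambda>t. w (x + t *\<^sub>R axis k 1)) has_vector_derivative w' (x + t *\<^sub>R axis k 1)) (at t)"
  shows "(\<integral>x. w' x \<partial>lborel) = 0"
proof -
  let ?e = "axis k 1 :: real^'n"
  \<comment> \<open>The difference quotients for the step widths \<open>1 / (n + 1)\<close>.\<close>
  define g where "g n x = of_nat (Suc n) * (w (x + (1 / real (Suc n)) *\<^sub>R ?e) - w x)" for n x
  have wm: "w \<in> borel_measurable borel" "w' \<in> borel_measurable borel"
    using w by (auto simp: cont_supp_def intro: borel_measurable_continuous_onI)
  have shift: "(\<integral>x. w (x + a) \<partial>lborel) = (\<integral>x. w x \<partial>lborel)" "integrable lborel (\<lambda>x. w (x + a))" for a
  proof -
    have "integral\<^sup>L (distr lborel borel ((+) a)) w = (\<integral>x. w (a + x) \<partial>lborel)"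
      using wm by (intro integral_distr) auto
    then show "(\<integral>x. w (x + a) \<partial>lborel) = (\<integral>x. w x \<partial>lborel)"
      by (simp add: lborel_distr_plus add.commute)
    have "integrable (distr lborel borel ((+) a)) w"
      using cont_supp_integrable[OF w(1)] by (simp add: lborel_distr_plus)
    then have "integrable lborel (\<lambda>x. w (a + x))"
      using wm by (subst (asm) integrable_distr_eq) auto
    then show "integrable lborel (\<lambda>x. w (x + a))" by (simp add: add.commute)
  qed
  have "bounded (w' ` cball 0 R)"
    using w(2) by (intro compact_imp_bounded compact_continuous_image) (auto simp: cont_supp_def intro: continuous_on_subset)
  then obtain M where "\<forall>y\<in>w' ` cball 0 R. cmod y \<le> M" unfolding bounded_iff by blast
  then have M: "\<And>x. x \<in> cball 0 R \<Longrightarrow> cmod (w' x) \<le> M" by blast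
  have M': "cmod (w' x) \<le> \<bar>M\<bar>" for x
    using M[of x] w(2) by (cases "norm x \<le> R") (auto simp: cont_supp_def)
  have g_bound: "cmod (g n x) \<le> indicator (cball 0 (R + 1)) x * \<bar>M\<bar>" for n x
  proof (cases "norm x \<le> R + 1")
    case True
    let ?h = "1 / real (Suc n)"
    have "norm (w (x + ?h *\<^sub>R ?e) - w (x + 0 *\<^sub>R ?e)) \<le> \<bar>M\<bar> * norm (?h - 0)"
      by (rule differentiable_bound[of UNIV "\<lambda>t. w (x + t *\<^sub>R ?e)" "\<lambda>t s. s *\<^sub>R w' (x + t *\<^sub>R ?e)"])
        (use deriv M' in \<open>auto simp: has_vector_derivative_def intro!: onorm_le mult_left_mono simp: mult.commute[of "\<bar>M\<bar>"]\<close>)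
    then have "cmod (w (x + ?h *\<^sub>R ?e) - w x) \<le> \<bar>M\<bar> * ?h" by simp
    then have "real (Suc n) * cmod (w (x + ?h *\<^sub>R ?e) - w x) \<le> real (Suc n) * (\<bar>M\<bar> * ?h)"
      by (intro mult_left_mono) auto
    also have "\<dots> = \<bar>M\<bar>" by simp
    finally show ?thesis using True by (simp add: g_def norm_mult del: of_nat_Suc)
  next
    case False
    have "norm ((1 / real (Suc n)) *\<^sub>R ?e) \<le> 1" by (simp add: norm_axis_1)
    then have "norm (x + (1 / real (Suc n)) *\<^sub>R ?e) > R"
      using False norm_diff_ineq[of x "(1 / real (Suc n)) *\<^sub>R ?e"] by linarith
    then have "w (x + (1 / real (Suc n)) *\<^sub>R ?e) = 0" "w x = 0"
      using w(1) False by (auto simp: cont_supp_def)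
    then show ?thesis by (simp add: g_def)
  qed
  have "(\<lambda>n. \<integral>x. g n x \<partial>lborel) \<longlonglongrightarrow> (\<integral>x. w' x \<partial>lborel)"
  proof (rule integral_dominated_convergence[where w = "\<lambda>x. indicator (cball 0 (R + 1)) x * \<bar>M\<bar>"])
    show "w' \<in> borel_measurable lborel" using wm by simp
    have "(\<lambda>x. w (x + a)) \<in> borel_measurable borel" for a
      using wm(1) by measurable
    then show "g n \<in> borel_measurable lborel" for n unfolding g_def using wm by measurable
    show "integrable lborel (\<lambda>x. indicator (cball 0 (R + 1)) x * \<bar>M\<bar>)"
      using borel_integrable_compact[of "cball 0 (R + 1)" "\<lambda>x. \<bar>M\<bar>"] by simp
    show "AE x in lborel. (\<lambda>n. g n x) \<longlonglongrightarrow> w' x"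
    proof (rule AE_I2)
      fix x
      have "(\<lambda>h. norm (w (x + (0 + h) *\<^sub>R ?e) - w (x + 0 *\<^sub>R ?e) - h *\<^sub>R w' (x + 0 *\<^sub>R ?e)) / norm h) \<midarrow>0\<rightarrow> 0"
        using deriv[of x 0] unfolding has_vector_derivative_def has_derivative_at by blast
      moreover have "(\<lambda>n. 1 / real (Suc n)) \<longlonglongrightarrow> 0"
        using LIMSEQ_inverse_real_of_nat by (simp only: inverse_eq_divide)
      then have "filterlim (\<lambda>n. 1 / real (Suc n)) (at 0) sequentially"
        by (rule filterlim_atI) simp
      ultimately have lim: "(\<lambda>n. norm (w (x + (0 + 1 / real (Suc n)) *\<^sub>R ?e) - w (x + 0 *\<^sub>R ?e)
          - (1 / real (Suc n)) *\<^sub>R w' (x + 0 *\<^sub>R ?e)) / norm (1 / real (Suc n))) \<longlonglongrightarrow> 0"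
        by (rule filterlim_compose)
      have eq: "norm (z - (1 / real (Suc n)) *\<^sub>R z') / norm (1 / real (Suc n)) = norm (of_nat (Suc n) * z - z')"
        for z z' :: complex and n
      proof -
        have "of_nat (Suc n) * z - z' = of_nat (Suc n) * (z - (1 / real (Suc n)) *\<^sub>R z')"
          by (simp add: scaleR_conv_of_real right_diff_distrib del: of_nat_Suc)
        then show ?thesis by (simp add: norm_mult del: of_nat_Suc)
      qed
      have "(\<lambda>n. norm (g n x - w' x)) \<longlonglongrightarrow> 0"
        using lim unfolding eq by (simp add: g_def del: of_nat_Suc)
      then show "(\<lambda>n. g n x) \<longlonglongrightarrow> w' x"
        by (simp only: tendsto_norm_zero_iff LIM_zero_iff)
    qed
    show "AE x in lborel. norm (g n x) \<le> indicator (cball 0 (R + 1)) x * \<bar>M\<bar>" for n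
      using g_bound by simp
  qed
  moreover have "(\<integral>x. g n x \<partial>lborel) = 0" for n
  proof -
    have "(\<integral>x. g n x \<partial>lborel) = of_nat (Suc n) * ((\<integral>x. w (x + (1 / real (Suc n)) *\<^sub>R ?e) \<partial>lborel) - (\<integral>x. w x \<partial>lborel))"
      unfolding g_def using shift(2)[of "(1 / real (Suc n)) *\<^sub>R ?e"] cont_supp_integrable[OF w(1)]
      by (simp del: of_nat_Suc)
    then show ?thesis by (simp add: shift(1))
  qed
  ultimately show ?thesis by (simp add: LIMSEQ_const_iff)
qed

section \<open>Compactly supported solutions\<close>

lift_definition cnj_poly :: "'n diffop \<Rightarrow> 'n diffop" is
  "\<lambda>(p :: ('n \<Rightarrow>\<^sub>0 nat) \<Rightarrow> complex) \<alpha>. cnj (p \<alpha>)"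
  by simp

lemma cnj_poly_add: "cnj_poly (p + q) = cnj_poly p + cnj_poly q"
  by (rule poly_mapping_eqI) (simp add: cnj_poly.rep_eq lookup_add)

lemma cnj_poly_const: "cnj_poly (const_poly c) = const_poly (cnj c)"
  by (rule poly_mapping_eqI) (simp add: cnj_poly.rep_eq lookup_single when_def)

lemma cnj_poly_var_mult:
  fixes p :: "'n::finite diffop"
  shows "cnj_poly (var_poly k * p) = var_poly k * cnj_poly p"
  by (rule poly_mapping_eqI) (simp add: cnj_poly.rep_eq lookup_var_mult)

lemma cnj_poly_cnj: "cnj_poly (cnj_poly p) = p"
  by (rule poly_mapping_eqI) (simp add: cnj_poly.rep_eq)

text \<open>The situation of \<open>u p = p (D) v\<close> for a fixed compactly supported \<open>v\<close>. It abstracts from the fact that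
  \<open>v\<close> is the regularization of a distribution; the factor \<open>\<i>\<close> is that of \<open>\<partial>\<^sub>k = \<i> D\<^sub>k\<close>.\<close>
locale compact_orbit =
  fixes u :: "'n::finite diffop \<Rightarrow> real^'n \<Rightarrow> complex" and R :: real
  assumes u_cont_supp: "cont_supp R (u p)"
    and u_add: "u (p + q) = (\<lambda>x. u p x + u q x)"
    and u_const: "u (const_poly c * p) = (\<lambda>x. c * u p x)"
    and u_deriv: "((\<lambda>t. u p (x + t *\<^sub>R axis k 1)) has_vector_derivative \<i> * u (var_poly k * p) (x + t *\<^sub>R axis k 1)) (at t)"
begin

lemma u_zero: "u 0 = (\<lambda>x. 0)"
  using u_const[of 0 0] by simp

text \<open>\<open>D\<^sub>k\<close> is symmetric: integrate \<open>\<partial>\<^sub>k (u p * cnj (u q))\<close>.\<close>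
lemma ip_var: "ip (u (var_poly k * p)) (u q) = ip (u p) (u (var_poly k * q))"
proof -
  let ?w' = "\<lambda>x. u p x * cnj (\<i> * u (var_poly k * q) x) + \<i> * u (var_poly k * p) x * cnj (u q x)"
  have c: "cont_supp R (\<lambda>x. c * u p x)" for c p using u_cont_supp by (intro cont_supp_mult continuous_on_const)
  have c1: "cont_supp R (\<lambda>x. u p x * cnj (\<i> * u (var_poly k * q) x))"
    by (rule cont_supp_mult_cnj[OF u_cont_supp c])
  have c2: "cont_supp R (\<lambda>x. \<i> * u (var_poly k * p) x * cnj (u q x))"
    by (rule cont_supp_mult_cnj[OF c u_cont_supp])
  have "(\<integral>x. ?w' x \<partial>lborel) = 0"
  proof (rule integral_derivative_zero[where k = k, OF cont_supp_mult_cnj[OF u_cont_supp[of p] u_cont_supp[of q]]])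
    show "cont_supp R ?w'" by (rule cont_supp_add[OF c1 c2])
    show "((\<lambda>t. u p (x + t *\<^sub>R axis k 1) * cnj (u q (x + t *\<^sub>R axis k 1))) has_vector_derivative ?w' (x + t *\<^sub>R axis k 1)) (at t)" for x t
      by (rule has_vector_derivative_mult[OF u_deriv has_vector_derivative_cnj[OF u_deriv]])
  qed
  moreover have "(\<integral>x. ?w' x \<partial>lborel) = ip (u p) (\<lambda>x. \<i> * u (var_poly k * q) x) + ip (\<lambda>x. \<i> * u (var_poly k * p) x) (u q)"
    unfolding ip_def by (rule Bochner_Integration.integral_add[OF cont_supp_integrable[OF c1] cont_supp_integrable[OF c2]])
  ultimately show ?thesis by (simp add: ip_scale_left ip_scale_right)
qed

lemma ip_adjoint: "ip (u (p * q)) (u r) = ip (u q) (u (cnj_poly p * r))"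
proof (induction p arbitrary: q r rule: diffop_induct)
  case (const c)
  show ?case by (simp add: u_const cnj_poly_const ip_scale_left ip_scale_right)
next
  case (var j p)
  show ?case by (simp add: mult.assoc ip_var var cnj_poly_var_mult mult.left_commute)
next
  case (add p p')
  show ?case
    by (simp add: distrib_right u_add cnj_poly_add add
        ip_add_left[OF u_cont_supp u_cont_supp u_cont_supp] ip_add_right[OF u_cont_supp u_cont_supp u_cont_supp])
qed

abbreviation coord_u :: "'n \<Rightarrow> 'n diffop \<Rightarrow> real^'n \<Rightarrow> complex" where
  "coord_u j p \<equiv> \<lambda>x. complex_of_real (x $ j) * u p x"

lemma coord_u_cont_supp: "cont_supp R (coord_u j p)"
  by (intro cont_supp_mult u_cont_supp continuous_intros)

text \<open>The commutator of \<open>D\<^sub>k\<close> with multiplication by \<open>x\<^sub>j\<close> is the constant \<open>- \<i> \<delta>\<^sub>j\<^sub>k\<close>, seen through the inner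
  product: integrate \<open>\<partial>\<^sub>k (x\<^sub>j * u p * cnj (u q))\<close>.\<close>
lemma ip_coord_var:
  "ip (coord_u j (var_poly k * p)) (u q) = ip (coord_u j p) (u (var_poly k * q)) + (if j = k then \<i> * ip (u p) (u q) else 0)"
proof -
  let ?d = "if j = k then 1 else 0 :: complex"
  let ?v' = "\<lambda>x. \<i> * coord_u j (var_poly k * p) x + ?d * u p x"
  let ?w' = "\<lambda>x. coord_u j p x * cnj (\<i> * u (var_poly k * q) x) + ?v' x * cnj (u q x)"
  have c: "cont_supp R (\<lambda>x. c * u p x)" "cont_supp R (\<lambda>x. c * coord_u j p x)" for c p
    by (rule cont_supp_mult[OF u_cont_supp continuous_on_const],
        rule cont_supp_mult[OF coord_u_cont_supp continuous_on_const])
  have cv: "cont_supp R ?v'" by (rule cont_supp_add[OF c(2) c(1)])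
  have c1: "cont_supp R (\<lambda>x. coord_u j p x * cnj (\<i> * u (var_poly k * q) x))"
    by (rule cont_supp_mult_cnj[OF coord_u_cont_supp c(1)])
  have c2: "cont_supp R (\<lambda>x. ?v' x * cnj (u q x))"
    by (rule cont_supp_mult_cnj[OF cv u_cont_supp])
  have "(\<integral>x. ?w' x \<partial>lborel) = 0"
  proof (rule integral_derivative_zero[where k = k, OF cont_supp_mult_cnj[OF coord_u_cont_supp[of j p] u_cont_supp[of q]]])
    show "cont_supp R ?w'" by (rule cont_supp_add[OF c1 c2])
    fix x :: "real^'n" and t
    have "((\<lambda>t. complex_of_real (x $ j + t * axis k 1 $ j)) has_vector_derivative complex_of_real (axis k 1 $ j)) (at t)"
      by (intro has_vector_derivative_of_real) (auto intro!: derivative_eq_intros)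
    then have "((\<lambda>t. complex_of_real ((x + t *\<^sub>R axis k 1) $ j)) has_vector_derivative ?d) (at t)"
      by (auto simp: axis_def split: if_splits)
    from has_vector_derivative_mult[OF this u_deriv[of p x k t]]
    have "((\<lambda>t. coord_u j p (x + t *\<^sub>R axis k 1)) has_vector_derivative ?v' (x + t *\<^sub>R axis k 1)) (at t)"
      by (simp add: mult.left_commute)
    from has_vector_derivative_mult[OF this has_vector_derivative_cnj[OF u_deriv]]
    show "((\<lambda>t. coord_u j p (x + t *\<^sub>R axis k 1) * cnj (u q (x + t *\<^sub>R axis k 1))) has_vector_derivative ?w' (x + t *\<^sub>R axis k 1)) (at t)" .
  qed
  moreover have "(\<integral>x. ?w' x \<partial>lborel) = ip (coord_u j p) (\<lambda>x. \<i> * u (var_poly k * q) x) + ip ?v' (u q)"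
    unfolding ip_def by (rule Bochner_Integration.integral_add[OF cont_supp_integrable[OF c1] cont_supp_integrable[OF c2]])
  moreover have "ip ?v' (u q) = \<i> * ip (coord_u j (var_poly k * p)) (u q) + ?d * ip (u p) (u q)"
    by (subst ip_add_left[OF c(2) c(1) u_cont_supp]) (simp only: ip_scale_left)
  ultimately have "\<i> * ip (coord_u j (var_poly k * p)) (u q) + ?d * ip (u p) (u q) = \<i> * ip (coord_u j p) (u (var_poly k * q))"
    by (simp add: ip_scale_right add_eq_0_iff)
  then have "- \<i> * (\<i> * ip (coord_u j (var_poly k * p)) (u q) + ?d * ip (u p) (u q)) = - \<i> * (\<i> * ip (coord_u j p) (u (var_poly k * q)))"
    by simp
  then show ?thesis by (auto simp: algebra_simps split: if_splits)
qed

text \<open>The commutator of \<open>p (D)\<close> with multiplication by \<open>x\<^sub>j\<close> is \<open>- \<i>\<close> times the formal derivative of \<open>p\<close>. In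
  weak form, with \<open>p (D)\<close> moved to the other side as its adjoint, only functions \<open>u q\<close> and \<open>x\<^sub>j * u q\<close>
  occur.\<close>
lemma ip_pderiv:
  "- \<i> * ip (u (pderiv_poly j p * q)) (u r) =
     ip (coord_u j q) (u (cnj_poly p * r)) - ip (coord_u j (p * q)) (u r)"
proof (induction p arbitrary: q r rule: diffop_induct)
  case (const c)
  have "coord_u j (const_poly c * q) = (\<lambda>x. c * coord_u j q x)" by (simp add: u_const mult.left_commute)
  then show ?case
    by (simp add: pderiv_poly_const u_zero ip_zero_left u_const cnj_poly_const ip_scale_left ip_scale_right)
next
  case (var k p)
  have "u (pderiv_poly j (var_poly k * p) * q) = (\<lambda>x. (if j = k then 1 else 0) * u (p * q) x + u (var_poly k * (pderiv_poly j p * q)) x)"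
    by (auto simp: pderiv_poly_var_mult distrib_right u_add u_zero mult.assoc)
  then have "ip (u (pderiv_poly j (var_poly k * p) * q)) (u r) =
      (if j = k then 1 else 0) * ip (u (p * q)) (u r) + ip (u (pderiv_poly j p * q)) (u (var_poly k * r))"
    by (simp only: ip_add_left[OF cont_supp_mult[OF u_cont_supp continuous_on_const] u_cont_supp u_cont_supp] ip_scale_left ip_var)
  moreover have "- \<i> * ip (u (pderiv_poly j p * q)) (u (var_poly k * r)) =
     ip (coord_u j q) (u (cnj_poly p * (var_poly k * r))) - ip (coord_u j (p * q)) (u (var_poly k * r))"
    by (rule var)
  moreover have "ip (coord_u j (var_poly k * p * q)) (u r) = ip (coord_u j (p * q)) (u (var_poly k * r)) + (if j = k then \<i> * ip (u (p * q)) (u r) else 0)"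
    using ip_coord_var[of j k "p * q" r] by (simp add: mult.assoc)
  moreover have "cnj_poly p * (var_poly k * r) = cnj_poly (var_poly k * p) * r"
    unfolding cnj_poly_var_mult by (simp only: mult_ac)
  ultimately show ?case by (auto simp: algebra_simps split: if_splits)
next
  case (add p p')
  have "coord_u j ((p + p') * q) = (\<lambda>x. coord_u j (p * q) x + coord_u j (p' * q) x)"
    by (simp add: distrib_right u_add distrib_left)
  then have 1: "ip (coord_u j ((p + p') * q)) (u r) = ip (coord_u j (p * q)) (u r) + ip (coord_u j (p' * q)) (u r)"
    by (simp only: ip_add_left[OF coord_u_cont_supp coord_u_cont_supp u_cont_supp])
  have 2: "ip (u (pderiv_poly j (p + p') * q)) (u r) = ip (u (pderiv_poly j p * q)) (u r) + ip (u (pderiv_poly j p' * q)) (u r)"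
    by (simp only: pderiv_poly_add distrib_right u_add ip_add_left[OF u_cont_supp u_cont_supp u_cont_supp])
  have 3: "ip (coord_u j q) (u (cnj_poly (p + p') * r)) = ip (coord_u j q) (u (cnj_poly p * r)) + ip (coord_u j q) (u (cnj_poly p' * r))"
    by (simp only: cnj_poly_add distrib_right u_add ip_add_right[OF u_cont_supp u_cont_supp coord_u_cont_supp])
  show ?case unfolding 1 2 3 distrib_left add[of q r] by simp
qed

text \<open>This is the step behind Hoermander's inequality for operators with constant coefficients. Let
  \<open>s = \<partial>p/\<partial>X\<^sub>j\<close> and let \<open>cnj p\<close> be the polynomial with conjugate coefficients, so that \<open>cnj p (D)\<close> is the adjoint of
  \<open>p (D)\<close>. As \<open>p (D)\<close> commutes with its adjoint, \<open>\<parallel>u (cnj p * s)\<parallel>\<close> is the norm of \<open>u (p * s) = 0\<close>. In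
  \<open>ip_pderiv\<close> with \<open>q = 1\<close> and \<open>r = s\<close> both terms on the right are then zero, which leaves \<open>\<parallel>u s\<parallel> = 0\<close>.\<close>
lemma pderiv_annihilates:
  assumes p: "\<And>q. u (p * q) = (\<lambda>x. 0)"
  shows "u (pderiv_poly j p) = (\<lambda>x. 0)"
proof -
  let ?s = "pderiv_poly j p"
  have "ip (u (cnj_poly p * ?s)) (u (cnj_poly p * ?s)) = 0"
    by (simp add: ip_adjoint cnj_poly_cnj p ip_zero_right)
  then have "u (cnj_poly p * ?s) = (\<lambda>x. 0)" using ip_definite[OF u_cont_supp] by blast
  then have "ip (u (?s * 1)) (u ?s) = 0"
    using ip_pderiv[of j p 1 ?s] p[of 1] by (simp add: ip_zero_left ip_zero_right)
  then show ?thesis using ip_definite[OF u_cont_supp, of ?s] by auto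
qed

end

section \<open>The action of the operators on distributions\<close>

lemma fold_D_op_trivial:
  assumes "finite J" "\<And>i. i \<in> J \<Longrightarrow> Poly_Mapping.lookup \<alpha> i = 0"
    and "comp_fun_commute (\<lambda>j. D_op j ^^ Poly_Mapping.lookup \<alpha> j)"
  shows "Finite_Set.fold (\<lambda>j. D_op j ^^ Poly_Mapping.lookup \<alpha> j) T J = T"
proof -
  interpret comp_fun_commute "\<lambda>j. D_op j ^^ Poly_Mapping.lookup \<alpha> j" by (rule assms(3))
  show ?thesis using assms(1,2) by (induction J rule: finite_induct) simp_all
qed

lemma D_monomial_0: "D_monomial 0 T = T"
  unfolding D_monomial_def by (rule fold_D_op_trivial) (auto intro!: comp_fun_commute.intro)

text \<open>For a monomial in one variable all operators but one in the fold are the identity, so they commute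
  trivially and the fold can be evaluated.\<close>
lemma D_monomial_single: "D_monomial (Poly_Mapping.single j (Suc 0)) T = D_op j T"
proof -
  let ?f = "\<lambda>i. D_op i ^^ Poly_Mapping.lookup (Poly_Mapping.single j (Suc 0)) i"
  have c: "comp_fun_commute ?f"
    by standard (auto simp: lookup_single when_def)
  interpret comp_fun_commute ?f by (rule c)
  have "Finite_Set.fold ?f T UNIV = ?f j (Finite_Set.fold ?f T (UNIV - {j}))"
    by (rule fold_rec) auto
  also have "Finite_Set.fold ?f T (UNIV - {j}) = T"
    by (rule fold_D_op_trivial[OF _ _ c]) (auto simp: lookup_single)
  finally show ?thesis by (simp add: D_monomial_def)
qed

lemma scale_dist_0: "scale_dist 0 T = 0"
  by (rule dist_eqI) (simp add: scale_dist.rep_eq zero_distribution.rep_eq)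

lemma scale_dist_1: "scale_dist 1 T = T"
  by (rule dist_eqI) (simp add: scale_dist.rep_eq)

lemma act_const: "act (const_poly c) T = scale_dist c T"
  by (simp add: act_def D_monomial_0 scale_dist_0)

lemma act_var: "act (var_poly j) T = D_op j T"
  unfolding act_def by (simp add: D_monomial_single[unfolded One_nat_def] scale_dist_1)

lemma conv_add: "conv (S + T) \<phi> x = conv S \<phi> x + conv T \<phi> x"
  by (simp add: conv_def plus_distribution.rep_eq)

lemma conv_scale: "conv (scale_dist c T) \<phi> x = c * conv T \<phi> x"
  by (simp add: conv_def scale_dist.rep_eq)

lemma conv_zero: "conv 0 \<phi> x = 0"
  by (simp add: conv_def zero_distribution.rep_eq)

lemma eq_on_open_partial: "eq_on_open W S T \<Longrightarrow> eq_on_open W (partial_dist j S) (partial_dist j T)"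
  unfolding eq_on_open_def partial_dist.rep_eq
  by (auto simp: partial_test order_trans[OF supp_partial])

lemma eq_on_open_scale: "eq_on_open W S T \<Longrightarrow> eq_on_open W (scale_dist c S) (scale_dist c T)"
  unfolding eq_on_open_def scale_dist.rep_eq by simp

lemma eq_on_open_add: "eq_on_open W S T \<Longrightarrow> eq_on_open W S' T' \<Longrightarrow> eq_on_open W (S + S') (T + T')"
  unfolding eq_on_open_def plus_distribution.rep_eq by simp

lemma conv_zero_imp:
  assumes "\<And>\<phi> x. \<phi> \<in> test_functions \<Longrightarrow> conv T \<phi> x = 0"
  shows "T = 0"
proof (rule dist_eqI)
  fix \<phi> :: "real^'a \<Rightarrow> complex" assume \<phi>: "\<phi> \<in> test_functions"
  have "conv T (\<lambda>y. \<phi> (0 + (-1) *\<^sub>R y)) 0 = 0"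
    by (rule assms[OF test_affine[OF \<phi>]]) simp
  then show "apply_dist T \<phi> = apply_dist 0 \<phi>" by (simp add: conv_def zero_distribution.rep_eq)
qed

text \<open>The module axioms for \<open>F\<close> include that the action of \<open>A\<close> is multiplicative on \<open>F\<close>; with
  \<open>act_const\<close> and \<open>act_var\<close> they determine the action of every polynomial.\<close>
locale dist_module =
  fixes F :: "'n::finite distribution set"
  assumes dist_module: "module diffop_ring (dist_A_module F)"
begin

lemma
  fixes a b :: "'n diffop"
  assumes "T \<in> F"
  shows act_closed: "act a T \<in> F" and act_add_left: "act (a + b) T = act a T + act b T"
    and act_mult: "act (a * b) T = act a (act b T)" and act_1: "act 1 T = T"
  using assms module.smult_closed[OF dist_module, of a T] module.smult_l_distr[OF dist_module, of a b T]
    module.smult_assoc1[OF dist_module, of a b T] module.smult_one[OF dist_module, of T]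
  by (auto simp: module_on_def ring_of_type_algebra_def)

lemma
  assumes "S \<in> F" "T \<in> F"
  shows add_closed: "S + T \<in> F" and act_add_right: "act a (S + T) = act a S + act a T"
  using assms module.smult_r_distr[OF dist_module, of a S T]
    abelian_monoid.a_closed[OF abelian_group.axioms(1)[OF module.axioms(2)[OF dist_module]], of S T]
  by (auto simp: module_on_def ring_of_type_algebra_def)

lemma zero_mem: "0 \<in> F"
  using abelian_monoid.zero_closed[OF abelian_group.axioms(1)[OF module.axioms(2)[OF dist_module]]]
  by (simp add: module_on_def)

lemma act_zero_left: "T \<in> F \<Longrightarrow> act 0 T = 0"
  using act_add_left[of T 0 0] by simp

lemma act_zero_right: "act a (0 :: 'n distribution) = 0"
  using act_add_right[OF zero_mem zero_mem, of a] by simp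

lemma act_uminus: "T \<in> F \<Longrightarrow> act (- a) T = - act a T"
  using act_add_left[of T a "- a"] act_zero_left[of T] by (simp add: add_eq_0_iff)

lemma uminus_mem: "T \<in> F \<Longrightarrow> - T \<in> F"
  using act_uminus[of T 1] act_closed[of T "- 1"] act_1[of T] by simp

lemma act_var_mult: "T \<in> F \<Longrightarrow> act (var_poly j * p) T = D_op j (act p T)"
  using act_mult[of T "var_poly j" p] by (simp add: act_var)

lemma act_local:
  assumes "S \<in> F" "T \<in> F" "eq_on_open W S T"
  shows "eq_on_open W (act p S) (act p T)"
proof (induction p rule: diffop_induct)
  case (const c)
  show ?case using assms(3) by (simp add: act_const eq_on_open_scale)
next
  case (var j p)
  then show ?case using assms by (simp add: act_var_mult D_op_def eq_on_open_scale eq_on_open_partial)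
next
  case (add p q)
  then show ?case using assms by (simp add: act_add_left eq_on_open_add)
qed

lemma conv_act_support:
  assumes T: "T \<in> F" "eq_near (- V) T 0" and V: "bounded V" and \<phi>: "\<phi> \<in> test_functions"
  shows "\<exists>R. \<forall>p x. norm x > R \<longrightarrow> conv (act p T) \<phi> x = 0"
proof -
  obtain W where W: "- V \<subseteq> W" "eq_on_open W T 0" using T(2) by (auto simp: eq_near_def)
  obtain a where a: "\<And>x. x \<in> V \<Longrightarrow> norm x \<le> a" using V by (auto simp: bounded_iff)
  obtain b where b: "\<And>x. x \<in> supp \<phi> \<Longrightarrow> norm x \<le> b"
    using compact_imp_bounded[OF test_compact[OF \<phi>]] by (auto simp: bounded_iff)
  have "conv (act p T) \<phi> x = 0" if x: "norm x > a + b" for p x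
  proof -
    have "eq_on_open W (act p T) 0" using act_local[OF T(1) zero_mem W(2), of p] by (simp add: act_zero_right)
    moreover have "supp (\<lambda>y. \<phi> (x + (- 1) *\<^sub>R y)) \<subseteq> W"
    proof
      fix y assume "y \<in> supp (\<lambda>y. \<phi> (x + (- 1) *\<^sub>R y))"
      then have "x - y \<in> supp \<phi>" using supp_affine[of "-1" \<phi> x] by auto
      then have "norm (x - y) \<le> b" by (rule b)
      then have "norm y > a" using x norm_triangle_ineq2[of x y] by linarith
      then show "y \<in> W" using a[of y] W(1) by auto
    qed
    moreover have "(\<lambda>y. \<phi> (x + (- 1) *\<^sub>R y)) \<in> test_functions" using test_affine[OF \<phi>, of "-1"] by simp
    ultimately show ?thesis by (simp add: conv_def eq_on_open_def zero_distribution.rep_eq)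
  qed
  then show ?thesis by blast
qed

text \<open>Regularizing \<open>T\<close> by a test function gives a \<open>compact_orbit\<close>. The annihilator ideal of \<open>T\<close> is
  therefore closed under formal derivatives and contains a nonzero constant.\<close>
lemma compact_support_zero:
  assumes T: "T \<in> F" "eq_near (- V) T 0" and V: "bounded V" and a: "a \<noteq> 0" "act a T = 0"
  shows "T = 0"
proof -
  define I where "I = {p. act p T = 0}"
  have "pderiv_poly j p \<in> I" if p: "p \<in> I" for p j
  proof -
    have "conv (act (pderiv_poly j p) T) \<phi> x = 0" if \<phi>: "\<phi> \<in> test_functions" for \<phi> x
    proof -
      obtain R where R: "\<And>p x. norm x > R \<Longrightarrow> conv (act p T) \<phi> x = 0"
        using conv_act_support[OF T V \<phi>] by blast
      interpret compact_orbit "\<lambda>p. conv (act p T) \<phi>" R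
      proof
        show "cont_supp R (conv (act p T) \<phi>)" for p
          using continuous_conv[OF \<phi>] R by (auto simp: cont_supp_def)
        show "conv (act (p + q) T) \<phi> = (\<lambda>x. conv (act p T) \<phi> x + conv (act q T) \<phi> x)" for p q
          by (rule ext) (simp add: act_add_left[OF T(1)] conv_add)
        show "conv (act (const_poly c * p) T) \<phi> = (\<lambda>x. c * conv (act p T) \<phi> x)" for c p
          by (rule ext) (simp add: act_mult[OF T(1)] act_const conv_scale)
        show "((\<lambda>t. conv (act p T) \<phi> (x + t *\<^sub>R axis k 1)) has_vector_derivative
            \<i> * conv (act (var_poly k * p) T) \<phi> (x + t *\<^sub>R axis k 1)) (at t)" for p x k t
          using conv_derivative[OF \<phi>, of "act p T" x k t]
          by (simp add: act_var_mult[OF T(1)] D_op_def conv_scale)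
      qed
      have "conv (act (p * q) T) \<phi> = (\<lambda>x. 0)" for q
      proof -
        have "act (p * q) T = act q (act p T)" using act_mult[OF T(1), of q p] by (simp add: mult.commute)
        also have "\<dots> = 0" using p by (simp add: I_def act_zero_right)
        finally show ?thesis by (simp add: conv_zero fun_eq_iff)
      qed
      from pderiv_annihilates[OF this] show ?thesis by (simp add: fun_eq_iff)
    qed
    then have "act (pderiv_poly j p) T = 0" by (rule conv_zero_imp)
    then show ?thesis by (simp add: I_def)
  qed
  moreover have "a \<in> I" using a by (simp add: I_def)
  ultimately obtain c where c: "c \<noteq> 0" "const_poly c \<in> I"
    using derivative_closed_contains_constant[of I a] a(1) by blast
  have "apply_dist (scale_dist c T) = apply_dist 0" using c(2) by (simp add: I_def act_const)
  then show ?thesis using c(1)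
    by (intro dist_eqI) (simp add: scale_dist.rep_eq zero_distribution.rep_eq fun_eq_iff)
qed

end

section \<open>Quotient modules as records\<close>

lemma smult_module_on [simp]: "x \<odot>\<^bsub>module_on M smul\<^esub> y = smul x y"
  and carrier_module_on [simp]: "carrier (module_on M smul) = M"
  and zero_module_on [simp]: "\<zero>\<^bsub>module_on M smul\<^esub> = 0"
  and add_module_on [simp]: "u \<oplus>\<^bsub>module_on M smul\<^esub> v = u + v"
  by (simp_all add: module_on_def)

lemma module_vec: "Modules.module ((*s) :: 'a::comm_ring_1 \<Rightarrow> 'a^'k \<Rightarrow> 'a^'k)"
  by unfold_locales (simp_all add: vector_add_ldistrib vector_sadd_rdistrib vector_smult_assoc)

interpretation vec_module: Modules.module "(*s) :: 'a::comm_ring_1 \<Rightarrow> 'a^'k \<Rightarrow> 'a^'k"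
  by (rule module_vec)

lemma lin_closed_uminus:
  assumes "Modules.module smul" "lin_closed smul M" "x \<in> M"
  shows "- x \<in> M"
proof -
  interpret Modules.module smul by (rule assms(1))
  show ?thesis using lin_closedD(3)[OF assms(2,3), of "- 1"] by simp
qed

lemma submodule_iff:
  fixes P :: "('n::finite diffop^'k) set"
  shows "submodule P diffop_ring free_A_module \<longleftrightarrow> lin_closed (*s) P"
proof
  assume "submodule P diffop_ring free_A_module"
  then interpret submodule P diffop_ring free_A_module .
  show "lin_closed (*s) P"
    using m_closed one_closed smult_closed by (auto simp: lin_closed_def module_on_def ring_of_type_algebra_def)
next
  assume P: "lin_closed (*s) P"
  have "inv\<^bsub>add_monoid free_A_module\<^esub> x = - x" for x :: "'n diffop^'k"
    unfolding m_inv_def by (rule the_equality) (auto simp: module_on_def eq_neg_iff_add_eq_0 add.commute)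
  then show "submodule P diffop_ring free_A_module"
    using lin_closedD[OF P] lin_closed_uminus[OF module_vec P]
    by (intro submodule.intro subgroup.intro submodule_axioms.intro) (auto simp: module_on_def)
qed

definition quotient_rep :: "('b \<Rightarrow> 'u) \<Rightarrow> 'b set \<Rightarrow> 'u \<Rightarrow> 'b" where
  "quotient_rep \<pi> S u = (SOME x. x \<in> S \<and> \<pi> x = u)"

definition quotient_module ::
  "('b::ab_group_add \<Rightarrow> 'u) \<Rightarrow> ('a \<Rightarrow> 'b \<Rightarrow> 'b) \<Rightarrow> 'b set \<Rightarrow> ('a, 'u) module" where
  "quotient_module \<pi> smul S =
     \<lparr>carrier = \<pi> ` S, monoid.mult = undefined, one = undefined, zero = \<pi> 0,
      add = (\<lambda>u v. \<pi> (quotient_rep \<pi> S u + quotient_rep \<pi> S v)),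
      smult = (\<lambda>a u. \<pi> (smul a (quotient_rep \<pi> S u)))\<rparr>"

text \<open>The quotient \<open>S / N\<close>, its elements named by values of \<open>\<pi>\<close>, whose fibres on \<open>S\<close> are the cosets of \<open>N\<close>. With
  \<open>N = {0}\<close> it is a copy of \<open>S\<close> in another type. In this way the submodules of \<open>A\<^sup>k\<close> and the cyclic
  modules \<open>A / M\<close> get carriers in the type over which injectivity and the cogenerator property are stated.\<close>
locale quotient_map =
  fixes \<pi> :: "'b::ab_group_add \<Rightarrow> 'u" and smul :: "'a::comm_ring_1 \<Rightarrow> 'b \<Rightarrow> 'b" and S N :: "'b set"
  assumes smul: "Modules.module smul" and S: "lin_closed smul S" and N: "lin_closed smul N"
    and fibres: "\<And>x y. x \<in> S \<Longrightarrow> y \<in> S \<Longrightarrow> \<pi> x = \<pi> y \<longleftrightarrow> x - y \<in> N"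
begin

lemma quotient_rep: "x \<in> S \<Longrightarrow> quotient_rep \<pi> S (\<pi> x) \<in> S \<and> \<pi> (quotient_rep \<pi> S (\<pi> x)) = \<pi> x"
  unfolding quotient_rep_def by (rule someI_ex) blast

lemma quotient_carrier: "carrier (quotient_module \<pi> smul S) = \<pi> ` S"
  by (simp add: quotient_module_def)

lemma quotient_zero: "\<zero>\<^bsub>quotient_module \<pi> smul S\<^esub> = \<pi> 0"
  by (simp add: quotient_module_def)

lemma quotient_add:
  assumes "x \<in> S" "y \<in> S"
  shows "\<pi> x \<oplus>\<^bsub>quotient_module \<pi> smul S\<^esub> \<pi> y = \<pi> (x + y)"
proof -
  let ?x = "quotient_rep \<pi> S (\<pi> x)" and ?y = "quotient_rep \<pi> S (\<pi> y)"
  have "?x \<in> S" "?y \<in> S" "\<pi> ?x = \<pi> x" "\<pi> ?y = \<pi> y" using quotient_rep assms by blast+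
  then have "?x - x \<in> N" "?y - y \<in> N" "?x + ?y \<in> S" "x + y \<in> S"
    using fibres assms lin_closedD(2)[OF S] by blast+
  moreover from this have "(?x - x) + (?y - y) \<in> N" using lin_closedD(2)[OF N] by blast
  ultimately have "\<pi> (?x + ?y) = \<pi> (x + y)" using fibres by (simp add: algebra_simps)
  then show ?thesis by (simp add: quotient_module_def)
qed

lemma quotient_smult:
  assumes "x \<in> S"
  shows "a \<odot>\<^bsub>quotient_module \<pi> smul S\<^esub> \<pi> x = \<pi> (smul a x)"
proof -
  interpret Modules.module smul by (rule smul)
  let ?x = "quotient_rep \<pi> S (\<pi> x)"
  have "?x \<in> S" "\<pi> ?x = \<pi> x" using quotient_rep assms by blast+
  then have "smul a (?x - x) \<in> N" "smul a ?x \<in> S" "smul a x \<in> S"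
    using fibres assms lin_closedD(3)[OF S] lin_closedD(3)[OF N] by blast+
  then have "\<pi> (smul a ?x) = \<pi> (smul a x)" using fibres by (simp add: scale_right_diff_distrib)
  then show ?thesis by (simp add: quotient_module_def)
qed

lemma quotient_is_module: "module ring_of_type_algebra (quotient_module \<pi> smul S)"
proof -
  interpret Modules.module smul by (rule smul)
  note S_closed = lin_closedD(1)[OF S] lin_closedD(2)[OF S] lin_closedD(3)[OF S] lin_closed_uminus[OF smul S]
  note simps = quotient_add quotient_smult quotient_zero quotient_carrier S_closed
  show ?thesis
  proof (rule moduleI)
    show "cring (ring_of_type_algebra :: 'a ring)" by (rule cring_from_type_algebra)
    show "abelian_group (quotient_module \<pi> smul S)"
    proof (rule abelian_groupI)
      fix u assume "u \<in> carrier (quotient_module \<pi> smul S)"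
      then obtain x where x: "x \<in> S" "u = \<pi> x" by (auto simp: quotient_carrier)
      have "\<pi> (- x) \<oplus>\<^bsub>quotient_module \<pi> smul S\<^esub> u = \<zero>\<^bsub>quotient_module \<pi> smul S\<^esub>"
        using x by (simp add: simps)
      then show "\<exists>v\<in>carrier (quotient_module \<pi> smul S). v \<oplus>\<^bsub>quotient_module \<pi> smul S\<^esub> u = \<zero>\<^bsub>quotient_module \<pi> smul S\<^esub>"
        using S_closed(4)[OF x(1)] by (auto simp: quotient_carrier)
    qed (auto simp: simps add_ac)
  qed (auto simp: simps ring_of_type_algebra_def scale_left_distrib scale_right_distrib)
qed

end

section \<open>Pairing of operator vectors with vectors of distributions\<close>

definition pairing :: "'n::finite diffop^'k \<Rightarrow> 'n distribution^'k \<Rightarrow> 'n distribution" where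
  "pairing x f = (\<Sum>j\<in>UNIV. act (x $ j) (f $ j))"

lemma Ker_iff: "f \<in> Ker F P \<longleftrightarrow> (\<forall>j. f $ j \<in> F) \<and> (\<forall>p\<in>P. pairing p f = 0)"
  by (simp add: Ker_def pairing_def)

lemma Ker_antimono: "P \<subseteq> Q \<Longrightarrow> Ker F Q \<subseteq> Ker F P"
  unfolding Ker_def by blast

context dist_module
begin

lemma sum_mem: "(\<And>j. j \<in> J \<Longrightarrow> f j \<in> F) \<Longrightarrow> sum f J \<in> F"
  by (induction J rule: infinite_finite_induct) (auto simp: zero_mem add_closed)

lemma act_sum: "(\<And>j. j \<in> J \<Longrightarrow> f j \<in> F) \<Longrightarrow> act a (sum f J) = (\<Sum>j\<in>J. act a (f j))"
  by (induction J rule: infinite_finite_induct) (auto simp: act_zero_right act_add_right sum_mem)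

lemma pairing_mem: "(\<And>j. f $ j \<in> F) \<Longrightarrow> pairing x f \<in> F"
  unfolding pairing_def by (intro sum_mem) (auto intro: act_closed)

lemma pairing_add_left:
  assumes "\<And>j. f $ j \<in> F" shows "pairing (x + y) f = pairing x f + pairing y f"
  unfolding pairing_def using act_add_left[OF assms] by (simp add: sum.distrib)

lemma pairing_smult:
  assumes "\<And>j. f $ j \<in> F" shows "pairing (a *s x) f = act a (pairing x f)"
  unfolding pairing_def using act_mult[OF assms] act_closed[OF assms]
  by (simp add: act_sum)

lemma pairing_zero_left: "(\<And>j. f $ j \<in> F) \<Longrightarrow> pairing 0 f = 0"
  using pairing_add_left[of f 0 0] by simp

lemma pairing_sum_left:
  "(\<And>j. f $ j \<in> F) \<Longrightarrow> pairing (\<Sum>i\<in>J. x i) f = (\<Sum>i\<in>J. pairing (x i) f)"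
  by (induction J rule: infinite_finite_induct) (auto simp: pairing_zero_left pairing_add_left)

lemma pairing_add_right:
  assumes "\<And>j. f $ j \<in> F" "\<And>j. g $ j \<in> F" shows "pairing x (f + g) = pairing x f + pairing x g"
  unfolding pairing_def using act_add_right[OF assms] by (simp add: sum.distrib)

lemma pairing_zero_right: "pairing (x :: 'n diffop^'k) 0 = 0"
  by (simp add: pairing_def act_zero_right)

lemma pairing_uminus_right:
  assumes "\<And>j. f $ j \<in> F" shows "pairing x (- f) = - pairing x f"
  using pairing_add_right[of f "- f" x] assms uminus_mem by (simp add: pairing_zero_right eq_neg_iff_add_eq_0 add.commute)

lemma pairing_axis:
  assumes "\<And>j. f $ j \<in> F" shows "pairing (axis i 1) f = f $ i"
proof -
  have "pairing (axis i 1) f = (\<Sum>j\<in>UNIV. if j = i then f $ i else 0)"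
    unfolding pairing_def using assms by (intro sum.cong) (auto simp: axis_def act_1 act_zero_left)
  then show ?thesis by simp
qed

lemma zero_in_Ker: "0 \<in> Ker F P"
  by (simp add: Ker_iff zero_mem pairing_zero_right)

lemma pairing_local:
  assumes "\<And>j. f $ j \<in> F" "\<And>j. g $ j \<in> F" "\<And>j. eq_near U (f $ j) (g $ j)"
  shows "eq_near U (pairing x f) (pairing x g)"
proof -
  have "\<forall>j. \<exists>W. open W \<and> U \<subseteq> W \<and> eq_on_open W (f $ j) (g $ j)"
    using assms(3) unfolding eq_near_def by blast
  from choice[OF this] obtain W where W: "\<And>j. open (W j)" "\<And>j. U \<subseteq> W j" "\<And>j. eq_on_open (W j) (f $ j) (g $ j)"
    by blast
  let ?W = "\<Inter>j. W j"
  have "eq_on_open ?W (f $ j) (g $ j)" for j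
    using W(3)[of j] unfolding eq_on_open_def by (meson INT_lower UNIV_I order_trans)
  then have "eq_on_open ?W (act (x $ j) (f $ j)) (act (x $ j) (g $ j))" for j
    by (rule act_local[OF assms(1,2)])
  then have "eq_on_open ?W (\<Sum>j\<in>J. act (x $ j) (f $ j)) (\<Sum>j\<in>J. act (x $ j) (g $ j))" for J
    by (induction J rule: infinite_finite_induct) (auto simp: eq_on_open_add, (simp_all add: eq_on_open_def)?)
  moreover have "open ?W" by (intro open_INT) (auto simp: W)
  ultimately show ?thesis
    unfolding eq_near_def pairing_def using W(2) by (intro exI[of _ ?W]) auto
qed

end

section \<open>Consequences of injectivity and of the cogenerator property\<close>

locale dist_injective = dist_module F for F :: "'n::finite distribution set" +
  assumes injective: "injective_module TYPE('n universe) diffop_ring (dist_A_module F)"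
begin

text \<open>Injectivity in the form needed for all constructions below. A homomorphism from a submodule of
  \<open>A\<^sup>k\<close> to \<open>F\<close> is given by its graph \<open>G\<close>, for which being well defined only means that \<open>(0, t) \<in> G\<close>
  implies \<open>t = 0\<close>. A homomorphism defined on all of \<open>A\<^sup>k\<close> is the pairing with a vector \<open>g\<close> over \<open>F\<close>.\<close>
lemma extend_graph:
  fixes G :: "((('n diffop, 'k::finite) vec) \<times> 'n distribution) set"
  assumes G_F: "\<And>x t. (x, t) \<in> G \<Longrightarrow> t \<in> F"
    and G_0: "(0, 0) \<in> G"
    and G_add: "\<And>x t y s. (x, t) \<in> G \<Longrightarrow> (y, s) \<in> G \<Longrightarrow> (x + y, t + s) \<in> G"
    and G_smult: "\<And>a x t. (x, t) \<in> G \<Longrightarrow> (a *s x, act a t) \<in> G"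
    and G_fun: "\<And>t. (0, t) \<in> G \<Longrightarrow> t = 0"
  shows "\<exists>g. (\<forall>j. g $ j \<in> F) \<and> (\<forall>x t. (x, t) \<in> G \<longrightarrow> pairing x g = t)"
proof -
  obtain e :: "'k \<Rightarrow> nat" where e: "inj e"
    using finite_imp_inj_to_nat_seg[of "UNIV :: 'k set"] by auto
  \<comment> \<open>A copy of \<open>A\<^sup>k\<close> in the type of the test modules: \<open>x\<close> is stored in the components of a sequence that \<open>e\<close> selects.\<close>
  define \<tau> :: "'n diffop^'k \<Rightarrow> 'n universe" where
    "\<tau> x = {\<lambda>i. if i \<in> range e then x $ inv_into UNIV e i else 0}" for x
  have \<tau>_inj: "\<tau> x = \<tau> y \<longleftrightarrow> x = y" for x y
  proof
    assume "\<tau> x = \<tau> y"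
    then have eq: "(\<lambda>i. if i \<in> range e then x $ inv_into UNIV e i else 0) = (\<lambda>i. if i \<in> range e then y $ inv_into UNIV e i else 0)"
      by (simp add: \<tau>_def)
    have "x $ j = y $ j" for j using fun_cong[OF eq, of "e j"] e by simp
    then show "x = y" by (simp add: vec_eq_iff)
  qed simp
  define S where "S = fst ` G"
  have S: "lin_closed (*s) S"
    unfolding lin_closed_def
  proof (intro conjI ballI allI)
    have S_I: "x \<in> S" if "(x, t) \<in> G" for x t using imageI[OF that, of fst] by (simp add: S_def)
    show "0 \<in> S" by (rule S_I[OF G_0])
    fix x assume "x \<in> S"
    then obtain t where t: "(x, t) \<in> G" by (auto simp: S_def)
    show "a *s x \<in> S" for a by (rule S_I[OF G_smult[OF t]])
    fix y assume "y \<in> S"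
    then obtain s where s: "(y, s) \<in> G" by (auto simp: S_def)
    show "x + y \<in> S" by (rule S_I[OF G_add[OF t s]])
  qed
  have unique: "t = s" if "(x, t) \<in> G" "(x, s) \<in> G" for x t s
  proof -
    have "((- 1) *s x, act (- 1) s) \<in> G" by (rule G_smult[OF that(2)])
    \<comment> \<open>Single-valuedness follows from the value at \<open>0\<close> by subtraction.\<close>
    from G_add[OF that(1) this] have "(x + (- 1) *s x, t + act (- 1) s) \<in> G" .
    moreover have "x + (- 1) *s x = 0" by (simp add: vec_module.scale_minus_left)
    moreover have "t + act (- 1) s = t - s"
      by (simp only: act_uminus[OF G_F[OF that(2)]] act_1[OF G_F[OF that(2)]] add_uminus_conv_diff)
    ultimately have "(0, t - s) \<in> G" by simp
    then have "t - s = 0" by (rule G_fun)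
    then show ?thesis by simp
  qed
  have triv: "lin_closed (*s) {0 :: 'n diffop^'k}" "lin_closed (*s) (UNIV :: ('n diffop^'k) set)"
    by (auto simp: lin_closed_def)
  interpret M: quotient_map \<tau> "(*s)" S "{0}"
    by (rule quotient_map.intro[OF module_vec S triv(1)]) (simp add: \<tau>_inj)
  interpret N: quotient_map \<tau> "(*s)" UNIV "{0}"
    by (rule quotient_map.intro[OF module_vec triv(2,1)]) (simp add: \<tau>_inj)
  let ?M = "quotient_module \<tau> (*s) S" and ?N = "quotient_module \<tau> (*s) UNIV"
  define h where "h u = (THE t. \<exists>x. \<tau> x = u \<and> (x, t) \<in> G)" for u
  have h: "h (\<tau> x) = t" if "(x, t) \<in> G" for x t
    unfolding h_def by (rule the_equality) (use that unique \<tau>_inj in auto)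
  have carrier_M: "\<exists>x t. x \<in> S \<and> u = \<tau> x \<and> (x, t) \<in> G" if u: "u \<in> carrier ?M" for u
  proof -
    obtain x where x: "x \<in> S" "u = \<tau> x" using u unfolding M.quotient_carrier by blast
    then obtain t where "(x, t) \<in> G" by (auto simp: S_def)
    with x show ?thesis by blast
  qed
  have id: "id \<in> mod_hom diffop_ring ?M ?N"
    unfolding mod_hom_def hom_def
    by (auto simp: M.quotient_carrier N.quotient_carrier M.quotient_add N.quotient_add M.quotient_smult N.quotient_smult)
  have hh: "h \<in> mod_hom diffop_ring ?M (dist_A_module F)"
    unfolding mod_hom_def hom_def
  proof (intro CollectI conjI ballI funcsetI)
    fix u assume "u \<in> carrier (add_monoid ?M)"
    then have "u \<in> carrier ?M" by simp
    then obtain x t where x: "x \<in> S" "u = \<tau> x" "(x, t) \<in> G" using carrier_M by blast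
    then show "h u \<in> carrier (add_monoid (dist_A_module F))" using h G_F by auto
    fix v assume "v \<in> carrier (add_monoid ?M)"
    then have "v \<in> carrier ?M" by simp
    then obtain y s where y: "y \<in> S" "v = \<tau> y" "(y, s) \<in> G" using carrier_M by blast
    show "h (u \<otimes>\<^bsub>add_monoid ?M\<^esub> v) = h u \<otimes>\<^bsub>add_monoid (dist_A_module F)\<^esub> h v"
      using x y h[OF x(3)] h[OF y(3)] h[OF G_add[OF x(3) y(3)]] by (simp add: M.quotient_add)
  next
    fix a u assume "u \<in> carrier ?M"
    then obtain x t where x: "x \<in> S" "u = \<tau> x" "(x, t) \<in> G" using carrier_M by blast
    then show "h (a \<odot>\<^bsub>?M\<^esub> u) = a \<odot>\<^bsub>dist_A_module F\<^esub> h u"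
      using h[OF x(3)] h[OF G_smult[OF x(3)]] by (simp add: M.quotient_smult)
  qed
  obtain g where g: "g \<in> mod_hom diffop_ring ?N (dist_A_module F)" "\<And>u. u \<in> carrier ?M \<Longrightarrow> g u = h u"
    using injective[unfolded injective_module_def] M.quotient_is_module N.quotient_is_module id hh
    by (metis id_apply inj_on_id)
  have g_F: "g (\<tau> x) \<in> F" for x
    using g(1) by (auto simp: mod_hom_def hom_def N.quotient_carrier)
  have g_add: "g (\<tau> (x + y)) = g (\<tau> x) + g (\<tau> y)" for x y
  proof -
    have "g (\<tau> x \<oplus>\<^bsub>?N\<^esub> \<tau> y) = g (\<tau> x) + g (\<tau> y)"
      using g(1) by (simp add: mod_hom_def hom_def N.quotient_carrier)
    then show ?thesis by (simp add: N.quotient_add)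
  qed
  have g_smult: "g (\<tau> (a *s x)) = act a (g (\<tau> x))" for a x
  proof -
    have "g (a \<odot>\<^bsub>?N\<^esub> \<tau> x) = act a (g (\<tau> x))"
      using g(1) by (simp add: mod_hom_def N.quotient_carrier ring_of_type_algebra_def)
    then show ?thesis by (simp add: N.quotient_smult)
  qed
  have g_sum: "g (\<tau> (\<Sum>j\<in>J. x j)) = (\<Sum>j\<in>J. g (\<tau> (x j)))" for J :: "'k set" and x
    by (induction J rule: infinite_finite_induct) (use g_add[of 0 0] in \<open>auto simp: g_add\<close>)
  define gv where "gv = (\<chi> j. g (\<tau> (axis j 1)))"
  have "pairing x gv = g (\<tau> x)" for x
  proof -
    have "g (\<tau> x) = g (\<tau> (\<Sum>j\<in>UNIV. x $ j *s axis j 1))" by (simp add: basis_expansion)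
    then show ?thesis by (simp add: g_sum g_smult pairing_def gv_def)
  qed
  moreover have "g (\<tau> x) = t" if "(x, t) \<in> G" for x t
  proof -
    have "x \<in> S" using that by (force simp: S_def)
    then show ?thesis using g(2)[of "\<tau> x"] h[OF that] by (simp add: M.quotient_carrier)
  qed
  ultimately show ?thesis using g_F by (intro exI[of _ gv]) (auto simp: gv_def)
qed

end

lemma scale_dist_scale: "scale_dist a (scale_dist b T) = scale_dist (a * b) T"
  by (rule dist_eqI) (simp add: scale_dist.rep_eq)

locale dist_cogenerator = dist_module F for F :: "'n::finite distribution set" +
  assumes cogenerator: "injective_cogenerator TYPE('n universe) diffop_ring (dist_A_module F)"

sublocale dist_cogenerator \<subseteq> dist_injective
  using cogenerator by unfold_locales (simp add: injective_cogenerator_def)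

context dist_cogenerator
begin

text \<open>A nonzero homomorphism \<open>A / M \<rightarrow> F\<close> sends the class of \<open>1\<close> to such a \<open>T\<close>.\<close>
lemma exists_annihilated:
  fixes M :: "'n diffop set"
  assumes M: "lin_closed (*) M" "1 \<notin> M"
  shows "\<exists>T\<in>F. T \<noteq> 0 \<and> (\<forall>a\<in>M. act a T = 0)"
proof -
  \<comment> \<open>The coset of \<open>x\<close> modulo \<open>M\<close>, stored as a set of sequences.\<close>
  define \<pi> :: "'n diffop \<Rightarrow> 'n universe" where
    "\<pi> x = {\<lambda>i. if i = 0 then y else 0 | y. y - x \<in> M}" for x
  have fibres: "\<pi> x = \<pi> y \<longleftrightarrow> x - y \<in> M" for x y
  proof
    assume "\<pi> x = \<pi> y"
    moreover have "(\<lambda>i::nat. if i = 0 then x else 0) \<in> \<pi> x" using lin_closedD(1)[OF M(1)] by (auto simp: \<pi>_def)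
    ultimately have "(\<lambda>i::nat. if i = 0 then x else 0) \<in> \<pi> y" by simp
    then obtain z where z: "(\<lambda>i::nat. if i = 0 then x else 0) = (\<lambda>i. if i = 0 then z else 0)" "z - y \<in> M"
      by (auto simp: \<pi>_def)
    show "x - y \<in> M" using fun_cong[OF z(1), of 0] z(2) by simp
  next
    assume xy: "x - y \<in> M"
    have "z - x \<in> M \<longleftrightarrow> z - y \<in> M" for z
      using lin_closedD(2)[OF M(1) _ xy, of "z - x"] lin_closedD(2)[OF M(1) _ lin_closed_uminus[OF module_times M(1) xy], of "z - y"]
      by (auto simp: algebra_simps)
    then show "\<pi> x = \<pi> y" by (simp add: \<pi>_def)
  qed
  have triv: "lin_closed (*) (UNIV :: 'n diffop set)" by (auto simp: lin_closed_def)
  interpret Q: quotient_map \<pi> "(*)" UNIV M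
    by (rule quotient_map.intro[OF module_times triv M(1)]) (rule fibres)
  let ?Q = "quotient_module \<pi> (*) UNIV"
  have "\<pi> 1 \<noteq> \<pi> 0" using fibres[of 1 0] M(2) by simp
  then have "carrier ?Q \<noteq> {\<zero>\<^bsub>?Q\<^esub>}" unfolding Q.quotient_carrier Q.quotient_zero by blast
  then obtain h u where h: "h \<in> mod_hom diffop_ring ?Q (dist_A_module F)" "u \<in> carrier ?Q" "h u \<noteq> 0"
    using cogenerator Q.quotient_is_module unfolding injective_cogenerator_def zero_module_on by meson
  define T where "T = h (\<pi> 1)"
  have hx: "h (\<pi> x) = act x T" for x
  proof -
    have "h (x \<odot>\<^bsub>?Q\<^esub> \<pi> 1) = act x (h (\<pi> 1))"
      using h(1) by (simp add: mod_hom_def Q.quotient_carrier ring_of_type_algebra_def)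
    then show ?thesis by (simp add: Q.quotient_smult T_def)
  qed
  have T: "T \<in> F" using h(1) by (auto simp: mod_hom_def hom_def Q.quotient_carrier T_def)
  have "act a T = 0" if "a \<in> M" for a
  proof -
    have "\<pi> a = \<pi> 0" using fibres[of a 0] that by simp
    then have "act a T = act 0 T" using hx by metis
    then show ?thesis using act_zero_left[OF T] by simp
  qed
  moreover have "T \<noteq> 0"
  proof
    assume "T = 0"
    obtain x where "u = \<pi> x" using h(2) by (auto simp: Q.quotient_carrier)
    then show False using h(3) hx[of x] \<open>T = 0\<close> by (simp add: act_zero_right)
  qed
  ultimately show ?thesis using T by blast
qed

text \<open>Enlarge \<open>I\<close> to a maximal ideal; it contains some \<open>D\<^sub>j - c\<^sub>j\<close> for every \<open>j\<close>, so the distribution that it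
  annihilates is an exponential up to a factor.\<close>
lemma exists_annihilated_full_support:
  fixes I :: "'n diffop set"
  assumes I: "lin_closed (*) I" "1 \<notin> I"
  shows "\<exists>T\<in>F. (\<forall>a\<in>I. act a T = 0) \<and> (\<forall>W. open W \<longrightarrow> W \<noteq> {} \<longrightarrow> \<not> eq_on_open W T 0)"
proof -
  obtain M where M: "lin_closed (*) M" "I \<subseteq> M" "1 \<notin> M" "\<And>x. x \<notin> M \<Longrightarrow> \<exists>r. r * x - 1 \<in> M"
    using maximal_ideal_exists[OF I] by blast
  obtain T where T: "T \<in> F" "T \<noteq> 0" "\<And>a. a \<in> M \<Longrightarrow> act a T = 0" using exists_annihilated[OF M(1,3)] by blast
  have "\<exists>c. var_poly j - const_poly c \<in> M" for j :: 'n
    by (rule maximal_ideal_contains_linear[OF M(1,3,4)])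
  then obtain c where c: "\<And>j. var_poly j - const_poly (c j) \<in> M" by metis
  have "partial_dist j T = scale_dist ((\<chi> j. \<i> * c j) $ j) T" for j
  proof -
    have "act (var_poly j + - const_poly (c j)) T = 0" using T(3)[OF c[of j]] by simp
    then have "D_op j T = scale_dist (c j) T"
      unfolding act_add_left[OF T(1)] act_uminus[OF T(1)] act_var act_const by simp
    then have "scale_dist \<i> (D_op j T) = scale_dist (\<i> * c j) T" by (simp add: scale_dist_scale)
    then show ?thesis by (simp add: D_op_def scale_dist_scale scale_dist_1)
  qed
  then have "\<not> eq_on_open W T 0" if "open W" "W \<noteq> {}" for W
    using eigen_dist_zero[of T] that T(2) by blast
  then show ?thesis using T M(2) by blast
qed

end

section \<open>Torsion and saturation\<close>

definition saturation :: "('n::finite diffop^'k) set \<Rightarrow> ('n diffop^'k) set" where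
  "saturation P = {x. \<exists>a. a \<noteq> 0 \<and> a *s x \<in> P}"

lemma subset_saturation: "P \<subseteq> saturation P"
  unfolding saturation_def by (auto intro!: exI[of _ 1])

lemma lin_closed_saturation:
  assumes P: "lin_closed (*s) P"
  shows "lin_closed (*s) (saturation P)"
  unfolding lin_closed_def
proof (intro conjI ballI allI)
  show "0 \<in> saturation P" using subset_saturation lin_closedD(1)[OF P] by blast
  fix x assume "x \<in> saturation P"
  then obtain a where a: "a \<noteq> 0" "a *s x \<in> P" by (auto simp: saturation_def)
  have "a *s (b *s x) = b *s (a *s x)" for b by (simp add: vector_smult_assoc mult.commute)
  then show "b *s x \<in> saturation P" for b
    using a lin_closedD(3)[OF P a(2), of b] by (auto simp: saturation_def)
  fix y assume "y \<in> saturation P"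
  then obtain b where b: "b \<noteq> 0" "b *s y \<in> P" by (auto simp: saturation_def)
  have "(a * b) *s (x + y) = b *s (a *s x) + a *s (b *s y)"
    by (simp add: vector_smult_assoc vector_add_ldistrib mult.commute)
  also have "\<dots> \<in> P" by (intro lin_closedD(2)[OF P] lin_closedD(3)[OF P] a(2) b(2))
  finally show "x + y \<in> saturation P"
    using diffop_no_zero_divisors[of a b] a(1) b(1) by (auto simp: saturation_def)
qed

lemma saturation_saturated:
  "a \<noteq> 0 \<Longrightarrow> a *s x \<in> saturation P \<Longrightarrow> x \<in> saturation P"
  using diffop_no_zero_divisors by (fastforce simp: saturation_def vector_smult_assoc)

text \<open>A submodule \<open>M\<close> maximal with \<open>M \<inter> saturation P \<subseteq> P\<close>. An element \<open>x\<close> without nonzero multiple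
  in \<open>M\<close> could be adjoined: if \<open>m + r x\<close> has a nonzero multiple by \<open>b\<close> in \<open>P \<subseteq> M\<close>, then \<open>b r x \<in> M\<close>, so
  \<open>r = 0\<close> since there are no zero divisors.\<close>
lemma complement_of_saturation:
  fixes P :: "('n::finite diffop^'k) set"
  assumes P: "lin_closed (*s) P"
  shows "\<exists>M. lin_closed (*s) M \<and> P \<subseteq> M \<and> M \<inter> saturation P \<subseteq> P \<and> saturation M = UNIV"
proof -
  obtain M where M: "lin_closed (*s) M" "P \<subseteq> M" "M \<inter> saturation P \<subseteq> P"
    and max: "\<And>N. lin_closed (*s) N \<Longrightarrow> M \<subseteq> N \<Longrightarrow> N \<inter> saturation P \<subseteq> P \<Longrightarrow> N = M"
    using maximal_submodule_meeting[OF P, of "saturation P" P] by blast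
  have "x \<in> saturation M" for x
  proof (rule ccontr)
    assume x: "x \<notin> saturation M"
    then have free: "a = 0" if "a *s x \<in> M" for a using that by (auto simp: saturation_def)
    let ?N = "{m + r *s x | m r. m \<in> M}"
    have "?N \<inter> saturation P \<subseteq> P"
    proof
      fix y assume "y \<in> ?N \<inter> saturation P"
      then obtain m r where y: "y = m + r *s x" "m \<in> M" "y \<in> saturation P" by blast
      then obtain b where b: "b \<noteq> 0" "b *s y \<in> P" by (auto simp: saturation_def)
      have "(b * r) *s x = b *s y + (- b) *s m"
        using y(1) by (simp add: vector_add_ldistrib vector_smult_assoc vec_module.scale_minus_left)
      also have "\<dots> \<in> M"
        by (rule lin_closedD(2)[OF M(1) subsetD[OF M(2) b(2)] lin_closedD(3)[OF M(1) y(2)]])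
      finally have "r = 0" using free diffop_no_zero_divisors b(1) by blast
      then show "y \<in> P" using y M(3) by auto
    qed
    moreover have "m = m + 0 *s x" "x = 0 + 1 *s x" for m :: "'n diffop^'k" by simp_all
    then have "M \<subseteq> ?N" "x \<in> ?N" using lin_closedD(1)[OF M(1)] by blast+
    ultimately have "x \<in> M" using max[OF lin_closed_adjoin[OF module_vec M(1)]] by blast
    then show False using x subset_saturation by blast
  qed
  then show ?thesis using M by blast
qed

text \<open>A finitely generated torsion-free module embeds in a free one. Choose a maximal set \<open>J\<close> of unit
  vectors that is linearly independent modulo \<open>P\<close>. With a common denominator \<open>B \<noteq> 0\<close>, every \<open>B e\<^sub>i\<close> is congruent
  modulo \<open>P\<close> to a combination \<open>C i\<close> of the \<open>e\<^sub>j\<close>, \<open>j \<in> J\<close>. So \<open>B x\<close> is congruent to \<open>\<Sum>\<^sub>i x\<^sub>i C\<^sub>i\<close>, which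
  lies in \<open>P\<close> only if it is zero.\<close>
lemma saturated_is_kernel:
  fixes P :: "('n::finite diffop^'k::finite) set"
  assumes P: "lin_closed (*s) P" and sat: "\<And>a x. a \<noteq> 0 \<Longrightarrow> a *s x \<in> P \<Longrightarrow> x \<in> P"
  shows "\<exists>C :: 'k \<Rightarrow> 'n diffop^'k. \<forall>x. x \<in> P \<longleftrightarrow> (\<Sum>i\<in>UNIV. x $ i *s C i) = 0"
proof -
  let ?e = "\<lambda>j. axis j 1 :: 'n diffop^'k"
  have P_sum: "sum f J \<in> P" if "\<And>i. i \<in> J \<Longrightarrow> f i \<in> P" for f and J :: "'k set"
    using that by (induction J rule: infinite_finite_induct) (auto intro: lin_closedD[OF P])
  define indep where "indep J \<longleftrightarrow> (\<forall>a. (\<Sum>j\<in>J. a j *s ?e j) \<in> P \<longrightarrow> (\<forall>j\<in>J. a j = 0))" for J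
  have "indep {}" by (simp add: indep_def)
  moreover have "\<forall>J. indep J \<longrightarrow> card J < Suc (CARD('k))" by (simp add: card_mono less_Suc_eq_le)
  ultimately have "\<exists>J. indep J \<and> (\<forall>J'. indep J' \<longrightarrow> card J' \<le> card J)"
    by (rule ex_has_greatest_nat)
  then obtain J where J: "indep J" "\<And>J'. indep J' \<Longrightarrow> card J' \<le> card J" by blast
  have "\<exists>b a. b \<noteq> 0 \<and> b *s ?e i - (\<Sum>j\<in>J. a j *s ?e j) \<in> P" for i
  proof (cases "i \<in> J")
    case True
    have "(\<Sum>j\<in>J. (if j = i then 1 else 0) *s ?e j) = (\<Sum>j\<in>J. if j = i then ?e i else 0)"
      by (rule sum.cong) auto
    also have "\<dots> = ?e i" using True by simp
    finally have "1 *s ?e i - (\<Sum>j\<in>J. (if j = i then 1 else 0) *s ?e j) \<in> P"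
      using lin_closedD(1)[OF P] by simp
    moreover have "(1 :: 'n diffop) \<noteq> 0" by simp
    ultimately show ?thesis by (intro exI conjI)
  next
    case False
    then have "\<not> indep (insert i J)" using J(2)[of "insert i J"] by auto
    then obtain a where a: "(\<Sum>j\<in>insert i J. a j *s ?e j) \<in> P" "\<exists>j\<in>insert i J. a j \<noteq> 0"
      by (auto simp: indep_def)
    have "a i \<noteq> 0"
    proof
      assume "a i = 0"
      then have "(\<Sum>j\<in>J. a j *s ?e j) \<in> P" using a(1) False by simp
      then have "\<forall>j\<in>J. a j = 0" using J(1) by (simp add: indep_def)
      then show False using a(2) \<open>a i = 0\<close> by blast
    qed
    moreover have "a i *s ?e i - (\<Sum>j\<in>J. (- a j) *s ?e j) \<in> P"
      using a(1) False by (simp add: sum_negf vec_module.scale_minus_left)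
    ultimately show ?thesis by (intro exI conjI)
  qed
  then have "\<forall>i. \<exists>b. \<exists>a. b \<noteq> 0 \<and> b *s ?e i - (\<Sum>j\<in>J. a j *s ?e j) \<in> P" by (intro allI)
  from choice[OF this] obtain b where "\<forall>i. \<exists>a. b i \<noteq> 0 \<and> b i *s ?e i - (\<Sum>j\<in>J. a j *s ?e j) \<in> P" by (elim exE)
  from choice[OF this] obtain a where "\<forall>i. b i \<noteq> 0 \<and> b i *s ?e i - (\<Sum>j\<in>J. a i j *s ?e j) \<in> P" by (elim exE)
  note ba = this[THEN spec, THEN conjunct1] this[THEN spec, THEN conjunct2]
  define B where "B = (\<Prod>i\<in>UNIV. b i)"
  define B' where "B' i = (\<Prod>l\<in>UNIV - {i}. b l)" for i
  have BB': "B = B' i * b i" for i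
    unfolding B_def B'_def by (subst prod.remove[of UNIV i]) (auto simp: mult.commute)
  have B0: "B \<noteq> 0" unfolding B_def using ba(1) by (intro diffop_prod_nonzero) auto
  define C where "C i = (\<Sum>j\<in>J. (B' i * a i j) *s ?e j)" for i
  have diff: "B *s x - (\<Sum>i\<in>UNIV. x $ i *s C i) \<in> P" for x
  proof -
    have "B *s x = B *s (\<Sum>i\<in>UNIV. x $ i *s ?e i)" by (simp add: basis_expansion)
    also have "\<dots> = (\<Sum>i\<in>UNIV. B *s (x $ i *s ?e i))" by (rule vec_module.scale_sum_right)
    also have "\<dots> = (\<Sum>i\<in>UNIV. x $ i *s (B' i *s (b i *s ?e i)))"
    proof (rule sum.cong)
      show "B *s (x $ i *s ?e i) = x $ i *s (B' i *s (b i *s ?e i))" for i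
        unfolding BB'[of i] by (simp only: vector_smult_assoc mult_ac)
    qed simp
    finally have "B *s x - (\<Sum>i\<in>UNIV. x $ i *s C i)
       = (\<Sum>i\<in>UNIV. x $ i *s (B' i *s (b i *s ?e i)) - x $ i *s C i)" by (simp add: sum_subtractf)
    also have "\<dots> = (\<Sum>i\<in>UNIV. x $ i *s (B' i *s (b i *s ?e i - (\<Sum>j\<in>J. a i j *s ?e j))))"
      by (simp add: C_def vec_module.scale_sum_right vector_smult_assoc vec_module.scale_right_diff_distrib)
    also have "\<dots> \<in> P" using ba(2) by (intro P_sum lin_closedD(3)[OF P])
    finally show ?thesis .
  qed
  have "x \<in> P \<longleftrightarrow> (\<Sum>i\<in>UNIV. x $ i *s C i) = 0" for x
  proof
    assume x: "x \<in> P"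
    let ?y = "\<Sum>i\<in>UNIV. x $ i *s C i"
    have "?y = B *s x + - (B *s x - ?y)" by simp
    also have "\<dots> \<in> P"
      by (intro lin_closedD(2)[OF P] lin_closedD(3)[OF P] x lin_closed_uminus[OF module_vec P] diff)
    also have y: "?y = (\<Sum>j\<in>J. (\<Sum>i\<in>UNIV. x $ i * (B' i * a i j)) *s ?e j)"
    proof -
      have "?y = (\<Sum>i\<in>UNIV. \<Sum>j\<in>J. (x $ i * (B' i * a i j)) *s ?e j)"
        by (simp add: C_def vec_module.scale_sum_right vector_smult_assoc)
      also have "\<dots> = (\<Sum>j\<in>J. \<Sum>i\<in>UNIV. (x $ i * (B' i * a i j)) *s ?e j)" by (rule sum.swap)
      finally show ?thesis by (simp add: vec_module.scale_sum_left)
    qed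
    finally have "(\<Sum>j\<in>J. (\<Sum>i\<in>UNIV. x $ i * (B' i * a i j)) *s ?e j) \<in> P" .
    from J(1)[unfolded indep_def, THEN spec, THEN mp, OF this]
    have "\<forall>j\<in>J. (\<Sum>i\<in>UNIV. x $ i * (B' i * a i j)) = 0" .
    then show "?y = 0" unfolding y by simp
  next
    assume "(\<Sum>i\<in>UNIV. x $ i *s C i) = 0"
    then have "B *s x \<in> P" using diff[of x] by simp
    then show "x \<in> P" by (rule sat[OF B0])
  qed
  then show ?thesis by blast
qed

section \<open>Controllability\<close>

context dist_cogenerator
begin

text \<open>With \<open>C\<close> from \<open>saturated_is_kernel\<close>, the map \<open>Y x = \<Sum>\<^sub>i x\<^sub>i C\<^sub>i\<close> has kernel \<open>P\<close>. For \<open>f \<in> Ker P\<close> the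
  homomorphism \<open>x \<mapsto> x \<cdot> f\<close> factors through the image of \<open>Y\<close> and extends to \<open>A\<^sup>k\<close>, which gives a potential
  \<open>g\<close> with \<open>f\<^sub>i = C\<^sub>i \<cdot> g\<close>. The components of potentials are arbitrary elements of \<open>F\<close> and can be patched one
  by one; differential operators are local, so the patched potential yields a patched solution.\<close>
lemma saturated_Ker_controllable:
  fixes P :: "('n diffop^'k::finite) set"
  assumes P: "lin_closed (*s) P" and sat: "\<And>a x. a \<noteq> 0 \<Longrightarrow> a *s x \<in> P \<Longrightarrow> x \<in> P"
  shows "controllable F (Ker F P)"
proof -
  have "\<exists>C :: 'k \<Rightarrow> 'n diffop^'k. \<forall>x. x \<in> P \<longleftrightarrow> (\<Sum>i\<in>UNIV. x $ i *s C i) = 0"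
    by (rule saturated_is_kernel[OF P]) (rule sat)
  then obtain C :: "'k \<Rightarrow> 'n diffop^'k" where C': "\<forall>x. x \<in> P \<longleftrightarrow> (\<Sum>i\<in>UNIV. x $ i *s C i) = 0"
    by (elim exE)
  define Y where "Y x = (\<Sum>i\<in>UNIV. x $ i *s C i)" for x
  have C: "x \<in> P \<longleftrightarrow> Y x = 0" for x by (simp add: C' Y_def)
  have Y_add: "Y (x + y) = Y x + Y y" for x y by (simp add: Y_def vector_sadd_rdistrib sum.distrib)
  have Y_smult: "Y (a *s x) = a *s Y x" for a x by (simp add: Y_def vec_module.scale_sum_right vector_smult_assoc)
  have Y_axis: "Y (axis i 1) = C i" for i
  proof -
    have "Y (axis i 1) = (\<Sum>l\<in>UNIV. if l = i then C i else 0)"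
      unfolding Y_def by (rule sum.cong) (auto simp: axis_def)
    then show ?thesis by simp
  qed
  have image: "\<exists>g. (\<forall>j. g $ j \<in> F) \<and> f = (\<chi> i. pairing (C i) g)" if f: "f \<in> Ker F P" for f
  proof -
    have fF: "\<And>j. f $ j \<in> F" and f0: "\<And>p. p \<in> P \<Longrightarrow> pairing p f = 0" using f by (auto simp: Ker_iff)
    let ?G = "range (\<lambda>x. (Y x, pairing x f))"
    have GI: "(Y x, pairing x f) \<in> ?G" for x by (rule rangeI)
    have GE: "\<exists>v. x = Y v \<and> t = pairing v f" if "(x, t) \<in> ?G" for x t using that by (elim rangeE, intro exI) simp
    have "\<exists>g. (\<forall>j. g $ j \<in> F) \<and> (\<forall>x t. (x, t) \<in> ?G \<longrightarrow> pairing x g = t)"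
    proof (rule extend_graph)
      show "t \<in> F" if "(x, t) \<in> ?G" for x t using GE[OF that] pairing_mem[OF fF] by auto
      have "Y 0 = 0" using C[of 0] lin_closedD(1)[OF P] by simp
      then show "(0, 0) \<in> ?G" using GI[of 0] by (simp only: pairing_zero_left[OF fF])
      show "(x + y, t + s) \<in> ?G" if xy: "(x, t) \<in> ?G" "(y, s) \<in> ?G" for x t y s
      proof -
        obtain v where v: "x = Y v" "t = pairing v f" using GE[OF xy(1)] by blast
        obtain w where w: "y = Y w" "s = pairing w f" using GE[OF xy(2)] by blast
        show ?thesis using GI[of "v + w"] by (simp only: v w Y_add pairing_add_left[OF fF])
      qed
      show "(a *s x, act a t) \<in> ?G" if xt: "(x, t) \<in> ?G" for a x t
      proof -
        obtain v where v: "x = Y v" "t = pairing v f" using GE[OF xt] by blast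
        show ?thesis using GI[of "a *s v"] by (simp only: v Y_smult pairing_smult[OF fF])
      qed
      show "t = 0" if zt: "(0, t) \<in> ?G" for t
      proof -
        obtain v where "0 = Y v" "t = pairing v f" using GE[OF zt] by blast
        then show ?thesis using C[of v] f0[of v] by simp
      qed
    qed
    then obtain g where g: "\<And>j. g $ j \<in> F" "\<And>x. pairing (Y x) g = pairing x f" using GI by blast
    have "f $ i = pairing (C i) g" for i
      using g(2)[of "axis i 1"] unfolding Y_axis pairing_axis[OF fF] by simp
    then show ?thesis using g(1) by (intro exI[of _ g]) (simp add: vec_eq_iff)
  qed
  have conversely: "(\<chi> i. pairing (C i) g) \<in> Ker F P" if g: "\<And>j. g $ j \<in> F" for g
  proof -
    have "pairing x (\<chi> i. pairing (C i) g) = pairing (Y x) g" for x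
    proof -
      have "pairing (Y x) g = (\<Sum>i\<in>UNIV. act (x $ i) (pairing (C i) g))"
        by (simp add: Y_def pairing_sum_left[OF g] pairing_smult[OF g])
      then show ?thesis by (simp add: pairing_def[of x])
    qed
    then show ?thesis using C pairing_mem[OF g] by (auto simp: Ker_iff pairing_zero_left[OF g])
  qed
  show ?thesis
    unfolding controllable_def
  proof (intro allI impI ballI)
    fix U1 U2 f1 f2
    assume adm: "admissible F U1 U2" and f1: "f1 \<in> Ker F P" and f2: "f2 \<in> Ker F P"
    obtain g1 g2 where g1: "\<And>j. g1 $ j \<in> F" "f1 = (\<chi> i. pairing (C i) g1)"
      and g2: "\<And>j. g2 $ j \<in> F" "f2 = (\<chi> i. pairing (C i) g2)" using image[OF f1] image[OF f2] by blast
    have "\<forall>j. \<exists>t. t \<in> F \<and> eq_near U1 t (g1 $ j) \<and> eq_near U2 t (g2 $ j)"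
      using adm g1(1) g2(1) unfolding admissible_def by blast
    from choice[OF this] obtain t where t: "\<And>j. t j \<in> F" "\<And>j. eq_near U1 (t j) (g1 $ j)" "\<And>j. eq_near U2 (t j) (g2 $ j)"
      by blast
    let ?g = "\<chi> j. t j"
    have "eq_near U1 (pairing (C i) ?g) (pairing (C i) g1)" "eq_near U2 (pairing (C i) ?g) (pairing (C i) g2)" for i
      by (rule pairing_local; simp add: t g1 g2)+
    then show "\<exists>f\<in>Ker F P. \<forall>j. eq_near U1 (f $ j) (f1 $ j) \<and> eq_near U2 (f $ j) (f2 $ j)"
      unfolding g1(2) g2(2) by (intro bexI[of _ "\<chi> i. pairing (C i) ?g"] conversely) (auto simp: t)
  qed
qed

text \<open>The core of the argument: controllability cuts \<open>f\<close> off to some \<open>g\<close> without leaving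
  \<open>Ker Q\<close>, and \<open>x \<cdot> g\<close> is zero, being compactly supported and annihilated by some \<open>a \<noteq> 0\<close>. This makes \<open>x \<cdot> f\<close> vanish near one fixed set \<open>U\<close> for all \<open>f \<in> Ker Q\<close>,
  whereas by injectivity and the cogenerator property some \<open>x \<cdot> f\<close> is an exponential unless \<open>x \<in> Q\<close>.\<close>
lemma controllable_annihilates_torsion:
  fixes Q P :: "('n diffop^'k::finite) set"
  assumes cutoff: "cutoff F" and Q: "lin_closed (*s) Q" and contr: "controllable F (Ker F Q)"
    and sub: "Ker F Q \<subseteq> Ker F P" and x: "x \<in> saturation P" and f: "f \<in> Ker F Q"
  shows "pairing x f = 0"
proof -
  obtain a where a: "a \<noteq> 0" "a *s x \<in> P" using x by (auto simp: saturation_def)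
  let ?V = "cball 0 1 :: (real^'n) set"
  have "bounded ?V \<and> interior ?V \<noteq> {}" by simp
  then obtain U where U: "U \<noteq> {}" "admissible F U (- ?V)"
    using cutoff unfolding cutoff_def by blast
  have vanish: "eq_near U 0 (pairing x f)" if f: "f \<in> Ker F Q" for f
  proof -
    obtain g where g: "g \<in> Ker F Q" "\<And>j. eq_near U (g $ j) (f $ j)" "\<And>j. eq_near (- ?V) (g $ j) (0 $ j)"
      using contr[unfolded controllable_def] U(2) f zero_in_Ker[of Q] by meson
    have gF: "\<And>j. g $ j \<in> F" and fF: "\<And>j. f $ j \<in> F" using g(1) f by (auto simp: Ker_iff)
    have zF: "\<And>j. (0 :: 'n distribution^'k) $ j \<in> F" by (simp add: zero_mem)
    have "pairing x g = 0"
    proof (rule compact_support_zero[OF pairing_mem[OF gF] _ bounded_cball a(1)])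
      show "eq_near (- ?V) (pairing x g) 0"
        using pairing_local[OF gF zF g(3), of x] by (simp add: pairing_zero_right)
      show "act a (pairing x g) = 0"
        using subsetD[OF sub g(1)] a(2) by (simp add: Ker_iff flip: pairing_smult[OF gF])
    qed
    then show ?thesis using pairing_local[OF gF fF g(2), of x] by simp
  qed
  have "x \<in> Q"
  proof (rule ccontr)
    assume "x \<notin> Q"
    let ?I = "{r. r *s x \<in> Q}"
    have I: "lin_closed (*) ?I"
      unfolding lin_closed_def
    proof (intro conjI ballI allI CollectI)
      show "0 *s x \<in> Q" using lin_closedD(1)[OF Q] by simp
      fix r assume r: "r \<in> ?I"
      have "b *s (r *s x) \<in> Q" for b by (rule lin_closedD(3)[OF Q]) (use r in simp)
      then show "(b * r) *s x \<in> Q" for b by (simp only: vector_smult_assoc)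
      fix s assume "s \<in> ?I"
      then have "r *s x + s *s x \<in> Q" using r by (intro lin_closedD(2)[OF Q]) simp_all
      then show "(r + s) *s x \<in> Q" by (simp only: vector_sadd_rdistrib)
    qed
    have "1 \<notin> ?I" using \<open>x \<notin> Q\<close> by simp
    from exists_annihilated_full_support[OF I this] obtain T where T: "T \<in> F" "\<forall>r\<in>?I. act r T = 0"
      and supp: "\<forall>W. open W \<longrightarrow> W \<noteq> {} \<longrightarrow> \<not> eq_on_open W T 0" by (elim bexE conjE)
    \<comment> \<open>The graph of the homomorphism \<open>q + r x \<mapsto> r T\<close> on \<open>Q + A x\<close>, well defined because \<open>(Q : x)\<close> annihilates \<open>T\<close>.\<close>
    let ?G = "{(q + r *s x, act r T) | q r. q \<in> Q}"
    have GI: "(q + r *s x, act r T) \<in> ?G" if "q \<in> Q" for q r using that by blast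
    have "\<exists>g. (\<forall>j. g $ j \<in> F) \<and> (\<forall>y t. (y, t) \<in> ?G \<longrightarrow> pairing y g = t)"
    proof (rule extend_graph)
      show "t \<in> F" if "(y, t) \<in> ?G" for y t using that act_closed[OF T(1)] by auto
      show "(0, 0) \<in> ?G" using GI[OF lin_closedD(1)[OF Q], of 0] by (simp add: act_zero_left[OF T(1)])
      show "(y + z, t + s) \<in> ?G" if yz: "(y, t) \<in> ?G" "(z, s) \<in> ?G" for y t z s
      proof -
        obtain q r q' r' where qr: "y = q + r *s x" "t = act r T" "q \<in> Q" "z = q' + r' *s x" "s = act r' T" "q' \<in> Q"
          using yz by blast
        have "y + z = (q + q') + (r + r') *s x" "t + s = act (r + r') T"
          using qr by (simp_all add: vector_sadd_rdistrib act_add_left[OF T(1)] add_ac)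
        then show ?thesis using GI[OF lin_closedD(2)[OF Q qr(3,6)], of "r + r'"] by simp
      qed
      show "(b *s y, act b t) \<in> ?G" if yt: "(y, t) \<in> ?G" for b y t
      proof -
        obtain q r where qr: "y = q + r *s x" "t = act r T" "q \<in> Q" using yt by blast
        have "b *s y = b *s q + (b * r) *s x" "act b t = act (b * r) T"
          using qr by (simp_all add: vector_add_ldistrib vector_smult_assoc act_mult[OF T(1)])
        then show ?thesis using GI[OF lin_closedD(3)[OF Q qr(3)], of b "b * r"] by simp
      qed
      show "t = 0" if "(0, t) \<in> ?G" for t
      proof -
        obtain q r where qr: "0 = q + r *s x" "t = act r T" "q \<in> Q" using \<open>(0, t) \<in> ?G\<close> by blast
        have "r *s x = - q" using qr(1) by (metis add.commute eq_neg_iff_add_eq_0)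
        then show ?thesis using T(2) qr(2) lin_closed_uminus[OF module_vec Q qr(3)] by simp
      qed
    qed
    then obtain g where gF: "\<And>j. g $ j \<in> F" and g: "\<And>y t. (y, t) \<in> ?G \<Longrightarrow> pairing y g = t" by blast
    have "pairing q g = 0" if "q \<in> Q" for q
      using g[OF GI[OF that, of 0]] by (simp add: act_zero_left[OF T(1)])
    then have "g \<in> Ker F Q" using gF by (simp add: Ker_iff)
    moreover have "pairing x g = T"
      using g[OF GI[OF lin_closedD(1)[OF Q], of 1]] by (simp add: act_1[OF T(1)])
    ultimately have "eq_near U 0 T" using vanish by blast
    then obtain W where W: "open W" "U \<subseteq> W" "eq_on_open W 0 T" by (auto simp: eq_near_def)
    then show False using supp[rule_format, OF W(1)] U(1) by (auto simp: eq_on_open_def)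
  qed
  then show ?thesis using f by (simp add: Ker_iff)
qed

text \<open>Every unit vector is torsion modulo \<open>M\<close>, so every component of an element of a controllable
  sub-system vanishes.\<close>
lemma torsion_Ker_uncontrollable:
  fixes M :: "('n diffop^'k::finite) set"
  assumes cutoff: "cutoff F" and M: "saturation M = UNIV"
  shows "uncontrollable F (Ker F M)"
  unfolding uncontrollable_def
proof (intro allI impI notI)
  fix B' assume B': "subsystem F B' (Ker F M) \<and> B' \<noteq> {0}" and contr: "controllable F B'"
  then obtain Q where Q: "lin_closed (*s) Q" "B' = Ker F Q" "Ker F Q \<subseteq> Ker F M"
    by (auto simp: subsystem_def is_system_def submodule_iff)
  have "f = 0" if f: "f \<in> Ker F Q" for f
  proof -
    have fF: "\<And>j. f $ j \<in> F" using f by (simp add: Ker_iff)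
    have "f $ j = 0" for j
      using controllable_annihilates_torsion[OF cutoff Q(1) _ Q(3) _ f, of "axis j 1"] contr Q(2) M pairing_axis[OF fF]
      by simp
    then show ?thesis by (simp add: vec_eq_iff)
  qed
  then have "B' = {0}" using zero_in_Ker Q(2) by blast
  then show False using B' by blast
qed

lemma controllable_part_saturation:
  fixes P :: "('n diffop^'k::finite) set"
  assumes cutoff: "cutoff F" and P: "lin_closed (*s) P"
  shows "is_controllable_part F (Ker F P) (Ker F (saturation P))"
  unfolding is_controllable_part_def
proof (intro conjI allI impI)
  show "subsystem F (Ker F (saturation P)) (Ker F P)"
    using lin_closed_saturation[OF P] Ker_antimono[OF subset_saturation[of P]]
    by (auto simp: subsystem_def is_system_def submodule_iff)
  show "controllable F (Ker F (saturation P))"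
    by (rule saturated_Ker_controllable[OF lin_closed_saturation[OF P] saturation_saturated])
  fix C' assume C': "subsystem F C' (Ker F P) \<and> controllable F C'"
  then obtain Q where Q: "lin_closed (*s) Q" "C' = Ker F Q" "Ker F Q \<subseteq> Ker F P"
    by (auto simp: subsystem_def is_system_def submodule_iff)
  show "C' \<subseteq> Ker F (saturation P)"
    using controllable_annihilates_torsion[OF cutoff Q(1) _ Q(3)] C' unfolding Q(2) by (auto simp: Ker_iff)
qed

text \<open>For an injective \<open>F\<close> the kernel functor turns intersections of submodules into sums. The graph \<open>G\<close> is
  that of the homomorphism on \<open>S + M\<close> equal to \<open>0\<close> on \<open>S\<close> and to \<open>f\<close> on \<open>M\<close>.\<close>
lemma Ker_decompose:
  fixes P S M :: "('n diffop^'k::finite) set"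
  assumes S: "lin_closed (*s) S" and M: "lin_closed (*s) M" and sub: "S \<inter> M \<subseteq> P" and f: "f \<in> Ker F P"
  shows "\<exists>g\<in>Ker F S. \<exists>h\<in>Ker F M. f = g + h"
proof -
  have fF: "\<And>j. f $ j \<in> F" and f0: "\<And>p. p \<in> P \<Longrightarrow> pairing p f = 0" using f by (auto simp: Ker_iff)
  let ?G = "{(p + m, pairing m f) | p m. p \<in> S \<and> m \<in> M}"
  have GI: "(p + m, pairing m f) \<in> ?G" if "p \<in> S" "m \<in> M" for p m using that by blast
  have "\<exists>g. (\<forall>j. g $ j \<in> F) \<and> (\<forall>y t. (y, t) \<in> ?G \<longrightarrow> pairing y g = t)"
  proof (rule extend_graph)
    show "t \<in> F" if "(y, t) \<in> ?G" for y t using that pairing_mem[OF fF] by auto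
    show "(0, 0) \<in> ?G" using GI[OF lin_closedD(1)[OF S] lin_closedD(1)[OF M]] by (simp add: pairing_zero_left[OF fF])
    show "(y + z, t + s) \<in> ?G" if yz: "(y, t) \<in> ?G" "(z, s) \<in> ?G" for y t z s
    proof -
      obtain p m p' m' where pm: "y = p + m" "t = pairing m f" "p \<in> S" "m \<in> M" "z = p' + m'" "s = pairing m' f" "p' \<in> S" "m' \<in> M"
        using yz by blast
      have "y + z = (p + p') + (m + m')" "t + s = pairing (m + m') f"
        using pm by (simp_all add: pairing_add_left[OF fF] add_ac)
      then show ?thesis using GI[OF lin_closedD(2)[OF S pm(3,7)] lin_closedD(2)[OF M pm(4,8)]] by simp
    qed
    show "(b *s y, act b t) \<in> ?G" if yt: "(y, t) \<in> ?G" for b y t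
    proof -
      obtain p m where pm: "y = p + m" "t = pairing m f" "p \<in> S" "m \<in> M" using yt by blast
      have "b *s y = b *s p + b *s m" "act b t = pairing (b *s m) f"
        using pm by (simp_all add: vector_add_ldistrib pairing_smult[OF fF])
      then show ?thesis using GI[OF lin_closedD(3)[OF S pm(3)] lin_closedD(3)[OF M pm(4)], of b b] by simp
    qed
    show "t = 0" if "(0, t) \<in> ?G" for t
    proof -
      obtain p m where pm: "0 = p + m" "t = pairing m f" "p \<in> S" "m \<in> M" using \<open>(0, t) \<in> ?G\<close> by blast
      have "m = - p" using pm(1) by (metis add.commute eq_neg_iff_add_eq_0)
      then have "m \<in> P" using lin_closed_uminus[OF module_vec S pm(3)] pm(4) sub by blast
      then show ?thesis using f0 pm(2) by simp
    qed
  qed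
  then obtain g where gF: "\<And>j. g $ j \<in> F" and g: "\<And>y t. (y, t) \<in> ?G \<Longrightarrow> pairing y g = t" by blast
  have "pairing p g = 0" if "p \<in> S" for p
    using g[OF GI[OF that lin_closedD(1)[OF M]]] by (simp add: pairing_zero_left[OF fF])
  then have gS: "g \<in> Ker F S" using gF by (simp add: Ker_iff)
  have ngF: "\<And>j. (- g) $ j \<in> F" using gF uminus_mem by simp
  have "pairing m (f + - g) = 0" if "m \<in> M" for m
    using g[OF GI[OF lin_closedD(1)[OF S] that]]
    by (simp only: pairing_add_right[OF fF ngF] pairing_uminus_right[OF gF]) simp
  moreover have "(f + - g) $ j \<in> F" for j
    unfolding vector_add_component by (rule add_closed[OF fF ngF])
  ultimately have "f + - g \<in> Ker F M" by (simp add: Ker_iff)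
  then show ?thesis using gS by (intro bexI[of _ g] bexI[of _ "f + - g"]) auto
qed

end

section \<open>The decomposition\<close>

theorem theorem4p1:
  fixes F :: "'n::finite distribution set"
    and P :: "('n diffop^'k::finite) set"
  assumes "submodule F diffop_ring (dist_A_module UNIV)"
    and "injective_cogenerator TYPE('n universe) diffop_ring (dist_A_module F)"
    and "cutoff F"
    and "submodule P diffop_ring free_A_module"
    and "P \<noteq> UNIV"
  shows "\<exists>C U. is_controllable_part F (Ker F P) C \<and>
           subsystem F U (Ker F P) \<and> uncontrollable F U \<and>
           Ker F P = {f + g | f g. f \<in> C \<and> g \<in> U}"
proof -
  interpret dist_cogenerator F
    using assms(2) by (intro dist_cogenerator.intro dist_module.intro dist_cogenerator_axioms.intro)
      (simp_all add: injective_cogenerator_def injective_module_def)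
  have P: "lin_closed (*s) P" using assms(4) by (simp add: submodule_iff)
  obtain M where M: "lin_closed (*s) M" "P \<subseteq> M" "M \<inter> saturation P \<subseteq> P" "saturation M = UNIV"
    using complement_of_saturation[OF P] by blast
  let ?C = "Ker F (saturation P)" and ?U = "Ker F M"
  have part: "is_controllable_part F (Ker F P) ?C" by (rule controllable_part_saturation[OF assms(3) P])
  have sub: "subsystem F ?U (Ker F P)"
    using M(1) Ker_antimono[OF M(2)] by (auto simp: subsystem_def is_system_def submodule_iff)
  have "Ker F P = {f + g | f g. f \<in> ?C \<and> g \<in> ?U}"
  proof (intro equalityI subsetI)
    fix f assume "f \<in> Ker F P"
    then show "f \<in> {f + g | f g. f \<in> ?C \<and> g \<in> ?U}"
      using Ker_decompose[OF lin_closed_saturation[OF P] M(1)] M(3) by blast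
  next
    fix f assume "f \<in> {f + g | f g. f \<in> ?C \<and> g \<in> ?U}"
    then obtain g h where "f = g + h" "g \<in> Ker F P" "h \<in> Ker F P"
      using part sub by (auto simp: is_controllable_part_def subsystem_def)
    then show "f \<in> Ker F P" by (auto simp: Ker_iff add_closed pairing_add_right)
  qed
  with part sub torsion_Ker_uncontrollable[OF assms(3) M(4)] show ?thesis by blast
qed

end
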